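(* Let $\lambda_1,\lambda_2,\alpha\in\Bbbk$ with $\alpha=0$ if $\lambda_1\ne\lambda_2$ and $\alpha\in\{0,1\}$ if $\lambda_1=\lambda_2$, and let $H=A(\lambda_1,\lambda_2,\alpha)$, with generators $z_1=Y$, $z_2=X$, $z_3=Z$. The right coideal subalgebras of $H$ are exactly: $\Bbbk$; $H$; those of GK-dimension $1$, namely $\Bbbk[aX+bY]$, parameterized by $[a,b]\in\mathbb P^1(\Bbbk)$; and the following ones of GK-dimension $2$ (each an Ore extension as indicated): (i) for all parameters: $\Bbbk[z_1][z_2]$; (ii) for all parameters: $\Bbbk[z_1][z_3+cz_2-z_1z_2;\delta]$ with $c\in\Bbbk$ and $\delta(z_1)=\lambda_2z_1$; (iii) if $\lambda_1\neq\lambda_2$ (so $\alpha=0$): $\Bbbk[z_2][z_3+bz_1+z_1z_2;\delta]$ with $b\in\Bbbk$ and $\delta(z_2)=\lambda_1z_2$; (iv) if $\lambda_1=\lambda_2$ and $\alpha=0$: $\Bbbk[z_2+az_1][z_3+bz_1+az_1^2+z_1z_2;\delta]$ with $a,b\in\Bbbk$ and $\delta(z_2+az_1)=\lambda_1(z_2+az_1)$. In particular, if $\lambda_1=\lambda_2$ and $\alpha=1$, only (i) and (ii) occur in GK-dimension $2$.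
   Context: $\Bbbk$ is a field of characteristic zero. $A(\lambda_1,\lambda_2,\alpha)$ is the $\Bbbk$-algebra generated by $X,Y,Z$ with relations $[X,Y]=0$, $[Z,X]=\lambda_1X-\alpha Y$, $[Z,Y]=\lambda_2Y$. It is a connected Hopf algebra of GK-dimension 3 with $\Delta(X)=X\otimes1+1\otimes X$, $\Delta(Y)=Y\otimes1+1\otimes Y$, $\Delta(Z)=Z\otimes1+1\otimes Z+X\otimes Y-Y\otimes X$ (the counit kills $X,Y,Z$). A right coideal subalgebra is a subalgebra $A\subseteq H$ with $\Delta(A)\subseteq A\otimes H$. The notation $\Bbbk[u][v;\delta]$ for $u,v\in H$ means the subalgebra of $H$ generated by $u$ and $v$, which is the Ore extension of the polynomial algebra $\Bbbk[u]$ by $v$ with $vr=rv+\delta(r)$, $\delta$ a derivation of $\Bbbk[u]$; $\Bbbk[u][v]$ is the case $\delta=0$. *)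

theory Defs
  imports
    "HOL-Algebra.Embedded_Algebras"
    "HOL-Algebra.QuotRing"
    "HOL-Algebra.Module"
    "HOL-Library.Poly_Mapping"
    "HOL-Library.Extended_Real"
    "HOL-Library.Liminf_Limsup"
    "HOL-Computational_Algebra.Polynomial"
begin

section \<open>Algebras over a field\<close>

text \<open>A (not necessarily commutative) algebra over the field \<open>'k\<close> is represented by a record of type
  \<^typ>\<open>('k, 'a) module\<close>, which carries a ring structure together with a scalar multiplication.\<close>

definition subalg :: "'a set \<Rightarrow> ('k, 'a) module \<Rightarrow> bool" where
  "subalg S A \<longleftrightarrow> subring S A \<and> (\<forall>c. \<forall>x\<in>S. c \<odot>\<^bsub>A\<^esub> x \<in> S)"

definition lin_subspace :: "'a set \<Rightarrow> ('k, 'a) module \<Rightarrow> bool" where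
  "lin_subspace V A \<longleftrightarrow> subgroup V (add_monoid A) \<and> (\<forall>c. \<forall>x\<in>V. c \<odot>\<^bsub>A\<^esub> x \<in> V)"

definition alg_gen :: "('k, 'a) module \<Rightarrow> 'a set \<Rightarrow> 'a set" where
  "alg_gen A U = (\<lambda>S. subalg S A) hull U"

definition lin_span :: "('k, 'a) module \<Rightarrow> 'a set \<Rightarrow> 'a set" where
  "lin_span A U = (\<lambda>V. lin_subspace V A) hull U"

definition alg_hom :: "('k, 'a) module \<Rightarrow> ('k, 'b) module \<Rightarrow> ('a \<Rightarrow> 'b) set" where
  "alg_hom A B = {f \<in> ring_hom A B. \<forall>c. \<forall>x\<in>carrier A. f (c \<odot>\<^bsub>A\<^esub> x) = c \<odot>\<^bsub>B\<^esub> f x}"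

definition quot_alg :: "('k, 'a) module \<Rightarrow> 'a set \<Rightarrow> ('k, 'a set) module" where
  "quot_alg A I = ring.extend (A Quot I)
     (module.fields (\<lambda>c C. \<Union>x\<in>C. I +>\<^bsub>A\<^esub> (c \<odot>\<^bsub>A\<^esub> x)))"

definition monoid_alg :: "('m, 'e) monoid_scheme \<Rightarrow> ('k::field, 'm \<Rightarrow>\<^sub>0 'k) module" where
  "monoid_alg M =
     \<lparr> carrier = {p. Poly_Mapping.keys p \<subseteq> carrier M},
       monoid.mult = (\<lambda>p q. \<Sum>x\<in>Poly_Mapping.keys p. \<Sum>y\<in>Poly_Mapping.keys q.
          Poly_Mapping.single (x \<otimes>\<^bsub>M\<^esub> y) (Poly_Mapping.lookup p x * Poly_Mapping.lookup q y)),
       one = Poly_Mapping.single \<one>\<^bsub>M\<^esub> 1,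
       zero = 0,
       add = (+),
       module.smult = (\<lambda>c p. Poly_Mapping.map (\<lambda>a. c * a) p) \<rparr>"

definition free_alg :: "('k::field, 'g list \<Rightarrow>\<^sub>0 'k) module" where
  "free_alg = monoid_alg \<lparr> carrier = UNIV, monoid.mult = (@), one = [] \<rparr>"


section \<open>Tensor products\<close>

text \<open>The free vector space on \<open>A \<times> B\<close>, with multiplication \<open>(a, b) (a', b') = (a a', b b')\<close> on basis
  elements, is the monoid algebra of \<open>A \<times> B\<close>. The span of the bilinearity relations is a two-sided
  ideal in it, so that the quotient carries the usual algebra structure of \<open>A \<otimes> B\<close>.\<close>

definition tensor_rels ::
  "('k::field, 'a) module \<Rightarrow> ('k, 'b) module \<Rightarrow> ('a \<times> 'b \<Rightarrow>\<^sub>0 'k) set" where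
  "tensor_rels A B =
     {Poly_Mapping.single (a \<oplus>\<^bsub>A\<^esub> a', b) 1 - Poly_Mapping.single (a, b) 1
        - Poly_Mapping.single (a', b) 1
        | a a' b. a \<in> carrier A \<and> a' \<in> carrier A \<and> b \<in> carrier B}
   \<union> {Poly_Mapping.single (a, b \<oplus>\<^bsub>B\<^esub> b') 1 - Poly_Mapping.single (a, b) 1
        - Poly_Mapping.single (a, b') 1
        | a b b'. a \<in> carrier A \<and> b \<in> carrier B \<and> b' \<in> carrier B}
   \<union> {Poly_Mapping.single (c \<odot>\<^bsub>A\<^esub> a, b) 1 - Poly_Mapping.single (a, b) c
        | c a b. a \<in> carrier A \<and> b \<in> carrier B}
   \<union> {Poly_Mapping.single (a, c \<odot>\<^bsub>B\<^esub> b) 1 - Poly_Mapping.single (a, b) c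
        | c a b. a \<in> carrier A \<and> b \<in> carrier B}"

definition tensor_null ::
  "('k::field, 'a) module \<Rightarrow> ('k, 'b) module \<Rightarrow> ('a \<times> 'b \<Rightarrow>\<^sub>0 'k) set" where
  "tensor_null A B = lin_span (monoid_alg (A \<times>\<times> B)) (tensor_rels A B)"

definition tensor_alg ::
  "('k::field, 'a) module \<Rightarrow> ('k, 'b) module \<Rightarrow> ('k, ('a \<times> 'b \<Rightarrow>\<^sub>0 'k) set) module" where
  "tensor_alg A B = quot_alg (monoid_alg (A \<times>\<times> B)) (tensor_null A B)"

definition pure_tensor ::
  "('k::field, 'a) module \<Rightarrow> ('k, 'b) module \<Rightarrow> 'a \<Rightarrow> 'b \<Rightarrow> ('a \<times> 'b \<Rightarrow>\<^sub>0 'k) set" where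
  "pure_tensor A B a b =
     tensor_null A B +>\<^bsub>monoid_alg (A \<times>\<times> B)\<^esub> Poly_Mapping.single (a, b) 1"

text \<open>\<open>A \<otimes> H\<close> is regarded as a subspace of \<open>H \<otimes> H\<close>, as is legitimate over a field.\<close>

definition right_coideal_subalg ::
  "('k::field, 'a) module \<Rightarrow> ('a \<Rightarrow> ('a \<times> 'a \<Rightarrow>\<^sub>0 'k) set) \<Rightarrow> 'a set \<Rightarrow> bool" where
  "right_coideal_subalg H \<Delta> S \<longleftrightarrow>
     subalg S H \<and>
     \<Delta> ` S \<subseteq> lin_span (tensor_alg H H) {pure_tensor H H a h | a h. a \<in> S \<and> h \<in> carrier H}"


section \<open>The Gelfand-Kirillov dimension\<close>

definition scalars :: "('k, 'a) module \<Rightarrow> 'a set" where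
  "scalars A = range (\<lambda>c. c \<odot>\<^bsub>A\<^esub> \<one>\<^bsub>A\<^esub>)"

text \<open>The dimension of \<open>V\<^sup>0 + V\<^sup>1 + \<dots> + V\<^sup>n\<close>, where \<open>V\<close> is the span of \<open>U\<close>.\<close>

definition growth :: "('k, 'a) module \<Rightarrow> 'a set \<Rightarrow> nat \<Rightarrow> nat" where
  "growth A U n = ring.dim A (scalars A)
     (lin_span A {foldr (\<otimes>\<^bsub>A\<^esub>) ws \<one>\<^bsub>A\<^esub> | ws. set ws \<subseteq> U \<and> length ws \<le> n})"

text \<open>The GK-dimension of a subalgebra \<open>S\<close> of \<open>A\<close>: the supremum over the finite-dimensional subspaces
  \<open>V\<close> of \<open>S\<close>, each given by a finite spanning set \<open>U\<close>.\<close>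

definition GK_dim :: "('k, 'a) module \<Rightarrow> 'a set \<Rightarrow> ereal" where
  "GK_dim A S = (SUP U\<in>{U. finite U \<and> U \<subseteq> S}.
     limsup (\<lambda>n. ereal (ln (real (growth A U n)) / ln (real n))))"


section \<open>Polynomial algebras and Ore extensions\<close>

definition is_polynomial_alg :: "('k::field, 'a) module \<Rightarrow> 'a \<Rightarrow> 'a set \<Rightarrow> bool" where
  "is_polynomial_alg A u R \<longleftrightarrow>
     u \<in> carrier A \<and>
     bij_betw (\<lambda>p :: 'k poly. \<Oplus>\<^bsub>A\<^esub>i\<in>{..degree p}. coeff p i \<odot>\<^bsub>A\<^esub> (u [^]\<^bsub>A\<^esub> i)) UNIV R"

definition is_derivation :: "('k, 'a) module \<Rightarrow> 'a set \<Rightarrow> ('a \<Rightarrow> 'a) \<Rightarrow> bool" where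
  "is_derivation A R \<delta> \<longleftrightarrow>
     \<delta> \<in> R \<rightarrow> R \<and>
     (\<forall>r\<in>R. \<forall>s\<in>R. \<delta> (r \<oplus>\<^bsub>A\<^esub> s) = \<delta> r \<oplus>\<^bsub>A\<^esub> \<delta> s) \<and>
     (\<forall>c. \<forall>r\<in>R. \<delta> (c \<odot>\<^bsub>A\<^esub> r) = c \<odot>\<^bsub>A\<^esub> \<delta> r) \<and>
     (\<forall>r\<in>R. \<forall>s\<in>R. \<delta> (r \<otimes>\<^bsub>A\<^esub> s) = \<delta> r \<otimes>\<^bsub>A\<^esub> s \<oplus>\<^bsub>A\<^esub> r \<otimes>\<^bsub>A\<^esub> \<delta> s)"

text \<open>\<open>S = R[v; \<delta>]\<close> inside \<open>A\<close>: \<open>S\<close> is a free left \<open>R\<close>-module on the powers of \<open>v\<close>, and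
  \<open>v r = r v + \<delta> r\<close>.\<close>

definition is_ore_extension ::
  "('k, 'a) module \<Rightarrow> 'a set \<Rightarrow> 'a \<Rightarrow> ('a \<Rightarrow> 'a) \<Rightarrow> 'a set \<Rightarrow> bool" where
  "is_ore_extension A R v \<delta> S \<longleftrightarrow>
     subalg R A \<and> subalg S A \<and> R \<subseteq> S \<and> v \<in> S \<and>
     is_derivation A R \<delta> \<and>
     (\<forall>r\<in>R. v \<otimes>\<^bsub>A\<^esub> r = r \<otimes>\<^bsub>A\<^esub> v \<oplus>\<^bsub>A\<^esub> \<delta> r) \<and>
     (\<forall>s\<in>S. \<exists>!f :: nat \<Rightarrow> 'a. range f \<subseteq> R \<and> finite {n. f n \<noteq> \<zero>\<^bsub>A\<^esub>} \<and>
        s = (\<Oplus>\<^bsub>A\<^esub>n\<in>{n. f n \<noteq> \<zero>\<^bsub>A\<^esub>}. f n \<otimes>\<^bsub>A\<^esub> (v [^]\<^bsub>A\<^esub> n)))"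

text \<open>The subalgebra generated by \<open>u\<close> and \<open>v\<close> is the Ore extension \<open>\<bbbk>[u][v; \<delta>]\<close> of the polynomial
  algebra \<open>\<bbbk>[u]\<close>, with \<open>\<delta>(u) = d\<close>; note that \<open>d = 0\<close> forces \<open>\<delta> = 0\<close>.\<close>

definition is_iterated_ore :: "('k::field, 'a) module \<Rightarrow> 'a \<Rightarrow> 'a \<Rightarrow> 'a \<Rightarrow> bool" where
  "is_iterated_ore A u v d \<longleftrightarrow>
     is_polynomial_alg A u (alg_gen A {u}) \<and>
     (\<exists>\<delta>. \<delta> u = d \<and> is_ore_extension A (alg_gen A {u}) v \<delta> (alg_gen A {u, v}))"


section \<open>The Hopf algebra \<open>A(\<lambda>\<^sub>1, \<lambda>\<^sub>2, \<alpha>)\<close>\<close>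

datatype gen = GX | GY | GZ

definition free_monom :: "gen list \<Rightarrow> (gen list \<Rightarrow>\<^sub>0 'k::field)" where
  "free_monom w = Poly_Mapping.single w 1"

definition HA_rels :: "'k::field \<Rightarrow> 'k \<Rightarrow> 'k \<Rightarrow> (gen list \<Rightarrow>\<^sub>0 'k) set" where
  "HA_rels l1 l2 \<alpha> =
     {free_monom [GX, GY] - free_monom [GY, GX],
      free_monom [GZ, GX] - free_monom [GX, GZ] - (Poly_Mapping.single [GX] l1 - Poly_Mapping.single [GY] \<alpha>),
      free_monom [GZ, GY] - free_monom [GY, GZ] - Poly_Mapping.single [GY] l2}"

definition HA_ideal :: "'k::field \<Rightarrow> 'k \<Rightarrow> 'k \<Rightarrow> (gen list \<Rightarrow>\<^sub>0 'k) set" where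
  "HA_ideal l1 l2 \<alpha> = Idl\<^bsub>free_alg\<^esub> (HA_rels l1 l2 \<alpha>)"

definition HA :: "'k::field \<Rightarrow> 'k \<Rightarrow> 'k \<Rightarrow> ('k, (gen list \<Rightarrow>\<^sub>0 'k) set) module" where
  "HA l1 l2 \<alpha> = quot_alg free_alg (HA_ideal l1 l2 \<alpha>)"

definition HA_gen :: "'k::field \<Rightarrow> 'k \<Rightarrow> 'k \<Rightarrow> gen \<Rightarrow> (gen list \<Rightarrow>\<^sub>0 'k) set" where
  "HA_gen l1 l2 \<alpha> g = HA_ideal l1 l2 \<alpha> +>\<^bsub>free_alg\<^esub> free_monom [g]"

definition HA_comult :: "'k::field \<Rightarrow> 'k \<Rightarrow> 'k \<Rightarrow> (gen list \<Rightarrow>\<^sub>0 'k) set \<Rightarrow>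
    ((gen list \<Rightarrow>\<^sub>0 'k) set \<times> (gen list \<Rightarrow>\<^sub>0 'k) set \<Rightarrow>\<^sub>0 'k) set" where
  "HA_comult l1 l2 \<alpha> =
     (let H = HA l1 l2 \<alpha>; T = tensor_alg H H; t = pure_tensor H H; e = \<one>\<^bsub>H\<^esub>;
          X = HA_gen l1 l2 \<alpha> GX; Y = HA_gen l1 l2 \<alpha> GY; Z = HA_gen l1 l2 \<alpha> GZ
      in THE \<Delta>. \<Delta> \<in> extensional (carrier H) \<and> \<Delta> \<in> alg_hom H T \<and>
           \<Delta> X = t X e \<oplus>\<^bsub>T\<^esub> t e X \<and>
           \<Delta> Y = t Y e \<oplus>\<^bsub>T\<^esub> t e Y \<and>
           \<Delta> Z = t Z e \<oplus>\<^bsub>T\<^esub> t e Z \<oplus>\<^bsub>T\<^esub> t X Y \<ominus>\<^bsub>T\<^esub> t Y X)"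

end

theory Submission
  imports Defs
begin

text \<open>By the PBW theorem \<open>H\<close> is \<open>\<bbbk>[y][x][z]\<close> as a vector space. Slicing the comultiplication with the coordinate
  functionals of \<open>X\<close>, \<open>Y\<close>, \<open>Z\<close> gives locally nilpotent operators \<open>D\<^sub>X\<close>, \<open>D\<^sub>Y\<close> and \<open>D\<^sub>Z = \<partial>\<^sub>z\<close> that preserve every
  right coideal subalgebra \<open>S\<close>. On \<open>\<bbbk>[x,y]\<close> they are \<open>\<partial>\<^sub>x\<close>, \<open>\<partial>\<^sub>y\<close> and \<open>0\<close>, so \<open>S \<inter> \<bbbk>[x,y]\<close> is \<open>\<bbbk>\<close>, \<open>\<bbbk>[x,y]\<close>,
  or \<open>\<bbbk>[u]\<close> with \<open>u = ax + by\<close>, the kernel of \<open>\<partial> = a\<partial>\<^sub>y - b\<partial>\<^sub>x\<close>. If \<open>S\<close> is not contained in \<open>\<bbbk>[x,y]\<close>, an element of \<open>S\<close>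
  outside \<open>\<bbbk>[x,y]\<close> that all three operators send into \<open>\<bbbk>[x,y]\<close> can be scaled to \<open>z + r\<close>. Since \<open>D\<^sub>X z = -y\<close> and
  \<open>D\<^sub>Y z = x\<close>, both \<open>\<partial>\<^sub>x r - y\<close> and \<open>\<partial>\<^sub>y r + x\<close> lie in \<open>S\<close>. This excludes \<open>\<bbbk>\<close>, and for \<open>\<bbbk>[u]\<close> it gives
  \<open>\<partial>r = u + c\<close>, hence \<open>v = z + (u + c) w \<in> S\<close> for any linear form \<open>w\<close> with \<open>\<partial>w = 1\<close>. Then \<open>[v,u] \<in> \<bbbk>[u]\<close> means
  \<open>a (b (\<lambda>\<^sub>2 - \<lambda>\<^sub>1) - \<alpha>a) = 0\<close>, and integrating \<open>\<partial>\<^sub>z\<close> shows \<open>S = \<bbbk>[u][v; \<delta>]\<close>.\<close>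

section \<open>Subspaces, subalgebras and homomorphisms\<close>

text \<open>The slices are computable because the coordinate functionals of 1, X, Y, Z span a space
  stable under precomposition with left multiplication by each generator. As \<Delta> is
  multiplicative, the operators are determined together by how they pass the three left
  multiplications and by their values at constants; \<Delta> of a general PBW monomial is never
  computed. The shape of the list comes from the cross terms X \<otimes> Y - Y \<otimes> X of
  \<Delta>(Z): when S contains only one linear form u up to scalars, a quadratic correction of Z has
  to turn both left factors into multiples of u. This correction is (u + c) w, and the signs of z1
  z2 and the square in case (iv) come from expanding it. Characteristic zero enters through
  integration of polynomials and through 1 and -1 being different. GK-dimension is computed exactly
  for the families of dimension 1 and 2; for the scalars an upper bound and for H a lower bound
  separate them from the rest. All linear maps out of the free algebra and out of the tensor product
  come from one device, linear extension from a basis followed by passage to the quotient.\<close>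

locale kalg = ring A for A :: "('k::field, 'a) module" (structure) +
  assumes smult_closed [simp, intro]: "x \<in> carrier A \<Longrightarrow> c \<odot> x \<in> carrier A"
    and smult_add_left: "x \<in> carrier A \<Longrightarrow> (c + d) \<odot> x = c \<odot> x \<oplus> d \<odot> x"
    and smult_add_right: "x \<in> carrier A \<Longrightarrow> y \<in> carrier A \<Longrightarrow> c \<odot> (x \<oplus> y) = c \<odot> x \<oplus> c \<odot> y"
    and smult_smult: "x \<in> carrier A \<Longrightarrow> c \<odot> (d \<odot> x) = (c * d) \<odot> x"
    and smult_1 [simp]: "x \<in> carrier A \<Longrightarrow> 1 \<odot> x = x"
    and smult_mult_left: "x \<in> carrier A \<Longrightarrow> y \<in> carrier A \<Longrightarrow> (c \<odot> x) \<otimes> y = c \<odot> (x \<otimes> y)"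
    and smult_mult_right: "x \<in> carrier A \<Longrightarrow> y \<in> carrier A \<Longrightarrow> x \<otimes> (c \<odot> y) = c \<odot> (x \<otimes> y)"
begin

lemma smult_0_left [simp]: "x \<in> carrier A \<Longrightarrow> 0 \<odot> x = \<zero>"
  using smult_add_left[of x 0 0] by (metis add.l_cancel_one' add_0 smult_closed)

lemma smult_0_right [simp]: "c \<odot> \<zero> = \<zero>"
  using smult_add_right[of \<zero> \<zero> c] by (metis add.l_cancel_one' l_zero smult_closed zero_closed)

lemma smult_minus_1: "x \<in> carrier A \<Longrightarrow> (- 1) \<odot> x = \<ominus> x"
  using smult_add_left[of x "- 1" 1] by (simp add: minus_equality)

lemma smult_minus: "x \<in> carrier A \<Longrightarrow> (- c) \<odot> x = \<ominus> (c \<odot> x)"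
  using smult_smult[of x "-1" c] smult_minus_1[of "c \<odot> x"] by simp

lemma lin_subspaceI:
  assumes "V \<subseteq> carrier A" "\<zero> \<in> V" "\<And>x y. x \<in> V \<Longrightarrow> y \<in> V \<Longrightarrow> x \<oplus> y \<in> V"
    "\<And>c x. x \<in> V \<Longrightarrow> c \<odot> x \<in> V"
  shows "lin_subspace V A"
  unfolding lin_subspace_def
proof (intro conjI allI ballI)
  have "\<ominus> x \<in> V" if "x \<in> V" for x
    using assms(1) assms(4)[OF that, of "-1"] that smult_minus_1 by auto
  then show "subgroup V (add_monoid A)"
    using assms by (auto intro!: add.subgroupI)
qed (use assms in auto)

lemma lin_subspaceD:
  assumes "lin_subspace V A"
  shows "V \<subseteq> carrier A" "\<zero> \<in> V" "x \<in> V \<Longrightarrow> y \<in> V \<Longrightarrow> x \<oplus> y \<in> V" "x \<in> V \<Longrightarrow> c \<odot> x \<in> V"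
    "x \<in> V \<Longrightarrow> \<ominus> x \<in> V" "x \<in> V \<Longrightarrow> y \<in> V \<Longrightarrow> x \<ominus> y \<in> V"
proof -
  have s: "subgroup V (add_monoid A)" and c: "\<And>c x. x \<in> V \<Longrightarrow> c \<odot> x \<in> V"
    using assms by (auto simp: lin_subspace_def)
  show sub: "V \<subseteq> carrier A" "\<zero> \<in> V" using subgroup.subset[OF s] subgroup.one_closed[OF s] by auto
  show a: "\<And>x y. x \<in> V \<Longrightarrow> y \<in> V \<Longrightarrow> x \<oplus> y \<in> V" using subgroup.m_closed[OF s] by auto
  show "x \<in> V \<Longrightarrow> c \<odot> x \<in> V" by (rule c)
  show m: "\<And>x. x \<in> V \<Longrightarrow> \<ominus> x \<in> V" using c[of _ "-1"] sub(1) smult_minus_1 by (metis subsetD)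
  show "x \<in> V \<Longrightarrow> y \<in> V \<Longrightarrow> x \<ominus> y \<in> V" using a m by (simp add: a_minus_def)
qed

lemma lin_subspace_carrier: "lin_subspace (carrier A) A"
  by (rule lin_subspaceI) auto

lemma lin_subspace_Inter:
  assumes "\<And>V. V \<in> F \<Longrightarrow> lin_subspace V A" "F \<noteq> {}"
  shows "lin_subspace (\<Inter>F) A"
proof (rule lin_subspaceI)
  show "\<Inter>F \<subseteq> carrier A" using assms lin_subspaceD(1) by blast
qed (use lin_subspaceD(2-4)[OF assms(1)] in auto)

lemma lin_span_least: "lin_subspace V A \<Longrightarrow> U \<subseteq> V \<Longrightarrow> lin_span A U \<subseteq> V"
  unfolding lin_span_def by (rule hull_minimal)

lemma lin_span_superset: "U \<subseteq> lin_span A U"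
  unfolding lin_span_def by (rule hull_subset)

lemma lin_subspace_lin_span:
  assumes "U \<subseteq> carrier A" shows "lin_subspace (lin_span A U) A"
  unfolding lin_span_def hull_def
  by (rule lin_subspace_Inter) (use assms lin_subspace_carrier in auto)

lemma lin_span_subset_carrier: "U \<subseteq> carrier A \<Longrightarrow> lin_span A U \<subseteq> carrier A"
  using lin_span_least lin_subspace_carrier by blast

text \<open>The elements with property P form a subspace containing U. The step cases carry
  membership in the carrier, because the algebra laws hold only there.\<close>

lemma lin_span_induct [consumes 2, case_names zero add smult base]:
  assumes "x \<in> lin_span A U" "U \<subseteq> carrier A" "P \<zero>"
    "\<And>x y. x \<in> carrier A \<Longrightarrow> y \<in> carrier A \<Longrightarrow> P x \<Longrightarrow> P y \<Longrightarrow> P (x \<oplus> y)"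
    "\<And>c x. x \<in> carrier A \<Longrightarrow> P x \<Longrightarrow> P (c \<odot> x)" "\<And>x. x \<in> U \<Longrightarrow> P x"
  shows "P x"
proof -
  have "lin_subspace {x \<in> carrier A. P x} A"
    by (rule lin_subspaceI) (use assms in auto)
  from lin_span_least[OF this, of U] show ?thesis using assms(1,2,6) by blast
qed

lemma lin_span_mono: "U \<subseteq> V \<Longrightarrow> lin_span A U \<subseteq> lin_span A V"
  unfolding lin_span_def by (rule hull_mono)

lemma subalgI:
  assumes "S \<subseteq> carrier A" "\<one> \<in> S" "\<And>x y. x \<in> S \<Longrightarrow> y \<in> S \<Longrightarrow> x \<oplus> y \<in> S"
    "\<And>x y. x \<in> S \<Longrightarrow> y \<in> S \<Longrightarrow> x \<otimes> y \<in> S" "\<And>c x. x \<in> S \<Longrightarrow> c \<odot> x \<in> S"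
  shows "subalg S A"
  unfolding subalg_def
proof (intro conjI allI ballI)
  have "\<ominus> x \<in> S" if "x \<in> S" for x
    using assms(1) assms(5)[OF that, of "-1"] that smult_minus_1 by auto
  then show "subring S A"
    using assms by (intro subringI) auto
qed (use assms in auto)

lemma subalgD:
  assumes "subalg S A"
  shows "S \<subseteq> carrier A" "\<one> \<in> S" "x \<in> S \<Longrightarrow> y \<in> S \<Longrightarrow> x \<oplus> y \<in> S" "x \<in> S \<Longrightarrow> y \<in> S \<Longrightarrow> x \<otimes> y \<in> S"
    "x \<in> S \<Longrightarrow> c \<odot> x \<in> S" "\<zero> \<in> S" "x \<in> S \<Longrightarrow> \<ominus> x \<in> S" "x \<in> S \<Longrightarrow> y \<in> S \<Longrightarrow> x \<ominus> y \<in> S"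
    "lin_subspace S A"
proof -
  have s: "subring S A" and c: "\<And>c x. x \<in> S \<Longrightarrow> c \<odot> x \<in> S" using assms by (auto simp: subalg_def)
  note * = subringE[OF s]
  show "S \<subseteq> carrier A" "\<one> \<in> S" "x \<in> S \<Longrightarrow> y \<in> S \<Longrightarrow> x \<oplus> y \<in> S" "x \<in> S \<Longrightarrow> y \<in> S \<Longrightarrow> x \<otimes> y \<in> S"
    "x \<in> S \<Longrightarrow> c \<odot> x \<in> S" "\<zero> \<in> S" "x \<in> S \<Longrightarrow> \<ominus> x \<in> S" "x \<in> S \<Longrightarrow> y \<in> S \<Longrightarrow> x \<ominus> y \<in> S"
    using * c by (auto simp: a_minus_def)
  show "lin_subspace S A" by (rule lin_subspaceI) (use * c in auto)
qed

lemma subalg_pow: "subalg S A \<Longrightarrow> x \<in> S \<Longrightarrow> x [^] (n::nat) \<in> S"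
  by (induction n) (auto simp: subalgD)

lemma subalg_carrier: "subalg (carrier A) A"
  by (rule subalgI) auto

lemma alg_gen_least: "subalg S A \<Longrightarrow> U \<subseteq> S \<Longrightarrow> alg_gen A U \<subseteq> S"
  unfolding alg_gen_def by (rule hull_minimal)

lemma alg_gen_superset: "U \<subseteq> alg_gen A U"
  unfolding alg_gen_def by (rule hull_subset)

lemma alg_gen_mono: "U \<subseteq> V \<Longrightarrow> alg_gen A U \<subseteq> alg_gen A V"
  unfolding alg_gen_def by (rule hull_mono)

lemma subalg_Inter:
  assumes "\<And>V. V \<in> F \<Longrightarrow> subalg V A" "F \<noteq> {}"
  shows "subalg (\<Inter>F) A"
proof (rule subalgI)
  show "\<Inter>F \<subseteq> carrier A" using assms subalgD(1) by blast
qed (use subalgD(2-5)[OF assms(1)] in auto)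

lemma subalg_alg_gen: "U \<subseteq> carrier A \<Longrightarrow> subalg (alg_gen A U) A"
  unfolding alg_gen_def hull_def
  by (rule subalg_Inter) (use subalg_carrier in auto)

lemma alg_gen_induct [consumes 2, case_names one add mult smult base]:
  assumes "x \<in> alg_gen A U" "U \<subseteq> carrier A" "P \<one>"
    "\<And>x y. x \<in> carrier A \<Longrightarrow> y \<in> carrier A \<Longrightarrow> P x \<Longrightarrow> P y \<Longrightarrow> P (x \<oplus> y)"
    "\<And>x y. x \<in> carrier A \<Longrightarrow> y \<in> carrier A \<Longrightarrow> P x \<Longrightarrow> P y \<Longrightarrow> P (x \<otimes> y)"
    "\<And>c x. x \<in> carrier A \<Longrightarrow> P x \<Longrightarrow> P (c \<odot> x)" "\<And>x. x \<in> U \<Longrightarrow> P x"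
  shows "P x"
proof -
  have "subalg {x \<in> carrier A. P x} A"
    by (rule subalgI) (use assms in auto)
  from alg_gen_least[OF this, of U] show ?thesis using assms(1,2,7) by blast
qed

lemma finsum_in_subspace:
  assumes "lin_subspace V A" "\<And>i. i \<in> I \<Longrightarrow> f i \<in> V"
  shows "(\<Oplus>i\<in>I. f i) \<in> V"
proof (cases "finite I")
  case True
  then show ?thesis using assms
  proof (induction I)
    case (insert i I)
    then have "f \<in> I \<rightarrow> carrier A" "f i \<in> carrier A" using lin_subspaceD(1) by blast+
    with insert show ?case by (simp add: lin_subspaceD)
  qed (simp add: lin_subspaceD)
qed (simp add: assms lin_subspaceD add.finprod_infinite)

lemma smult_finsum:
  assumes "f \<in> I \<rightarrow> carrier A" shows "c \<odot> (\<Oplus>i\<in>I. f i) = (\<Oplus>i\<in>I. c \<odot> f i)"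
proof (cases "finite I")
  case True
  then show ?thesis using assms
  proof (induction I)
    case (insert i I)
    then have "f \<in> I \<rightarrow> carrier A" "f i \<in> carrier A" by blast+
    with insert show ?case by (simp add: smult_add_right Pi_def)
  qed simp
qed (simp add: add.finprod_infinite)

lemma scalars_subalg: "subalg (scalars A) A"
proof (rule subalgI)
  show "\<one> \<in> scalars A" unfolding scalars_def by (metis one_closed rangeI smult_1)
next
  fix x y assume "x \<in> scalars A" "y \<in> scalars A"
  then obtain c d where [simp]: "x = c \<odot> \<one>" "y = d \<odot> \<one>" by (auto simp: scalars_def)
  have "x \<oplus> y = (c + d) \<odot> \<one>" "x \<otimes> y = (c * d) \<odot> \<one>"
    by (simp_all add: smult_add_left smult_mult_left smult_smult)
  then show "x \<oplus> y \<in> scalars A" "x \<otimes> y \<in> scalars A" by (auto simp: scalars_def)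
next
  fix c x assume "x \<in> scalars A"
  then show "c \<odot> x \<in> scalars A" by (auto simp: scalars_def smult_smult)
qed (auto simp: scalars_def)

lemma scalars_subset: "subalg S A \<Longrightarrow> scalars A \<subseteq> S"
  by (auto simp: scalars_def subalgD)

end

lemma alg_homD:
  assumes "f \<in> alg_hom A B"
  shows "x \<in> carrier A \<Longrightarrow> f x \<in> carrier B" "x \<in> carrier A \<Longrightarrow> y \<in> carrier A \<Longrightarrow> f (x \<otimes>\<^bsub>A\<^esub> y) = f x \<otimes>\<^bsub>B\<^esub> f y"
    "x \<in> carrier A \<Longrightarrow> y \<in> carrier A \<Longrightarrow> f (x \<oplus>\<^bsub>A\<^esub> y) = f x \<oplus>\<^bsub>B\<^esub> f y" "f \<one>\<^bsub>A\<^esub> = \<one>\<^bsub>B\<^esub>"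
    "x \<in> carrier A \<Longrightarrow> f (c \<odot>\<^bsub>A\<^esub> x) = c \<odot>\<^bsub>B\<^esub> f x"
  using assms by (auto simp: alg_hom_def ring_hom_def)

lemma alg_hom_comp:
  "f \<in> alg_hom A B \<Longrightarrow> g \<in> alg_hom B C \<Longrightarrow> g \<circ> f \<in> alg_hom A C"
  by (auto simp: alg_hom_def intro: ring_hom_trans simp: ring_hom_closed)

lemma alg_hom_zero:
  assumes "kalg A" "kalg B" "f \<in> alg_hom A B" shows "f \<zero>\<^bsub>A\<^esub> = \<zero>\<^bsub>B\<^esub>"
proof -
  interpret A: kalg A by fact
  interpret B: kalg B by fact
  show ?thesis using alg_homD(5)[OF assms(3), of "\<zero>\<^bsub>A\<^esub>" 0] alg_homD(1)[OF assms(3), of "\<zero>\<^bsub>A\<^esub>"] by simp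
qed

text \<open>Both maps respect every operation that builds the generated subalgebra. This makes
  \<Delta> unique once its values on X, Y, Z are fixed.\<close>

lemma alg_hom_eq_on_alg_gen:
  assumes "kalg A" "f \<in> alg_hom A B" "g \<in> alg_hom A B" "U \<subseteq> carrier A" "\<And>u. u \<in> U \<Longrightarrow> f u = g u"
    "x \<in> alg_gen A U"
  shows "f x = g x"
proof -
  interpret A: kalg A by fact
  show ?thesis using assms(6,4)
    by (induction rule: A.alg_gen_induct) (use assms in \<open>auto simp: alg_homD\<close>)
qed

section \<open>Quotients\<close>

text \<open>Scaling by c is multiplication by the ring element c \<odot> 1. Hence ideals generated
  in the sense of rings, such as \<open>HA_ideal\<close>, are subspaces, and scaling descends to the
  quotient.\<close>

lemma (in kalg) ideal_smult_closed:
  assumes "ideal I A" "x \<in> I" shows "c \<odot> x \<in> I"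
proof -
  interpret ideal I A by fact
  have "c \<odot> x = (c \<odot> \<one>) \<otimes> x" using assms by (simp add: smult_mult_left a_Hcarr)
  then show ?thesis using assms I_l_closed by simp
qed

lemma (in kalg) quot_alg_simps:
  assumes "ideal I A"
  shows "carrier (quot_alg A I) = (+>) I ` carrier A"
    "x \<in> carrier A \<Longrightarrow> y \<in> carrier A \<Longrightarrow> (I +> x) \<oplus>\<^bsub>quot_alg A I\<^esub> (I +> y) = I +> (x \<oplus> y)"
    "x \<in> carrier A \<Longrightarrow> y \<in> carrier A \<Longrightarrow> (I +> x) \<otimes>\<^bsub>quot_alg A I\<^esub> (I +> y) = I +> (x \<otimes> y)"
    "\<one>\<^bsub>quot_alg A I\<^esub> = I +> \<one>"
    "\<zero>\<^bsub>quot_alg A I\<^esub> = I"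
    "x \<in> carrier A \<Longrightarrow> c \<odot>\<^bsub>quot_alg A I\<^esub> (I +> x) = I +> (c \<odot> x)"
    "x \<in> carrier A \<Longrightarrow> y \<in> carrier A \<Longrightarrow> I +> x = I +> y \<longleftrightarrow> x \<ominus> y \<in> I"
proof -
  interpret I: ideal I A by fact
  note d = quot_alg_def ring.defs module.defs
  show "carrier (quot_alg A I) = (+>) I ` carrier A"
    by (auto simp: d FactRing_simps)
  show "x \<in> carrier A \<Longrightarrow> y \<in> carrier A \<Longrightarrow> (I +> x) \<oplus>\<^bsub>quot_alg A I\<^esub> (I +> y) = I +> (x \<oplus> y)"
    by (simp add: d FactRing_simps I.a_rcos_sum)
  show "x \<in> carrier A \<Longrightarrow> y \<in> carrier A \<Longrightarrow> (I +> x) \<otimes>\<^bsub>quot_alg A I\<^esub> (I +> y) = I +> (x \<otimes> y)"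
    by (simp add: d FactRing_simps I.rcoset_mult_add)
  show "\<one>\<^bsub>quot_alg A I\<^esub> = I +> \<one>" "\<zero>\<^bsub>quot_alg A I\<^esub> = I" by (simp_all add: d FactRing_simps)
  show eq: "I +> x = I +> y \<longleftrightarrow> x \<ominus> y \<in> I" if "x \<in> carrier A" "y \<in> carrier A" for x y
    using quotient_eq_iff_same_a_r_cos[OF assms] that by blast
  show "c \<odot>\<^bsub>quot_alg A I\<^esub> (I +> x) = I +> (c \<odot> x)" if x: "x \<in> carrier A"
  proof -
    \<comment> \<open>Scaling in the quotient is a union over all representatives of a coset. It
      collapses to a single coset because c (x' - x) stays in I.\<close>
    have "I +> (c \<odot> x') = I +> (c \<odot> x)" if "x' \<in> I +> x" for x'
    proof -
      have c: "x' \<in> carrier A" using that x by (auto simp: a_r_coset_def r_coset_def I.a_Hcarr)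
      then have "x' \<ominus> x \<in> I" using eq[OF c x] x that I.a_repr_independence' by auto
      then have "c \<odot> (x' \<ominus> x) \<in> I" by (rule ideal_smult_closed[OF assms])
      also have "c \<odot> (x' \<ominus> x) = c \<odot> x' \<ominus> c \<odot> x"
        using c x by (simp add: a_minus_def smult_add_right flip: smult_minus_1) (simp add: smult_smult)
      finally show ?thesis using eq c x by simp
    qed
    then have "(\<Union>x'\<in>I +> x. I +> (c \<odot> x')) = I +> (c \<odot> x)"
      using I.a_rcos_self[OF x] by blast
    then show ?thesis by (simp add: d FactRing_simps)
  qed
qed

lemma (in kalg) kalg_quot_alg:
  assumes "ideal I A" shows "kalg (quot_alg A I)"
proof -
  interpret I: ideal I A by fact
  note s = quot_alg_simps[OF assms]
  have "ring (quot_alg A I)"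
  proof -
    have r: "ring (A Quot I)" by (rule I.quotient_is_ring)
    have e: "carrier (quot_alg A I) = carrier (A Quot I)" "monoid.mult (quot_alg A I) = monoid.mult (A Quot I)"
      "one (quot_alg A I) = one (A Quot I)" "zero (quot_alg A I) = zero (A Quot I)" "add (quot_alg A I) = add (A Quot I)"
      by (simp_all add: quot_alg_def ring.defs)
    interpret Q: ring "A Quot I" by (rule r)
    show ?thesis
    proof (rule ringI)
      show "abelian_group (quot_alg A I)"
        by (rule abelian_groupI) (auto simp: e Q.add.m_ac intro: Q.l_neg Q.add.inv_closed)
      show "monoid (quot_alg A I)"
        by (rule monoidI) (auto simp: e Q.m_assoc)
    qed (auto simp: e Q.l_distr Q.r_distr)
  qed
  then interpret Q: ring "quot_alg A I" .
  show ?thesis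
    by unfold_locales (auto simp: s smult_add_left smult_add_right smult_smult smult_mult_left smult_mult_right)
qed

lemma (in kalg) quot_proj_hom:
  assumes "ideal I A" shows "(+>) I \<in> alg_hom A (quot_alg A I)"
  using quot_alg_simps[OF assms] by (auto simp: alg_hom_def ring_hom_def)

text \<open>A representative is picked by choice, so the value is meaningful for maps g that are
  constant on cosets. Nothing is required of the target: it may be a record algebra or a type with
  its own addition.\<close>

definition quot_lift :: "('k, 'a) module \<Rightarrow> 'a set \<Rightarrow> ('a \<Rightarrow> 'b) \<Rightarrow> 'a set \<Rightarrow> 'b" where
  "quot_lift A I g C = g (SOME x. x \<in> carrier A \<and> I +>\<^bsub>A\<^esub> x = C)"

lemma (in kalg) quot_lift_proj:
  assumes "\<And>y. y \<in> carrier A \<Longrightarrow> I +> x = I +> y \<Longrightarrow> g x = g y" "x \<in> carrier A"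
  shows "quot_lift A I g (I +> x) = g x"
proof -
  have "\<exists>y. y \<in> carrier A \<and> I +> y = I +> x" using assms by auto
  from someI_ex[OF this] show ?thesis using assms unfolding quot_lift_def by metis
qed

lemma (in kalg) quot_lift_hom:
  assumes "ideal I A" "kalg B" "g \<in> alg_hom A B" "\<And>x. x \<in> I \<Longrightarrow> g x = \<zero>\<^bsub>B\<^esub>"
  shows "quot_lift A I g \<in> alg_hom (quot_alg A I) B"
    "x \<in> carrier A \<Longrightarrow> quot_lift A I g (I +> x) = g x"
proof -
  interpret B: kalg B by fact
  note s = quot_alg_simps[OF assms(1)] and g = alg_homD[OF assms(3)]
  show l: "quot_lift A I g (I +> x) = g x" if "x \<in> carrier A" for x
  proof (rule quot_lift_proj[OF _ that])
    fix y assume y: "y \<in> carrier A" "I +> x = I +> y"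
    then have "x \<ominus> y \<in> I" using s(7) that by blast
    then have "g (x \<oplus> (- 1) \<odot> y) = \<zero>\<^bsub>B\<^esub>" using assms(4) y by (simp add: a_minus_def smult_minus_1)
    then have "g x \<oplus>\<^bsub>B\<^esub> (- 1) \<odot>\<^bsub>B\<^esub> g y = \<zero>\<^bsub>B\<^esub>" using g that y by simp
    then show "g x = g y" using g that y B.smult_minus_1 B.r_right_minus_eq unfolding B.minus_eq by metis
  qed
  show "quot_lift A I g \<in> alg_hom (quot_alg A I) B"
    unfolding alg_hom_def ring_hom_def by (auto simp: s l g)
qed

section \<open>Linear extension from a basis\<close>

abbreviation pm_scale :: "'k::field \<Rightarrow> ('b \<Rightarrow>\<^sub>0 'k) \<Rightarrow> ('b \<Rightarrow>\<^sub>0 'k)" where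
  "pm_scale c p \<equiv> Poly_Mapping.map ((*) c) p"

lemma lookup_pm_scale [simp]: "Poly_Mapping.lookup (pm_scale c p) x = c * Poly_Mapping.lookup p x"
  by (simp add: Poly_Mapping.map.rep_eq when_def)

lemma vector_space_pm_scale: "vector_space (pm_scale :: 'k::field \<Rightarrow> ('b \<Rightarrow>\<^sub>0 'k) \<Rightarrow> _)"
  by unfold_locales (auto intro!: poly_mapping_eqI simp: lookup_add algebra_simps)

lemma keys_sum_subset: "Poly_Mapping.keys (\<Sum>i\<in>I. f i) \<subseteq> (\<Union>i\<in>I. Poly_Mapping.keys (f i))"
proof (cases "finite I")
  case True
  then show ?thesis
  proof (induction I)
    case (insert i I)
    then show ?case using Poly_Mapping.keys_add[of "f i" "sum f I"] by auto
  qed simp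
qed simp

lemma keys_pm_scale: "Poly_Mapping.keys (pm_scale c p) \<subseteq> Poly_Mapping.keys p"
  by (auto simp: in_keys_iff)

text \<open>The universal property of the free vector space as a formula. Products in monoid
  algebras, the action on the polynomial model and linear maps out of a tensor product are all
  instances of it.\<close>

definition lin_ext :: "('k \<Rightarrow> 'v \<Rightarrow> 'v::ab_group_add) \<Rightarrow> ('b \<Rightarrow> 'v) \<Rightarrow> ('b \<Rightarrow>\<^sub>0 'k::field) \<Rightarrow> 'v" where
  "lin_ext s f p = (\<Sum>x\<in>Poly_Mapping.keys p. s (Poly_Mapping.lookup p x) (f x))"

lemma lin_ext_cong: "(\<And>x. x \<in> Poly_Mapping.keys p \<Longrightarrow> f x = g x) \<Longrightarrow> lin_ext s f p = lin_ext s g p"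
  by (simp add: lin_ext_def)

lemma keys_lin_ext: "Poly_Mapping.keys (lin_ext pm_scale f p) \<subseteq> (\<Union>x\<in>Poly_Mapping.keys p. Poly_Mapping.keys (f x))"
  unfolding lin_ext_def using keys_sum_subset keys_pm_scale by fastforce

context vector_space
begin

lemma lin_ext_superset:
  assumes "finite F" "Poly_Mapping.keys p \<subseteq> F"
  shows "lin_ext scale f p = (\<Sum>x\<in>F. scale (Poly_Mapping.lookup p x) (f x))"
  unfolding lin_ext_def using assms by (intro sum.mono_neutral_left) (auto simp: in_keys_iff)

lemma lin_ext_zero [simp]: "lin_ext scale f 0 = 0"
  by (simp add: lin_ext_def)

lemma lin_ext_single [simp]: "lin_ext scale f (Poly_Mapping.single x c) = scale c (f x)"
  by (simp add: lin_ext_def)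

lemma lin_ext_add: "lin_ext scale f (p + q) = lin_ext scale f p + lin_ext scale f q"
proof -
  let ?F = "Poly_Mapping.keys p \<union> Poly_Mapping.keys q"
  have "lin_ext scale f r = (\<Sum>x\<in>?F. scale (Poly_Mapping.lookup r x) (f x))"
    if "Poly_Mapping.keys r \<subseteq> ?F" for r
    using that by (rule lin_ext_superset[rotated]) simp
  then show ?thesis
    by (simp add: Poly_Mapping.keys_add lookup_add scale_left_distrib sum.distrib)
qed

lemma lin_ext_scale: "lin_ext scale f (pm_scale c p) = scale c (lin_ext scale f p)"
proof -
  have "lin_ext scale f (pm_scale c p) = (\<Sum>x\<in>Poly_Mapping.keys p. scale (c * Poly_Mapping.lookup p x) (f x))"
    by (subst lin_ext_superset[of "Poly_Mapping.keys p"]) (simp_all add: keys_pm_scale)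
  then show ?thesis by (simp add: lin_ext_def scale_sum_right)
qed

lemma lin_ext_diff: "lin_ext scale f (p - q) = lin_ext scale f p - lin_ext scale f q"
  using lin_ext_add[of f "p - q" q] by simp

lemma lin_ext_sum: "lin_ext scale f (\<Sum>i\<in>I. g i) = (\<Sum>i\<in>I. lin_ext scale f (g i))"
  by (induction I rule: infinite_finite_induct) (auto simp: lin_ext_add)

lemma lin_ext_comp:
  "lin_ext scale f (lin_ext pm_scale g p) = lin_ext scale (\<lambda>x. lin_ext scale f (g x)) p"
  by (simp add: lin_ext_def[of pm_scale] lin_ext_def[of scale "\<lambda>x. lin_ext scale f (g x)"]
      lin_ext_sum lin_ext_scale)

lemma lin_ext_fun_add: "lin_ext scale (\<lambda>x. f x + g x) p = lin_ext scale f p + lin_ext scale g p"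
  by (simp add: lin_ext_def scale_right_distrib sum.distrib)

lemma lin_ext_fun_scale: "lin_ext scale (\<lambda>x. scale c (f x)) p = scale c (lin_ext scale f p)"
  by (simp add: lin_ext_def scale_sum_right mult.commute)

lemma lin_ext_swap:
  "lin_ext scale (\<lambda>x. lin_ext scale (\<lambda>y. f x y) q) p = lin_ext scale (\<lambda>y. lin_ext scale (\<lambda>x. f x y) p) q"
  unfolding lin_ext_def by (simp add: scale_sum_right sum.swap[of _ "Poly_Mapping.keys q"] mult.commute)

end

lemma lin_ext_linear_comp:
  fixes f :: "'b \<Rightarrow> 'v::ab_group_add"
  assumes "vector_space s" "\<And>x y. g (x + y) = g x + g y" "\<And>c x. g (s c x) = s' c (g x)"
  shows "g (lin_ext s f p) = lin_ext s' (\<lambda>x. g (f x)) p"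
proof -
  have [simp]: "g 0 = 0" using assms(2)[of 0 0] by simp
  have "g (\<Sum>i\<in>I. h i) = (\<Sum>i\<in>I. g (h i))" for h and I :: "'b set"
    by (induction I rule: infinite_finite_induct) (auto simp: assms)
  then show ?thesis by (simp add: lin_ext_def assms)
qed

lemma pm_decomp: "p = lin_ext pm_scale (\<lambda>x. Poly_Mapping.single x 1) p"
proof (rule poly_mapping_eqI)
  fix x
  show "Poly_Mapping.lookup p x = Poly_Mapping.lookup (lin_ext pm_scale (\<lambda>x. Poly_Mapping.single x 1) p) x"
    by (simp add: lin_ext_def lookup_sum lookup_single when_def in_keys_iff)
qed

section \<open>Monoid algebras\<close>

lemma monoid_alg_simps [simp]:
  "carrier (monoid_alg M) = {p. Poly_Mapping.keys p \<subseteq> carrier M}"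
  "\<one>\<^bsub>monoid_alg M\<^esub> = Poly_Mapping.single \<one>\<^bsub>M\<^esub> 1"
  "\<zero>\<^bsub>monoid_alg M\<^esub> = 0" "p \<oplus>\<^bsub>monoid_alg M\<^esub> q = p + q"
  "c \<odot>\<^bsub>monoid_alg M\<^esub> p = pm_scale c p"
  by (simp_all add: monoid_alg_def)

text \<open>With the product written as a nested linear extension, \<open>lin_ext_comp\<close>
  reduces distributivity, associativity and compatibility with scalars to statements about basis
  elements.\<close>

lemma monoid_alg_mult:
  "p \<otimes>\<^bsub>monoid_alg M\<^esub> q = lin_ext pm_scale (\<lambda>x. lin_ext pm_scale (\<lambda>y. Poly_Mapping.single (x \<otimes>\<^bsub>M\<^esub> y) 1) q) p"
proof -
  interpret vector_space pm_scale by (rule vector_space_pm_scale)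
  show ?thesis by (simp add: monoid_alg_def lin_ext_def scale_sum_right)
qed

lemma monoid_alg_mult_single [simp]:
  "Poly_Mapping.single x c \<otimes>\<^bsub>monoid_alg M\<^esub> Poly_Mapping.single y d = Poly_Mapping.single (x \<otimes>\<^bsub>M\<^esub> y) (c * d)"
proof -
  interpret vector_space pm_scale by (rule vector_space_pm_scale)
  show ?thesis by (simp add: monoid_alg_mult)
qed

lemma kalg_monoid_alg:
  fixes M :: "('m, 'e) monoid_scheme"
  assumes "Group.monoid M" shows "kalg (monoid_alg M :: ('k::field, 'm \<Rightarrow>\<^sub>0 'k) module)"
proof -
  interpret M: Group.monoid M by fact
  interpret V: vector_space "pm_scale :: 'k \<Rightarrow> ('m \<Rightarrow>\<^sub>0 'k) \<Rightarrow> _" by (rule vector_space_pm_scale)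
  let ?A = "monoid_alg M :: ('k, 'm \<Rightarrow>\<^sub>0 'k) module"
  have add_l: "(p + q) \<otimes>\<^bsub>?A\<^esub> r = p \<otimes>\<^bsub>?A\<^esub> r + q \<otimes>\<^bsub>?A\<^esub> r" for p q r
    by (simp add: monoid_alg_mult V.lin_ext_add)
  have add_r: "r \<otimes>\<^bsub>?A\<^esub> (p + q) = r \<otimes>\<^bsub>?A\<^esub> p + r \<otimes>\<^bsub>?A\<^esub> q" for p q r
    by (simp only: monoid_alg_mult V.lin_ext_fun_add V.lin_ext_add)
  have sc_l: "pm_scale c p \<otimes>\<^bsub>?A\<^esub> r = pm_scale c (p \<otimes>\<^bsub>?A\<^esub> r)" for c p r
    by (simp only: monoid_alg_mult V.lin_ext_scale)
  have sc_r: "r \<otimes>\<^bsub>?A\<^esub> pm_scale c p = pm_scale c (r \<otimes>\<^bsub>?A\<^esub> p)" for c p r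
    by (simp only: monoid_alg_mult V.lin_ext_fun_scale V.lin_ext_scale)
  have closed: "p \<otimes>\<^bsub>?A\<^esub> q \<in> carrier ?A" if pq: "p \<in> carrier ?A" "q \<in> carrier ?A" for p q
  proof -
    have "Poly_Mapping.keys (p \<otimes>\<^bsub>?A\<^esub> q) \<subseteq> (\<Union>x\<in>Poly_Mapping.keys p. \<Union>y\<in>Poly_Mapping.keys q.
        Poly_Mapping.keys (Poly_Mapping.single (x \<otimes>\<^bsub>M\<^esub> y) (1::'k)))"
      unfolding monoid_alg_mult by (rule order_trans[OF keys_lin_ext]) (intro UN_mono order_refl keys_lin_ext)
    also have "\<dots> \<subseteq> carrier M" using pq by auto
    finally show ?thesis by simp
  qed
  have assoc: "p \<otimes>\<^bsub>?A\<^esub> q \<otimes>\<^bsub>?A\<^esub> r = p \<otimes>\<^bsub>?A\<^esub> (q \<otimes>\<^bsub>?A\<^esub> r)"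
    if pqr: "p \<in> carrier ?A" "q \<in> carrier ?A" "r \<in> carrier ?A" for p q r
  proof -
    have "p \<otimes>\<^bsub>?A\<^esub> q \<otimes>\<^bsub>?A\<^esub> r = lin_ext pm_scale (\<lambda>x. lin_ext pm_scale (\<lambda>y. lin_ext pm_scale (\<lambda>z.
        Poly_Mapping.single (x \<otimes>\<^bsub>M\<^esub> y \<otimes>\<^bsub>M\<^esub> z) 1) r) q) p"
      by (simp add: monoid_alg_mult V.lin_ext_comp)
    also have "\<dots> = lin_ext pm_scale (\<lambda>x. lin_ext pm_scale (\<lambda>y. lin_ext pm_scale (\<lambda>z.
        Poly_Mapping.single (x \<otimes>\<^bsub>M\<^esub> (y \<otimes>\<^bsub>M\<^esub> z)) 1) r) q) p"
    proof (intro lin_ext_cong)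
      fix x y z assume "x \<in> Poly_Mapping.keys p" "y \<in> Poly_Mapping.keys q" "z \<in> Poly_Mapping.keys r"
      then have "x \<in> carrier M" "y \<in> carrier M" "z \<in> carrier M" using pqr by auto
      then show "Poly_Mapping.single (x \<otimes>\<^bsub>M\<^esub> y \<otimes>\<^bsub>M\<^esub> z) (1::'k) = Poly_Mapping.single (x \<otimes>\<^bsub>M\<^esub> (y \<otimes>\<^bsub>M\<^esub> z)) 1"
        by (simp add: M.m_assoc)
    qed
    also have "\<dots> = p \<otimes>\<^bsub>?A\<^esub> (q \<otimes>\<^bsub>?A\<^esub> r)"
      by (simp add: monoid_alg_mult V.lin_ext_comp)
    finally show ?thesis .
  qed
  have one_l: "\<one>\<^bsub>?A\<^esub> \<otimes>\<^bsub>?A\<^esub> p = p" if p: "p \<in> carrier ?A" for p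
  proof -
    have "\<one>\<^bsub>?A\<^esub> \<otimes>\<^bsub>?A\<^esub> p = lin_ext pm_scale (\<lambda>y. Poly_Mapping.single (\<one>\<^bsub>M\<^esub> \<otimes>\<^bsub>M\<^esub> y) 1) p"
      by (simp add: monoid_alg_mult)
    also have "\<dots> = lin_ext pm_scale (\<lambda>y. Poly_Mapping.single y 1) p"
      using p by (intro lin_ext_cong) auto
    finally show ?thesis by (simp flip: pm_decomp)
  qed
  have one_r: "p \<otimes>\<^bsub>?A\<^esub> \<one>\<^bsub>?A\<^esub> = p" if p: "p \<in> carrier ?A" for p
  proof -
    have "p \<otimes>\<^bsub>?A\<^esub> \<one>\<^bsub>?A\<^esub> = lin_ext pm_scale (\<lambda>y. Poly_Mapping.single (y \<otimes>\<^bsub>M\<^esub> \<one>\<^bsub>M\<^esub>) 1) p"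
      by (simp add: monoid_alg_mult)
    also have "\<dots> = lin_ext pm_scale (\<lambda>y. Poly_Mapping.single y 1) p"
      using p by (intro lin_ext_cong) auto
    finally show ?thesis by (simp flip: pm_decomp)
  qed
  have "ring ?A"
  proof (rule ringI)
    show "abelian_group ?A"
    proof (rule abelian_groupI)
      fix p assume "p \<in> carrier ?A"
      then show "\<exists>q\<in>carrier ?A. q \<oplus>\<^bsub>?A\<^esub> p = \<zero>\<^bsub>?A\<^esub>"
        using keys_pm_scale[of "-1" p]
        by (intro bexI[of _ "pm_scale (-1) p"]) (auto intro!: poly_mapping_eqI simp: lookup_add)
    qed (use Poly_Mapping.keys_add in \<open>force simp: add_ac\<close>)+
    show "Group.monoid ?A"
      using closed assoc one_l one_r by (intro monoidI) auto
  qed (simp_all add: add_l add_r)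
  then interpret R: ring ?A .
  show ?thesis
  proof unfold_locales
    show "c \<odot>\<^bsub>?A\<^esub> x \<in> carrier ?A" if "x \<in> carrier ?A" for c x
      using that keys_pm_scale[of c x] by auto
  qed (auto simp: sc_l sc_r V.scale_left_distrib V.scale_right_distrib)
qed

lemma monoid_alg_minus:
  assumes "Group.monoid M" "Poly_Mapping.keys p \<subseteq> carrier M" "Poly_Mapping.keys q \<subseteq> carrier M"
  shows "p \<ominus>\<^bsub>monoid_alg M\<^esub> q = (p - q :: _ \<Rightarrow>\<^sub>0 'k::field)"
proof -
  interpret kalg "monoid_alg M :: ('k, _) module" by (rule kalg_monoid_alg) fact
  have "p \<ominus>\<^bsub>monoid_alg M\<^esub> q = p + pm_scale (-1) q"
    unfolding a_minus_def using smult_minus_1[of q] assms by simp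
  also have "\<dots> = p - q" by (auto intro!: poly_mapping_eqI simp: lookup_add lookup_minus)
  finally show ?thesis .
qed

lemma monoid_alg_induct [consumes 2, case_names zero add smult base]:
  fixes p :: "'m \<Rightarrow>\<^sub>0 'k::field"
  assumes "Group.monoid M" "p \<in> carrier (monoid_alg M)" "P 0"
    "\<And>p q. p \<in> carrier (monoid_alg M) \<Longrightarrow> q \<in> carrier (monoid_alg M) \<Longrightarrow> P p \<Longrightarrow> P q \<Longrightarrow> P (p + q)"
    "\<And>c p. p \<in> carrier (monoid_alg M) \<Longrightarrow> P p \<Longrightarrow> P (pm_scale c p)"
    "\<And>x. x \<in> carrier M \<Longrightarrow> P (Poly_Mapping.single x 1)"
  shows "P p"
proof -
  \<comment> \<open>The support condition is part of the invariant, since the hypotheses on sums and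
    multiples apply only inside the carrier.\<close>
  have "(\<Sum>x\<in>F. pm_scale (Poly_Mapping.lookup p x) (Poly_Mapping.single x 1)) \<in> {q. Poly_Mapping.keys q \<subseteq> carrier M \<and> P q}"
    if "finite F" "F \<subseteq> carrier M" for F
    using that
  proof (induction F)
    case (insert x F)
    let ?s = "pm_scale (Poly_Mapping.lookup p x) (Poly_Mapping.single x 1)"
    have s: "P ?s"
      by (rule assms(5)) (use insert assms(6) in auto)
    have s': "Poly_Mapping.keys ?s \<subseteq> carrier M"
      using insert by auto
    let ?t = "\<Sum>x\<in>F. pm_scale (Poly_Mapping.lookup p x) (Poly_Mapping.single x 1)"
    have t: "P ?t" "Poly_Mapping.keys ?t \<subseteq> carrier M"
      using insert by blast+
    have "P (?s + ?t)"
      using assms(4)[of ?s ?t] s s' t unfolding monoid_alg_simps mem_Collect_eq by blast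
    moreover have "Poly_Mapping.keys (?s + ?t) \<subseteq> carrier M"
      using s' t(2) Poly_Mapping.keys_add[of ?s ?t] by (meson Un_least order_trans)
    ultimately show ?case
      unfolding sum.insert[OF insert.hyps(1,2)] by blast
  qed (use assms in simp)
  from this[of "Poly_Mapping.keys p"] show ?thesis
    using assms(2) pm_decomp[of p] by (simp add: lin_ext_def)
qed

section \<open>Free algebras\<close>

abbreviation "word_monoid \<equiv> \<lparr>carrier = UNIV, monoid.mult = (@), one = []\<rparr>"

lemma monoid_words: "Group.monoid word_monoid"
  by (rule monoidI) auto

lemma kalg_free_alg: "kalg (free_alg :: ('k::field, 'g list \<Rightarrow>\<^sub>0 'k) module)"
  unfolding free_alg_def by (rule kalg_monoid_alg[OF monoid_words])

lemma free_alg_simps [simp]: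
  "carrier free_alg = UNIV" "\<one>\<^bsub>free_alg\<^esub> = Poly_Mapping.single [] 1"
  "\<zero>\<^bsub>free_alg\<^esub> = 0" "p \<oplus>\<^bsub>free_alg\<^esub> q = p + q" "c \<odot>\<^bsub>free_alg\<^esub> p = pm_scale c p"
  "Poly_Mapping.single w a \<otimes>\<^bsub>free_alg\<^esub> Poly_Mapping.single v b = Poly_Mapping.single (w @ v) (a * b)"
  "p \<ominus>\<^bsub>free_alg\<^esub> q = p - q"
  using monoid_alg_minus[OF monoid_words] by (auto simp: free_alg_def)

lemma free_alg_generated: "alg_gen free_alg (range (\<lambda>g. Poly_Mapping.single [g] 1)) = (UNIV :: ('g list \<Rightarrow>\<^sub>0 'k::field) set)"
proof -
  interpret kalg "free_alg :: ('k, 'g list \<Rightarrow>\<^sub>0 'k) module" by (rule kalg_free_alg)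
  let ?G = "alg_gen free_alg (range (\<lambda>g. Poly_Mapping.single [g] 1)) :: ('g list \<Rightarrow>\<^sub>0 'k) set"
  have s: "subalg ?G free_alg" by (rule subalg_alg_gen) simp
  have "Poly_Mapping.single w 1 \<in> ?G" for w :: "'g list"
  proof (induction w)
    case Nil
    then show ?case using subalgD(2)[OF s] by simp
  next
    case (Cons g w)
    have "Poly_Mapping.single [g] 1 \<in> ?G" by (rule subsetD[OF alg_gen_superset]) simp
    from subalgD(4)[OF s this Cons] show ?case by simp
  qed
  note w = this
  have "p \<in> ?G" for p
  proof -
    have "p \<in> carrier (monoid_alg word_monoid)" by simp
    with monoid_words show ?thesis
    proof (induction rule: monoid_alg_induct)
      case zero
      then show ?case using subalgD(6)[OF s] by simp
    next
      case (add p q)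
      then show ?case using subalgD(3)[OF s, of p q] by simp
    next
      case (smult c p)
      then show ?case using subalgD(5)[OF s, of p c] by simp
    qed (rule w)
  qed
  then show ?thesis by blast
qed

text \<open>Words go to products of the images of their letters, extended linearly. The target is a
  monoid algebra because \<open>lin_ext\<close> adds in a type; a quotient of a monoid algebra is
  reached by first choosing representatives for the images of the generators.\<close>

lemma free_alg_hom_monoid_alg:
  fixes f :: "'g \<Rightarrow> ('m \<Rightarrow>\<^sub>0 'k::field)"
  assumes "Group.monoid M" "\<And>g. f g \<in> carrier (monoid_alg M)"
  shows "\<exists>F \<in> alg_hom free_alg (monoid_alg M). \<forall>g. F (Poly_Mapping.single [g] 1) = f g"
proof -
  let ?B = "monoid_alg M :: ('k, 'm \<Rightarrow>\<^sub>0 'k) module"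
  interpret B: kalg ?B by (rule kalg_monoid_alg) fact
  interpret V: vector_space "pm_scale :: 'k \<Rightarrow> ('m \<Rightarrow>\<^sub>0 'k) \<Rightarrow> _" by (rule vector_space_pm_scale)
  define W where "W w = foldr (\<lambda>g. (\<otimes>\<^bsub>?B\<^esub>) (f g)) w \<one>\<^bsub>?B\<^esub>" for w
  have W0: "W [] = \<one>\<^bsub>?B\<^esub>" and WC: "\<And>g w. W (g # w) = f g \<otimes>\<^bsub>?B\<^esub> W w" by (simp_all add: W_def)
  have Wc: "W w \<in> carrier ?B" for w
    by (induction w) (use assms(2) B.one_closed B.m_closed W0 WC in metis)+
  have Wapp: "W (v @ w) = W v \<otimes>\<^bsub>?B\<^esub> W w" for v w
  proof (induction v)
    case Nil show ?case using B.l_one[OF Wc] W0 by simp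
  next
    case (Cons a v)
    then show ?case using B.m_assoc[OF assms(2) Wc Wc] by (simp add: WC)
  qed
  let ?F = "lin_ext pm_scale W"
  have Fc: "?F p \<in> carrier ?B" for p
    using keys_lin_ext[of W p] Wc by fastforce
  have Fm: "?F (p \<otimes>\<^bsub>free_alg\<^esub> q) = ?F p \<otimes>\<^bsub>?B\<^esub> ?F q" for p q
  proof -
    have "?F (p \<otimes>\<^bsub>free_alg\<^esub> q) = lin_ext pm_scale (\<lambda>x. lin_ext pm_scale (\<lambda>y. W x \<otimes>\<^bsub>?B\<^esub> W y) q) p"
      by (simp add: free_alg_def monoid_alg_mult[where M = word_monoid] V.lin_ext_comp Wapp)
    also have "\<dots> = lin_ext pm_scale (\<lambda>x. W x \<otimes>\<^bsub>?B\<^esub> ?F q) p"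
      by (intro lin_ext_cong, subst (2) monoid_alg_mult)
        (simp add: V.lin_ext_comp V.lin_ext_swap[of _ q] monoid_alg_mult)
    also have "\<dots> = ?F p \<otimes>\<^bsub>?B\<^esub> ?F q"
      by (simp add: monoid_alg_mult V.lin_ext_comp)
    finally show ?thesis .
  qed
  have "?F \<in> alg_hom free_alg ?B"
    unfolding alg_hom_def ring_hom_def using Fc
    by (auto simp: Fm V.lin_ext_add V.lin_ext_scale W0)
  moreover have "?F (Poly_Mapping.single [g] 1) = f g" for g
    using B.r_one[OF assms(2)] by (simp add: W0 WC)
  ultimately show ?thesis by blast
qed

section \<open>Tensor products\<close>

locale kalg_pair = A: kalg A + B: kalg B
  for A :: "('k::field, 'a) module" and B :: "('k, 'b) module"
begin

abbreviation "M \<equiv> monoid_alg (A \<times>\<times> B) :: ('k, 'a \<times> 'b \<Rightarrow>\<^sub>0 'k) module"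
abbreviation "N \<equiv> tensor_null A B"
abbreviation "T \<equiv> tensor_alg A B"
abbreviation "pt \<equiv> pure_tensor A B"
abbreviation "\<delta> a b \<equiv> Poly_Mapping.single (a, b) (1::'k)"

lemma monoid_prod: "Group.monoid (A \<times>\<times> B)"
  by (rule DirProd_monoid) unfold_locales

sublocale M: kalg M
  by (rule kalg_monoid_alg[OF monoid_prod])

lemma single_in_M: "a \<in> carrier A \<Longrightarrow> b \<in> carrier B \<Longrightarrow> Poly_Mapping.single (a, b) c \<in> carrier M"
  by auto

lemma minus_in_M:
  assumes "x \<in> carrier M" "y \<in> carrier M" shows "x - y \<in> carrier M"
  using M.minus_closed[OF assms] monoid_alg_minus[OF monoid_prod, of x y] assms by simp

lemma M_minus: "x \<in> carrier M \<Longrightarrow> y \<in> carrier M \<Longrightarrow> x \<ominus>\<^bsub>M\<^esub> y = x - y"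
  using monoid_alg_minus[OF monoid_prod] by simp

lemma tensor_rels_cases:
  assumes "r \<in> tensor_rels A B"
  obtains (add_left) a a' b where "r = \<delta> (a \<oplus>\<^bsub>A\<^esub> a') b - \<delta> a b - \<delta> a' b"
      "a \<in> carrier A" "a' \<in> carrier A" "b \<in> carrier B"
    | (add_right) a b b' where "r = \<delta> a (b \<oplus>\<^bsub>B\<^esub> b') - \<delta> a b - \<delta> a b'"
      "a \<in> carrier A" "b \<in> carrier B" "b' \<in> carrier B"
    | (smult_left) c a b where "r = \<delta> (c \<odot>\<^bsub>A\<^esub> a) b - Poly_Mapping.single (a, b) c"
      "a \<in> carrier A" "b \<in> carrier B"
    | (smult_right) c a b where "r = \<delta> a (c \<odot>\<^bsub>B\<^esub> b) - Poly_Mapping.single (a, b) c"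
      "a \<in> carrier A" "b \<in> carrier B"
  using assms unfolding tensor_rels_def by blast

lemma tensor_rels_intros:
  "a \<in> carrier A \<Longrightarrow> a' \<in> carrier A \<Longrightarrow> b \<in> carrier B \<Longrightarrow> \<delta> (a \<oplus>\<^bsub>A\<^esub> a') b - \<delta> a b - \<delta> a' b \<in> tensor_rels A B"
  "a \<in> carrier A \<Longrightarrow> b \<in> carrier B \<Longrightarrow> b' \<in> carrier B \<Longrightarrow> \<delta> a (b \<oplus>\<^bsub>B\<^esub> b') - \<delta> a b - \<delta> a b' \<in> tensor_rels A B"
  "a \<in> carrier A \<Longrightarrow> b \<in> carrier B \<Longrightarrow> \<delta> (c \<odot>\<^bsub>A\<^esub> a) b - Poly_Mapping.single (a, b) c \<in> tensor_rels A B"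
  "a \<in> carrier A \<Longrightarrow> b \<in> carrier B \<Longrightarrow> \<delta> a (c \<odot>\<^bsub>B\<^esub> b) - Poly_Mapping.single (a, b) c \<in> tensor_rels A B"
  unfolding tensor_rels_def by blast+

lemma tensor_rels_subset: "tensor_rels A B \<subseteq> carrier M"
proof
  fix r assume "r \<in> tensor_rels A B"
  then show "r \<in> carrier M"
    by (cases rule: tensor_rels_cases)
      (simp_all only:, (intro minus_in_M single_in_M A.add.m_closed B.add.m_closed A.smult_closed B.smult_closed; assumption)+)
qed

lemma lin_subspace_N: "lin_subspace N M"
  unfolding tensor_null_def by (rule M.lin_subspace_lin_span[OF tensor_rels_subset])

text \<open>Multiplying a bilinearity relation by a basis element gives a bilinearity relation of
  the same kind, by distributivity in one factor. This is why the span of the relations is a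
  two-sided ideal.\<close>

lemma rels_mult:
  assumes r: "r \<in> tensor_rels A B" and ab: "a' \<in> carrier A" "b' \<in> carrier B"
  shows "r \<otimes>\<^bsub>M\<^esub> \<delta> a' b' \<in> tensor_rels A B" "\<delta> a' b' \<otimes>\<^bsub>M\<^esub> r \<in> tensor_rels A B"
proof -
  interpret V: vector_space "pm_scale :: 'k \<Rightarrow> ('a \<times> 'b \<Rightarrow>\<^sub>0 'k) \<Rightarrow> _" by (rule vector_space_pm_scale)
  have dl: "(x - y) \<otimes>\<^bsub>M\<^esub> \<delta> a' b' = x \<otimes>\<^bsub>M\<^esub> \<delta> a' b' - y \<otimes>\<^bsub>M\<^esub> \<delta> a' b'" for x y
    unfolding monoid_alg_mult V.lin_ext_diff ..
  have dr: "\<delta> a' b' \<otimes>\<^bsub>M\<^esub> (x - y) = \<delta> a' b' \<otimes>\<^bsub>M\<^esub> x - \<delta> a' b' \<otimes>\<^bsub>M\<^esub> y" for x y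
    unfolding monoid_alg_mult V.lin_ext_diff V.lin_ext_single V.scale_one ..
  show "r \<otimes>\<^bsub>M\<^esub> \<delta> a' b' \<in> tensor_rels A B"
    using r
  proof (cases rule: tensor_rels_cases)
    case (add_left x y z)
    show ?thesis
      unfolding add_left(1) dl monoid_alg_mult_single mult_DirProd mult_1_left mult_1_right
        A.l_distr[OF add_left(2,3) ab(1)]
      by (intro tensor_rels_intros A.m_closed B.m_closed ab add_left)
  next
    case (add_right x y z)
    show ?thesis
      unfolding add_right(1) dl monoid_alg_mult_single mult_DirProd mult_1_left mult_1_right
        B.l_distr[OF add_right(3,4) ab(2)]
      by (intro tensor_rels_intros A.m_closed B.m_closed ab add_right)
  next
    case (smult_left c x y)
    show ?thesis
      unfolding smult_left(1) dl monoid_alg_mult_single mult_DirProd mult_1_left mult_1_right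
        A.smult_mult_left[OF smult_left(2) ab(1)]
      by (intro tensor_rels_intros A.m_closed B.m_closed ab smult_left)
  next
    case (smult_right c x y)
    show ?thesis
      unfolding smult_right(1) dl monoid_alg_mult_single mult_DirProd mult_1_left mult_1_right
        B.smult_mult_left[OF smult_right(3) ab(2)]
      by (intro tensor_rels_intros A.m_closed B.m_closed ab smult_right)
  qed
  show "\<delta> a' b' \<otimes>\<^bsub>M\<^esub> r \<in> tensor_rels A B"
    using r
  proof (cases rule: tensor_rels_cases)
    case (add_left x y z)
    show ?thesis
      unfolding add_left(1) dr monoid_alg_mult_single mult_DirProd mult_1_left mult_1_right
        A.r_distr[OF add_left(2,3) ab(1)]
      by (intro tensor_rels_intros A.m_closed B.m_closed ab add_left)
  next
    case (add_right x y z)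
    show ?thesis
      unfolding add_right(1) dr monoid_alg_mult_single mult_DirProd mult_1_left mult_1_right
        B.r_distr[OF add_right(3,4) ab(2)]
      by (intro tensor_rels_intros A.m_closed B.m_closed ab add_right)
  next
    case (smult_left c x y)
    show ?thesis
      unfolding smult_left(1) dr monoid_alg_mult_single mult_DirProd mult_1_left mult_1_right
        A.smult_mult_right[OF ab(1) smult_left(2)]
      by (intro tensor_rels_intros A.m_closed B.m_closed ab smult_left)
  next
    case (smult_right c x y)
    show ?thesis
      unfolding smult_right(1) dr monoid_alg_mult_single mult_DirProd mult_1_left mult_1_right
        B.smult_mult_right[OF ab(2) smult_right(3)]
      by (intro tensor_rels_intros A.m_closed B.m_closed ab smult_right)
  qed
qed

lemma N_mult_single:
  assumes "x \<in> N" and ab: "a \<in> carrier A" "b \<in> carrier B"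
  shows "x \<otimes>\<^bsub>M\<^esub> \<delta> a b \<in> N \<and> \<delta> a b \<otimes>\<^bsub>M\<^esub> x \<in> N"
  using assms(1)[unfolded tensor_null_def] tensor_rels_subset
proof (induction rule: M.lin_span_induct)
  case zero
  then show ?case using M.l_null[OF single_in_M[OF ab]] M.r_null[OF single_in_M[OF ab]] M.lin_subspaceD(2)[OF lin_subspace_N]
    by metis
next
  case (add x y)
  then show ?case
    using M.l_distr[of x y "\<delta> a b"] M.r_distr[of x y "\<delta> a b"] M.lin_subspaceD(3)[OF lin_subspace_N] single_in_M[OF ab]
    by metis
next
  case (smult c x)
  then show ?case
    using M.smult_mult_left[of x "\<delta> a b" c] M.smult_mult_right[of "\<delta> a b" x c] M.lin_subspaceD(4)[OF lin_subspace_N] single_in_M[OF ab]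
    by metis
next
  case (base x)
  then show ?case using rels_mult[OF base ab] M.lin_span_superset unfolding tensor_null_def by blast
qed

lemma N_mult:
  assumes "y \<in> carrier M" "x \<in> N"
  shows "x \<otimes>\<^bsub>M\<^esub> y \<in> N \<and> y \<otimes>\<^bsub>M\<^esub> x \<in> N"
proof -
  note N = M.lin_subspaceD[OF lin_subspace_N]
  have x: "x \<in> carrier M" using N(1) assms(2) by blast
  from monoid_prod assms(1) show ?thesis
  proof (induction rule: monoid_alg_induct)
    case zero
    show ?case using M.l_null[OF x] M.r_null[OF x] N(2) by simp
  next
    case (add p q)
    then show ?case using M.l_distr[of p q x] M.r_distr[of p q x] x N(3) by (metis monoid_alg_simps(4))
  next
    case (smult c p)
    then show ?case using M.smult_mult_left[of p x c] M.smult_mult_right[of x p c] x N(4) by (metis monoid_alg_simps(5))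
  next
    case (base z)
    then show ?case using N_mult_single[OF assms(2), of "fst z" "snd z"] by (cases z) auto
  qed
qed

lemma ideal_N: "ideal N M"
proof (rule idealI)
  show "ring M" by unfold_locales
  show "subgroup N (add_monoid M)" using lin_subspace_N by (simp add: lin_subspace_def)
qed (use N_mult in blast)+

sublocale T: kalg T
  unfolding tensor_alg_def by (rule M.kalg_quot_alg[OF ideal_N])

lemmas T_simps = M.quot_alg_simps[OF ideal_N, folded tensor_alg_def]

lemma pt_closed [simp, intro]: "a \<in> carrier A \<Longrightarrow> b \<in> carrier B \<Longrightarrow> pt a b \<in> carrier T"
  unfolding pure_tensor_def T_simps(1) by (rule imageI[OF single_in_M])

lemma pt_mult:
  assumes "a \<in> carrier A" "b \<in> carrier B" "a' \<in> carrier A" "b' \<in> carrier B"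
  shows "pt a b \<otimes>\<^bsub>T\<^esub> pt a' b' = pt (a \<otimes>\<^bsub>A\<^esub> a') (b \<otimes>\<^bsub>B\<^esub> b')"
  unfolding pure_tensor_def T_simps(3)[OF single_in_M[OF assms(1,2)] single_in_M[OF assms(3,4)]]
    monoid_alg_mult_single mult_DirProd mult_1_left ..

lemma pt_one: "\<one>\<^bsub>T\<^esub> = pt \<one>\<^bsub>A\<^esub> \<one>\<^bsub>B\<^esub>"
  unfolding pure_tensor_def T_simps(4) monoid_alg_simps one_DirProd ..

lemma T_eqI:
  assumes "x \<in> carrier M" "y \<in> carrier M" "x - y \<in> tensor_rels A B"
  shows "N +>\<^bsub>M\<^esub> x = N +>\<^bsub>M\<^esub> y"
  unfolding T_simps(7)[OF assms(1,2)] M_minus[OF assms(1,2)] unfolding tensor_null_def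
  by (rule subsetD[OF M.lin_span_superset assms(3)])

lemma pt_add_left:
  assumes "a \<in> carrier A" "a' \<in> carrier A" "b \<in> carrier B"
  shows "pt (a \<oplus>\<^bsub>A\<^esub> a') b = pt a b \<oplus>\<^bsub>T\<^esub> pt a' b"
proof -
  have c: "\<delta> a b \<in> carrier M" "\<delta> a' b \<in> carrier M" "\<delta> (a \<oplus>\<^bsub>A\<^esub> a') b \<in> carrier M"
    by (intro single_in_M A.add.m_closed B.add.m_closed assms)+
  have "pt a b \<oplus>\<^bsub>T\<^esub> pt a' b = N +>\<^bsub>M\<^esub> (\<delta> a b \<oplus>\<^bsub>M\<^esub> \<delta> a' b)"
    unfolding pure_tensor_def by (rule T_simps(2)[OF c(1,2)])
  also have "\<dots> = pt (a \<oplus>\<^bsub>A\<^esub> a') b"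
    unfolding pure_tensor_def
    by (rule T_eqI[OF c(3) M.add.m_closed[OF c(1,2)], symmetric])
      (use tensor_rels_intros(1)[OF assms] in \<open>simp only: monoid_alg_simps diff_diff_eq\<close>)
  finally show ?thesis by (rule sym)
qed

lemma pt_add_right:
  assumes "a \<in> carrier A" "b \<in> carrier B" "b' \<in> carrier B"
  shows "pt a (b \<oplus>\<^bsub>B\<^esub> b') = pt a b \<oplus>\<^bsub>T\<^esub> pt a b'"
proof -
  have c: "\<delta> a b \<in> carrier M" "\<delta> a b' \<in> carrier M" "\<delta> a (b \<oplus>\<^bsub>B\<^esub> b') \<in> carrier M"
    by (intro single_in_M A.add.m_closed B.add.m_closed assms)+
  have "pt a b \<oplus>\<^bsub>T\<^esub> pt a b' = N +>\<^bsub>M\<^esub> (\<delta> a b \<oplus>\<^bsub>M\<^esub> \<delta> a b')"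
    unfolding pure_tensor_def by (rule T_simps(2)[OF c(1,2)])
  also have "\<dots> = pt a (b \<oplus>\<^bsub>B\<^esub> b')"
    unfolding pure_tensor_def
    by (rule T_eqI[OF c(3) M.add.m_closed[OF c(1,2)], symmetric])
      (use tensor_rels_intros(2)[OF assms] in \<open>simp only: monoid_alg_simps diff_diff_eq\<close>)
  finally show ?thesis by (rule sym)
qed

lemma pt_smult:
  assumes "a \<in> carrier A" "b \<in> carrier B"
  shows "pt (c \<odot>\<^bsub>A\<^esub> a) b = c \<odot>\<^bsub>T\<^esub> pt a b" "pt a (c \<odot>\<^bsub>B\<^esub> b) = c \<odot>\<^bsub>T\<^esub> pt a b"
proof -
  have "c \<odot>\<^bsub>T\<^esub> pt a b = N +>\<^bsub>M\<^esub> (c \<odot>\<^bsub>M\<^esub> \<delta> a b)"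
    unfolding pure_tensor_def by (rule T_simps(6)[OF single_in_M[OF assms]])
  also have "c \<odot>\<^bsub>M\<^esub> \<delta> a b = Poly_Mapping.single (a, b) c" by simp
  finally have *: "c \<odot>\<^bsub>T\<^esub> pt a b = N +>\<^bsub>M\<^esub> Poly_Mapping.single (a, b) c" .
  show "pt (c \<odot>\<^bsub>A\<^esub> a) b = c \<odot>\<^bsub>T\<^esub> pt a b" unfolding * unfolding pure_tensor_def
    by (rule T_eqI[OF single_in_M single_in_M tensor_rels_intros(3)[OF assms]]) (use assms in blast)+
  show "pt a (c \<odot>\<^bsub>B\<^esub> b) = c \<odot>\<^bsub>T\<^esub> pt a b" unfolding * unfolding pure_tensor_def
    by (rule T_eqI[OF single_in_M single_in_M tensor_rels_intros(4)[OF assms]]) (use assms in blast)+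
qed

text \<open>The linear extension of a bilinear g kills each of the four kinds of relations, hence
  their span, and so factors through the quotient.\<close>

lemma tensor_lift_exists:
  fixes s :: "'k \<Rightarrow> 'v \<Rightarrow> 'v::ab_group_add" and g :: "'a \<Rightarrow> 'b \<Rightarrow> 'v"
  assumes s: "vector_space s"
    and g: "\<And>a a' b. a \<in> carrier A \<Longrightarrow> a' \<in> carrier A \<Longrightarrow> b \<in> carrier B \<Longrightarrow> g (a \<oplus>\<^bsub>A\<^esub> a') b = g a b + g a' b"
    "\<And>a b b'. a \<in> carrier A \<Longrightarrow> b \<in> carrier B \<Longrightarrow> b' \<in> carrier B \<Longrightarrow> g a (b \<oplus>\<^bsub>B\<^esub> b') = g a b + g a b'"
    "\<And>c a b. a \<in> carrier A \<Longrightarrow> b \<in> carrier B \<Longrightarrow> g (c \<odot>\<^bsub>A\<^esub> a) b = s c (g a b)"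
    "\<And>c a b. a \<in> carrier A \<Longrightarrow> b \<in> carrier B \<Longrightarrow> g a (c \<odot>\<^bsub>B\<^esub> b) = s c (g a b)"
  obtains G where "\<And>a b. a \<in> carrier A \<Longrightarrow> b \<in> carrier B \<Longrightarrow> G (pt a b) = g a b"
    "\<And>x y. x \<in> carrier T \<Longrightarrow> y \<in> carrier T \<Longrightarrow> G (x \<oplus>\<^bsub>T\<^esub> y) = G x + G y"
    "\<And>c x. x \<in> carrier T \<Longrightarrow> G (c \<odot>\<^bsub>T\<^esub> x) = s c (G x)"
proof -
  interpret s: vector_space s by fact
  let ?g = "lin_ext s (\<lambda>(a, b). g a b)"
  have z: "?g x = 0" if "x \<in> N" for x
    using that[unfolded tensor_null_def] tensor_rels_subset
  proof (induction rule: M.lin_span_induct)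
    case (base r)
    then show ?case by (cases rule: tensor_rels_cases) (simp_all add: s.lin_ext_diff g)
  qed (simp_all add: s.lin_ext_add s.lin_ext_scale)
  define G where "G = quot_lift M N ?g"
  have G: "G (N +>\<^bsub>M\<^esub> x) = ?g x" if "x \<in> carrier M" for x
    unfolding G_def
  proof (rule M.quot_lift_proj[OF _ that])
    fix y assume y: "y \<in> carrier M" "N +>\<^bsub>M\<^esub> x = N +>\<^bsub>M\<^esub> y"
    then have "?g (x - y) = 0" using T_simps(7)[OF that y(1)] M_minus[OF that y(1)] z by auto
    then show "?g x = ?g y" by (simp add: s.lin_ext_diff)
  qed
  show thesis
  proof (rule that)
    show "G (pt a b) = g a b" if "a \<in> carrier A" "b \<in> carrier B" for a b
      using G[OF single_in_M[OF that], of 1] by (simp add: pure_tensor_def)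
    fix x assume "x \<in> carrier T"
    then obtain x' where x: "x' \<in> carrier M" "x = N +>\<^bsub>M\<^esub> x'" by (auto simp only: T_simps(1))
    show "G (c \<odot>\<^bsub>T\<^esub> x) = s c (G x)" for c
      using G[OF x(1)] G[OF M.smult_closed[OF x(1)], of c] x by (simp add: T_simps(6) s.lin_ext_scale)
    fix y assume "y \<in> carrier T"
    then obtain y' where y: "y' \<in> carrier M" "y = N +>\<^bsub>M\<^esub> y'" by (auto simp only: T_simps(1))
    show "G (x \<oplus>\<^bsub>T\<^esub> y) = G x + G y"
      using G[OF x(1)] G[OF y(1)] G[OF M.add.m_closed[OF x(1) y(1)]] x y by (simp add: T_simps(2) s.lin_ext_add)
  qed
qed

abbreviation "span_left S \<equiv> lin_span T {pt a b | a b. a \<in> S \<and> b \<in> carrier B}"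

text \<open>The product of two pure tensors with left factors in S is a pure tensor of the same
  kind. Consequently the coideal condition for a generated subalgebra can be tested on generators
  alone.\<close>

lemma subalg_span_left:
  assumes S: "subalg S A" shows "subalg (span_left S) T"
proof -
  let ?U = "{pt a b | a b. a \<in> S \<and> b \<in> carrier B}"
  have SA: "S \<subseteq> carrier A" using A.subalgD(1)[OF S] .
  have U: "?U \<subseteq> carrier T" using SA pt_closed by blast
  note L = T.lin_subspaceD[OF T.lin_subspace_lin_span[OF U]]
  have um: "x \<otimes>\<^bsub>T\<^esub> u \<in> span_left S" if x: "x \<in> span_left S" and u: "u \<in> ?U" for x u
    using x U
  proof (induction rule: T.lin_span_induct)
    case (base x)
    then obtain a b a' b' where ab: "a \<in> S" "a' \<in> S" "b \<in> carrier B" "b' \<in> carrier B" "x = pt a b" "u = pt a' b'"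
      using u by blast
    then have "x \<otimes>\<^bsub>T\<^esub> u = pt (a \<otimes>\<^bsub>A\<^esub> a') (b \<otimes>\<^bsub>B\<^esub> b')"
      using pt_mult[of a b a' b'] SA by (metis subsetD)
    moreover have "a \<otimes>\<^bsub>A\<^esub> a' \<in> S" "b \<otimes>\<^bsub>B\<^esub> b' \<in> carrier B"
      using A.subalgD(4)[OF S] ab by auto
    ultimately have "x \<otimes>\<^bsub>T\<^esub> u \<in> ?U" by blast
    then show ?case by (rule subsetD[OF T.lin_span_superset])
  next
    case zero
    have "u \<in> carrier T" using u U by blast
    show ?case unfolding T.l_null[OF \<open>u \<in> carrier T\<close>] by (rule L(2))
  next
    case (add x y)
    have "u \<in> carrier T" using u U by blast
    show ?case unfolding T.l_distr[OF add(1,2) \<open>u \<in> carrier T\<close>] by (rule L(3)[OF add(3,4)])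
  next
    case (smult c x)
    have "u \<in> carrier T" using u U by blast
    show ?case unfolding T.smult_mult_left[OF smult(1) \<open>u \<in> carrier T\<close>] by (rule L(4)[OF smult(2)])
  qed
  have mm: "x \<otimes>\<^bsub>T\<^esub> y \<in> span_left S" if x: "x \<in> span_left S" and y: "y \<in> span_left S" for x y
    using y U
  proof (induction rule: T.lin_span_induct)
    case (base u)
    then show ?case using um x by blast
  next
    case zero
    have "x \<in> carrier T" using x L(1) by blast
    show ?case unfolding T.r_null[OF \<open>x \<in> carrier T\<close>] by (rule L(2))
  next
    case (add u v)
    have "x \<in> carrier T" using x L(1) by blast
    show ?case unfolding T.r_distr[OF add(1,2) \<open>x \<in> carrier T\<close>] by (rule L(3)[OF add(3,4)])
  next
    case (smult c u)
    have "x \<in> carrier T" using x L(1) by blast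
    show ?case unfolding T.smult_mult_right[OF \<open>x \<in> carrier T\<close> smult(1)] by (rule L(4)[OF smult(2)])
  qed
  have "\<one>\<^bsub>T\<^esub> \<in> ?U" using pt_one A.subalgD(2)[OF S] B.one_closed by blast
  then have "\<one>\<^bsub>T\<^esub> \<in> span_left S" by (rule subsetD[OF T.lin_span_superset])
  note one = this
  show ?thesis
  proof (rule T.subalgI)
    show "span_left S \<subseteq> carrier T" by (rule L(1))
    show "\<one>\<^bsub>T\<^esub> \<in> span_left S" by (rule one)
    show "x \<oplus>\<^bsub>T\<^esub> y \<in> span_left S" if "x \<in> span_left S" "y \<in> span_left S" for x y by (rule L(3)[OF that])
    show "x \<otimes>\<^bsub>T\<^esub> y \<in> span_left S" if "x \<in> span_left S" "y \<in> span_left S" for x y by (rule mm[OF that])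
    show "c \<odot>\<^bsub>T\<^esub> x \<in> span_left S" if "x \<in> span_left S" for c x by (rule L(4)[OF that])
  qed
qed

end

section \<open>The polynomial model\<close>

text \<open>The PBW basis \<open>X\<^sup>j Y\<^sup>k Z\<^sup>i\<close> identifies \<open>A(\<lambda>\<^sub>1, \<lambda>\<^sub>2, \<alpha>)\<close> with the vector space \<open>\<bbbk>[y][x][z]\<close>: the outermost
  polynomial variable is \<open>z\<close>, the innermost one \<open>y\<close>. Left multiplication by \<open>Z\<close> becomes \<open>Zop\<close>, as \<open>[Z, r] = delta r\<close> for
  \<open>r \<in> \<bbbk>[x,y]\<close>.\<close>

type_synonym 'k bipoly = "'k poly poly"
type_synonym 'k pbw = "'k bipoly poly"

abbreviation cst :: "'k::comm_ring_1 \<Rightarrow> 'k bipoly" where "cst c \<equiv> [:[:c:]:]"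
abbreviation xx :: "'k::comm_ring_1 bipoly" where "xx \<equiv> [:0, 1:]"
abbreviation yy :: "'k::comm_ring_1 bipoly" where "yy \<equiv> [:[:0, 1:]:]"
abbreviation dx :: "'k::idom bipoly \<Rightarrow> 'k bipoly" where "dx \<equiv> pderiv"
abbreviation dy :: "'k::idom bipoly \<Rightarrow> 'k bipoly" where "dy \<equiv> map_poly pderiv"
abbreviation pbw_scale :: "'k::comm_ring_1 \<Rightarrow> 'k pbw \<Rightarrow> 'k pbw" where "pbw_scale c \<equiv> smult (cst c)"

lemma vector_space_pbw_scale: "vector_space (pbw_scale :: 'k::field \<Rightarrow> _)"
  by unfold_locales (simp_all add: smult_add_right flip: smult_add_left one_pCons)

lemma dy_add: "dy (r + s) = dy r + dy s"
  by (rule poly_eqI) (simp add: coeff_map_poly pderiv_add)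

lemma dy_diff: "dy (r - s) = dy r - dy s"
  by (rule poly_eqI) (simp add: coeff_map_poly pderiv_diff)

lemma dx_dy: "dx (dy r) = dy (dx r)"
  by (rule poly_eqI) (simp add: coeff_map_poly coeff_pderiv pderiv_smult pderiv_mult flip: of_nat_Suc)

lemma dy_mult: "dy (r * s) = dy r * s + r * dy s"
proof (rule poly_eqI)
  fix n
  have "pderiv (\<Sum>i\<in>I. f i) = (\<Sum>i\<in>I. pderiv (f i))" for f :: "nat \<Rightarrow> 'a poly" and I
    by (induction I rule: infinite_finite_induct) (auto simp: pderiv_add)
  then show "coeff (dy (r * s)) n = coeff (dy r * s + r * dy s) n"
    by (simp add: coeff_map_poly coeff_mult pderiv_mult sum.distrib) (simp add: mult.commute add.commute)
qed

lemma dy_pCons: "dy (pCons a r) = pCons (pderiv a) (dy r)"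
  by (rule poly_eqI) (simp add: coeff_map_poly coeff_pCons split: nat.split)

text \<open>Constants, sums and multiplications by the two variables reach every polynomial.
  Statements about operators can thus be proved from their behaviour under these
  multiplications.\<close>

lemma bipoly_induct [case_names const add mult_x mult_y]:
  assumes "\<And>c. P (cst c)" "\<And>r s. P r \<Longrightarrow> P s \<Longrightarrow> P (r + s)"
    "\<And>r. P r \<Longrightarrow> P (xx * r)" "\<And>r. P r \<Longrightarrow> P (yy * r)"
  shows "P r"
proof (induction r)
  case 0
  then show ?case using assms(1)[of 0] by simp
next
  case (pCons s r)
  have "P [:s:]"
  proof (induction s)
    case 0
    then show ?case using assms(1)[of 0] by simp
  next
    case (pCons c s)
    have "[:pCons c s:] = cst c + yy * [:s:]" by simp
    then show ?case using assms(1,2,4) pCons by metis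
  qed
  moreover have "pCons s r = [:s:] + xx * r" by simp
  ultimately show ?case using assms(2,3) pCons by metis
qed

locale ha =
  fixes l1 l2 \<alpha> :: "'k::field_char_0"
begin

definition delta :: "'k bipoly \<Rightarrow> 'k bipoly" where
  "delta r = (cst l1 * xx - cst \<alpha> * yy) * dx r + cst l2 * yy * dy r"

definition Zop :: "'k pbw \<Rightarrow> 'k pbw" where
  "Zop q = pCons 0 q + map_poly delta q"

lemma delta_0 [simp]: "delta 0 = 0"
  by (simp add: delta_def)

lemma delta_cst [simp]: "delta (cst c) = 0"
  by (simp add: delta_def map_poly_pCons)

lemma delta_xx: "delta xx = cst l1 * xx - cst \<alpha> * yy"
  by (simp add: delta_def pderiv_pCons dy_pCons)

lemma delta_yy: "delta yy = cst l2 * yy"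
  by (simp add: delta_def dy_pCons pderiv_pCons)

lemma delta_add: "delta (r + s) = delta r + delta s"
  by (simp add: delta_def pderiv_add dy_add algebra_simps del: mult_pCons_left mult_pCons_right)

lemma delta_mult: "delta (r * s) = delta r * s + r * delta s"
  unfolding delta_def pderiv_mult dy_mult by (simp only: algebra_simps)

lemma coeff_Zop: "coeff (Zop q) n = (case n of 0 \<Rightarrow> 0 | Suc m \<Rightarrow> coeff q m) + delta (coeff q n)"
  by (simp add: Zop_def coeff_map_poly coeff_pCons)

lemma Zop_add: "Zop (p + q) = Zop p + Zop q"
  by (rule poly_eqI) (simp add: coeff_Zop delta_add split: nat.split)

lemma Zop_smult: "Zop (smult r q) = smult r (Zop q) + smult (delta r) q"
  by (rule poly_eqI) (simp add: coeff_Zop delta_mult algebra_simps del: mult_pCons_left mult_pCons_right split: nat.split)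

lemma Zop_const: "Zop [:r:] = [:delta r, r:]"
  by (rule poly_eqI) (simp add: coeff_Zop coeff_pCons split: nat.split)

text \<open>The left multiplications by x, y and z generate the model from the constants:
  \<open>pCons a q'\<close> is the constant a plus \<open>Zop q'\<close> minus
  \<open>map_poly delta q'\<close>, and both q' and this correction have smaller degree in
  z.\<close>

lemma pbw_Zop_induct [case_names const add mult_x mult_y Z]:
  assumes const: "\<And>c. P [:cst c:]" and add: "\<And>p q. P p \<Longrightarrow> P q \<Longrightarrow> P (p + q)"
    and x: "\<And>q. P q \<Longrightarrow> P (smult xx q)" and y: "\<And>q. P q \<Longrightarrow> P (smult yy q)" and z: "\<And>q. P q \<Longrightarrow> P (Zop q)"
  shows "P q"
proof -
  have r: "P [:r:]" for r
  proof (induction r rule: bipoly_induct)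
    case (const c)
    show ?case by (rule assms(1))
  next
    case (add r s)
    then show ?case using assms(2)[of "[:r:]" "[:s:]"] by simp
  next
    case (mult_x r)
    then show ?case using x[of "[:r:]"] by simp
  next
    case (mult_y r)
    then show ?case using y[of "[:r:]"] by simp
  qed
  show ?thesis
  proof (induction "degree q" arbitrary: q rule: less_induct)
    case less
    show ?case
    proof (cases q)
      case (pCons a q')
      show ?thesis
      proof (cases "q' = 0")
        case True
        then show ?thesis using r pCons by simp
      next
        case False
        then have d: "degree q' < degree q" using pCons by simp
        let ?m = "- map_poly delta q'"
        have deg: "degree (map_poly delta q') \<le> degree q'"
          by (rule degree_le) (simp add: coeff_map_poly coeff_eq_0)
        have "degree ?m < degree q"
          using d deg by simp
        then have "P ?m" "P (Zop q')" using less d z by blast+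
        then have "P ([:a:] + (Zop q' + ?m))" using r add by blast
        moreover have "[:a:] + (Zop q' + ?m) = q"
          by (rule poly_eqI) (simp add: coeff_Zop coeff_map_poly coeff_pCons pCons split: nat.split)
        ultimately show ?thesis by simp
      qed
    qed
  qed
qed

end

section \<open>The PBW theorem\<close>

context ha
begin

abbreviation "FA \<equiv> free_alg :: ('k, gen list \<Rightarrow>\<^sub>0 'k) module"
abbreviation "I \<equiv> HA_ideal l1 l2 \<alpha>"
abbreviation "H \<equiv> HA l1 l2 \<alpha>"
abbreviation "wd w \<equiv> Poly_Mapping.single w (1::'k)"

sublocale F: kalg FA by (rule kalg_free_alg)

lemma ideal_I: "ideal I FA"
  unfolding HA_ideal_def by (rule F.genideal_ideal) simp

lemma rels_subset_I: "HA_rels l1 l2 \<alpha> \<subseteq> I"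
  unfolding HA_ideal_def by (rule F.genideal_self) simp

sublocale H: kalg H
  unfolding HA_def by (rule F.kalg_quot_alg[OF ideal_I])

definition X where "X = HA_gen l1 l2 \<alpha> GX"
definition Y where "Y = HA_gen l1 l2 \<alpha> GY"
definition Z where "Z = HA_gen l1 l2 \<alpha> GZ"
definition proj where "proj p = I +>\<^bsub>FA\<^esub> p"

lemma proj_gen: "proj (wd [GX]) = X" "proj (wd [GY]) = Y" "proj (wd [GZ]) = Z"
  by (simp_all add: proj_def X_def Y_def Z_def HA_gen_def free_monom_def)

lemma proj_hom: "proj \<in> alg_hom FA H"
  using F.quot_proj_hom[OF ideal_I] unfolding proj_def[abs_def] HA_def .

lemmas proj_simps = alg_homD[OF proj_hom, simplified]

lemma carrier_H: "carrier H = range proj"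
  using F.quot_alg_simps(1)[OF ideal_I] by (simp add: HA_def proj_def[abs_def])

lemma proj_eq_iff: "proj p = proj q \<longleftrightarrow> p - q \<in> I"
  using F.quot_alg_simps(7)[OF ideal_I, of p q] by (simp add: proj_def)

lemma gen_closed [simp]: "X \<in> carrier H" "Y \<in> carrier H" "Z \<in> carrier H"
  by (simp_all add: carrier_H flip: proj_gen)

text \<open>Oriented as rewrite rules: two generators in the wrong order are brought into the order
  X, Y, Z of the PBW monomials.\<close>

lemma relations:
  "Y \<otimes>\<^bsub>H\<^esub> X = X \<otimes>\<^bsub>H\<^esub> Y"
  "Z \<otimes>\<^bsub>H\<^esub> X = X \<otimes>\<^bsub>H\<^esub> Z \<oplus>\<^bsub>H\<^esub> (l1 \<odot>\<^bsub>H\<^esub> X \<oplus>\<^bsub>H\<^esub> (- \<alpha>) \<odot>\<^bsub>H\<^esub> Y)"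
  "Z \<otimes>\<^bsub>H\<^esub> Y = Y \<otimes>\<^bsub>H\<^esub> Z \<oplus>\<^bsub>H\<^esub> l2 \<odot>\<^bsub>H\<^esub> Y"
proof -
  note r = rels_subset_I[unfolded HA_rels_def free_monom_def, simplified]
  have "proj (wd [GX, GY]) = proj (wd [GY, GX])" using r by (simp add: proj_eq_iff)
  then show "Y \<otimes>\<^bsub>H\<^esub> X = X \<otimes>\<^bsub>H\<^esub> Y"
    by (simp flip: proj_gen proj_simps(2))
  have "proj (wd [GZ, GX]) = proj (wd [GX, GZ] + (Poly_Mapping.single [GX] l1 - Poly_Mapping.single [GY] \<alpha>))"
    using r by (simp add: proj_eq_iff diff_diff_eq)
  also have "wd [GX, GZ] + (Poly_Mapping.single [GX] l1 - Poly_Mapping.single [GY] \<alpha>)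
     = wd [GX, GZ] + (pm_scale l1 (wd [GX]) + pm_scale (- \<alpha>) (wd [GY]))" by (simp add: single_uminus)
  finally show "Z \<otimes>\<^bsub>H\<^esub> X = X \<otimes>\<^bsub>H\<^esub> Z \<oplus>\<^bsub>H\<^esub> (l1 \<odot>\<^bsub>H\<^esub> X \<oplus>\<^bsub>H\<^esub> (- \<alpha>) \<odot>\<^bsub>H\<^esub> Y)"
    by (simp flip: proj_gen proj_simps del: map_single) 
  have "proj (wd [GZ, GY]) = proj (wd [GY, GZ] + Poly_Mapping.single [GY] l2)"
    using r by (simp add: proj_eq_iff diff_diff_eq)
  also have "wd [GY, GZ] + Poly_Mapping.single [GY] l2 = wd [GY, GZ] + pm_scale l2 (wd [GY])" by simp
  finally show "Z \<otimes>\<^bsub>H\<^esub> Y = Y \<otimes>\<^bsub>H\<^esub> Z \<oplus>\<^bsub>H\<^esub> l2 \<odot>\<^bsub>H\<^esub> Y"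
    by (simp flip: proj_gen proj_simps del: map_single)
qed

text \<open>The preimage of the generated subalgebra under the projection is a subalgebra of the
  free algebra that contains all letters, hence the whole free algebra.\<close>

lemma H_generated: "alg_gen H {X, Y, Z} = carrier H"
proof
  show "alg_gen H {X, Y, Z} \<subseteq> carrier H"
    by (rule H.alg_gen_least[OF H.subalg_carrier]) simp
  have s: "subalg (alg_gen H {X, Y, Z}) H" by (rule H.subalg_alg_gen) simp
  note sD = H.subalgD[OF s]
  have "subalg {p. proj p \<in> alg_gen H {X, Y, Z}} FA"
    by (rule F.subalgI) (simp_all add: proj_simps sD(2-5))
  moreover have "range (\<lambda>g. wd [g]) \<subseteq> {p. proj p \<in> alg_gen H {X, Y, Z}}"
  proof safe
    fix g show "proj (wd [g]) \<in> alg_gen H {X, Y, Z}"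
      using H.alg_gen_superset[of "{X, Y, Z}"] by (cases g) (auto simp: proj_gen)
  qed
  ultimately have "alg_gen FA (range (\<lambda>g. wd [g])) \<subseteq> {p. proj p \<in> alg_gen H {X, Y, Z}}"
    by (rule F.alg_gen_least)
  then show "carrier H \<subseteq> alg_gen H {X, Y, Z}"
    unfolding free_alg_generated carrier_H by blast
qed

text \<open>The kernel of g is an ideal containing the three defining relations, hence the whole
  ideal that they generate. The relations are required in the orientation of
  \<open>relations\<close>.\<close>

lemma HA_hom_exists:
  assumes B: "kalg B" and g: "g \<in> alg_hom FA B"
    and r: "g (wd [GY]) \<otimes>\<^bsub>B\<^esub> g (wd [GX]) = g (wd [GX]) \<otimes>\<^bsub>B\<^esub> g (wd [GY])"
      "g (wd [GZ]) \<otimes>\<^bsub>B\<^esub> g (wd [GX]) = g (wd [GX]) \<otimes>\<^bsub>B\<^esub> g (wd [GZ])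
         \<oplus>\<^bsub>B\<^esub> (l1 \<odot>\<^bsub>B\<^esub> g (wd [GX]) \<oplus>\<^bsub>B\<^esub> (- \<alpha>) \<odot>\<^bsub>B\<^esub> g (wd [GY]))"
      "g (wd [GZ]) \<otimes>\<^bsub>B\<^esub> g (wd [GY]) = g (wd [GY]) \<otimes>\<^bsub>B\<^esub> g (wd [GZ]) \<oplus>\<^bsub>B\<^esub> l2 \<odot>\<^bsub>B\<^esub> g (wd [GY])"
  obtains G where "G \<in> alg_hom H B" "\<And>p. G (proj p) = g p"
proof -
  interpret B: kalg B by fact
  note gD = alg_homD[OF g, simplified]
  have g0: "g 0 = \<zero>\<^bsub>B\<^esub>" using alg_hom_zero[OF F.kalg_axioms B g] by simp
  have gm: "g (p - q) = g p \<ominus>\<^bsub>B\<^esub> g q" for p q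
  proof -
    have "g (p - q) = g (p + pm_scale (-1) q)"
      by (rule arg_cong[of _ _ g], rule poly_mapping_eqI) (simp add: lookup_add lookup_minus)
    then show ?thesis using gD(5)[of "-1" q] gD(1)[of q] gD(3) by (simp add: a_minus_def B.smult_minus_1)
  qed
  let ?K = "{p. g p = \<zero>\<^bsub>B\<^esub>}"
  have "ideal ?K FA"
  proof (rule idealI)
    show "ring FA" by unfold_locales
    have "lin_subspace ?K FA" by (rule F.lin_subspaceI) (simp_all add: gD g0)
    then show "subgroup ?K (add_monoid FA)" by (simp add: lin_subspace_def)
  qed (simp_all add: gD)
  moreover have "HA_rels l1 l2 \<alpha> \<subseteq> ?K"
  proof -
    have *: "g (wd [GX, GY]) = g (wd [GX]) \<otimes>\<^bsub>B\<^esub> g (wd [GY])" "g (wd [GY, GX]) = g (wd [GY]) \<otimes>\<^bsub>B\<^esub> g (wd [GX])"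
      "g (wd [GZ, GX]) = g (wd [GZ]) \<otimes>\<^bsub>B\<^esub> g (wd [GX])" "g (wd [GX, GZ]) = g (wd [GX]) \<otimes>\<^bsub>B\<^esub> g (wd [GZ])"
      "g (wd [GZ, GY]) = g (wd [GZ]) \<otimes>\<^bsub>B\<^esub> g (wd [GY])" "g (wd [GY, GZ]) = g (wd [GY]) \<otimes>\<^bsub>B\<^esub> g (wd [GZ])"
      by (simp_all flip: gD(2))
    have s: "g (Poly_Mapping.single w c) = c \<odot>\<^bsub>B\<^esub> g (wd w)" for w c
      using gD(5)[of c "wd w"] by simp
    have c: "(q \<oplus>\<^bsub>B\<^esub> r) \<ominus>\<^bsub>B\<^esub> q \<ominus>\<^bsub>B\<^esub> r = \<zero>\<^bsub>B\<^esub>" "q \<ominus>\<^bsub>B\<^esub> q = \<zero>\<^bsub>B\<^esub>"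
      if "q \<in> carrier B" "r \<in> carrier B" for q r
      using that by algebra+
    have "g (wd [GX, GY] - wd [GY, GX]) = \<zero>\<^bsub>B\<^esub>"
      unfolding gm * r using c(2) gD(1) by simp
    moreover have "g (wd [GZ, GX] - wd [GX, GZ] - (Poly_Mapping.single [GX] l1 - Poly_Mapping.single [GY] \<alpha>)) = \<zero>\<^bsub>B\<^esub>"
    proof -
      have "g (Poly_Mapping.single [GX] l1) \<ominus>\<^bsub>B\<^esub> g (Poly_Mapping.single [GY] \<alpha>)
          = l1 \<odot>\<^bsub>B\<^esub> g (wd [GX]) \<oplus>\<^bsub>B\<^esub> (- \<alpha>) \<odot>\<^bsub>B\<^esub> g (wd [GY])"
        unfolding s[of "[GX]" l1] s[of "[GY]" \<alpha>] by (simp add: a_minus_def B.smult_minus gD(1))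
      then show ?thesis unfolding gm * r using c(1) gD(1) by simp
    qed
    moreover have "g (wd [GZ, GY] - wd [GY, GZ] - Poly_Mapping.single [GY] l2) = \<zero>\<^bsub>B\<^esub>"
      unfolding gm * r s[of "[GY]" l2] using c(1) gD(1) by simp
    ultimately show ?thesis
      unfolding HA_rels_def free_monom_def by simp
  qed
  ultimately have "I \<subseteq> ?K"
    unfolding HA_ideal_def by (rule F.genideal_minimal)
  then have K: "x \<in> I \<Longrightarrow> g x = \<zero>\<^bsub>B\<^esub>" for x by blast
  show thesis
  proof (rule that)
    show "quot_lift FA I g \<in> alg_hom H B"
      unfolding HA_def by (rule F.quot_lift_hom(1)[OF ideal_I B g K])
    show "quot_lift FA I g (proj p) = g p" for p
      unfolding proj_def by (rule F.quot_lift_hom(2)[OF ideal_I B g K]) simp_all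
  qed
qed

end

text \<open>Horner's scheme: \<open>e\<close> interprets a coefficient and \<open>m\<close> is
  multiplication by the value of the variable. Leaving \<open>m\<close> open allows multiplication
  from the left for x and y and from the right for z.\<close>

definition horner :: "('k, 'a) module \<Rightarrow> ('c::zero \<Rightarrow> 'a) \<Rightarrow> ('a \<Rightarrow> 'a) \<Rightarrow> 'c poly \<Rightarrow> 'a" where
  "horner A e m p = fold_coeffs (\<lambda>a h. e a \<oplus>\<^bsub>A\<^esub> m h) p \<zero>\<^bsub>A\<^esub>"

locale horner_eval = kalg A for A :: "('k::field, 'a) module" (structure) +
  fixes e :: "'c::idom \<Rightarrow> 'a" and m :: "'a \<Rightarrow> 'a"
  assumes e_closed [simp]: "e a \<in> carrier A" and e_add: "e (a + b) = e a \<oplus> e b"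
    and m_closed' [simp]: "h \<in> carrier A \<Longrightarrow> m h \<in> carrier A"
    and m_add: "h \<in> carrier A \<Longrightarrow> h' \<in> carrier A \<Longrightarrow> m (h \<oplus> h') = m h \<oplus> m h'"
    and m_smult: "h \<in> carrier A \<Longrightarrow> m (c \<odot> h) = c \<odot> m h"
begin

lemma e_0 [simp]: "e 0 = \<zero>"
  using e_add[of 0 0] e_closed[of 0] by (metis add.l_cancel_one' add_0)

lemma m_0 [simp]: "m \<zero> = \<zero>"
  using m_smult[of \<zero> 0] by simp

lemma horner_0 [simp]: "horner A e m 0 = \<zero>"
  by (simp add: horner_def)

lemma horner_pCons_raw: "horner A e m (pCons a p) = e a \<oplus> m (horner A e m p)"
  by (cases "a = 0 \<and> p = 0") (auto simp: horner_def)

lemma horner_closed [simp]: "horner A e m p \<in> carrier A"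
  by (induction p) (simp_all add: horner_pCons_raw)

lemma horner_add: "horner A e m (p + q) = horner A e m p \<oplus> horner A e m q"
  by (induction p q rule: poly_induct2) (simp_all add: horner_pCons_raw e_add m_add a_ac)

lemma horner_smult:
  assumes "\<And>a. e (c' * a) = c \<odot> e a"
  shows "horner A e m (smult c' p) = c \<odot> horner A e m p"
  by (induction p) (simp_all add: horner_pCons_raw assms m_smult smult_add_right)

end

section \<open>Evaluation of the polynomial model in H\<close>

context ha
begin

definition evS :: "'k poly \<Rightarrow> _" where "evS = horner H (\<lambda>c. c \<odot>\<^bsub>H\<^esub> \<one>\<^bsub>H\<^esub>) ((\<otimes>\<^bsub>H\<^esub>) Y)"
definition ev :: "'k bipoly \<Rightarrow> _" where "ev = horner H evS ((\<otimes>\<^bsub>H\<^esub>) X)"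
text \<open>X and Y multiply from the left and Z from the right, so a monomial of the model is sent
  to X^j Y^k Z^i.\<close>

definition psi :: "'k pbw \<Rightarrow> _" where "psi = horner H ev (\<lambda>h. h \<otimes>\<^bsub>H\<^esub> Z)"

sublocale S: horner_eval H "\<lambda>c. c \<odot>\<^bsub>H\<^esub> \<one>\<^bsub>H\<^esub>" "(\<otimes>\<^bsub>H\<^esub>) Y"
  by unfold_locales (simp_all add: H.smult_add_left H.r_distr H.smult_mult_right)

sublocale E: horner_eval H evS "(\<otimes>\<^bsub>H\<^esub>) X"
  unfolding evS_def
  by unfold_locales (simp_all add: S.horner_add H.r_distr H.smult_mult_right)

sublocale P: horner_eval H ev "\<lambda>h. h \<otimes>\<^bsub>H\<^esub> Z"
  unfolding ev_def
  by unfold_locales (simp_all add: E.horner_add H.l_distr H.smult_mult_left)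

lemma evS_pCons: "evS (pCons c s) = c \<odot>\<^bsub>H\<^esub> \<one>\<^bsub>H\<^esub> \<oplus>\<^bsub>H\<^esub> Y \<otimes>\<^bsub>H\<^esub> evS s"
  unfolding evS_def by (rule S.horner_pCons_raw)

lemma ev_pCons: "ev (pCons s r) = evS s \<oplus>\<^bsub>H\<^esub> X \<otimes>\<^bsub>H\<^esub> ev r"
  unfolding ev_def by (rule E.horner_pCons_raw)

lemma psi_pCons: "psi (pCons r q) = ev r \<oplus>\<^bsub>H\<^esub> psi q \<otimes>\<^bsub>H\<^esub> Z"
  unfolding psi_def by (rule P.horner_pCons_raw)

lemma psi_closed [simp]: "psi q \<in> carrier H"
  unfolding psi_def by (rule P.horner_closed)

lemma psi_add: "psi (p + q) = psi p \<oplus>\<^bsub>H\<^esub> psi q"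
  unfolding psi_def by (rule P.horner_add)

lemma psi_0 [simp]: "psi 0 = \<zero>\<^bsub>H\<^esub>"
  unfolding psi_def by (rule P.horner_0)

lemma evS_smult: "evS (smult c s) = c \<odot>\<^bsub>H\<^esub> evS s"
  unfolding evS_def by (rule S.horner_smult) (simp add: H.smult_smult)

lemma ev_smult: "ev (smult [:c:] r) = c \<odot>\<^bsub>H\<^esub> ev r"
  unfolding ev_def by (rule E.horner_smult) (simp add: evS_smult)

lemma psi_scale: "psi (pbw_scale c q) = c \<odot>\<^bsub>H\<^esub> psi q"
  unfolding psi_def by (rule P.horner_smult) (simp add: ev_smult)

lemma ev_cst: "ev (cst c) = c \<odot>\<^bsub>H\<^esub> \<one>\<^bsub>H\<^esub>"
  by (simp add: ev_pCons evS_pCons)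

lemma psi_const: "psi [:r:] = ev r"
  by (simp add: psi_pCons)

lemma psi_1: "psi 1 = \<one>\<^bsub>H\<^esub>"
  using ev_cst[of 1] psi_const[of "cst 1"] by (simp add: one_pCons)

lemma ev_xx: "ev (xx * r) = X \<otimes>\<^bsub>H\<^esub> ev r"
  by (simp add: ev_pCons)

lemma ev_yy: "ev (yy * r) = Y \<otimes>\<^bsub>H\<^esub> ev r"
proof (induction r)
  case (pCons s r)
  have "ev (yy * pCons s r) = evS (pCons 0 s) \<oplus>\<^bsub>H\<^esub> X \<otimes>\<^bsub>H\<^esub> ev (yy * r)"
    by (simp flip: ev_pCons)
  also have "\<dots> = Y \<otimes>\<^bsub>H\<^esub> evS s \<oplus>\<^bsub>H\<^esub> (X \<otimes>\<^bsub>H\<^esub> Y) \<otimes>\<^bsub>H\<^esub> ev r"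
    unfolding pCons by (simp add: evS_pCons H.m_assoc)
  also have "\<dots> = Y \<otimes>\<^bsub>H\<^esub> ev (pCons s r)"
    by (simp add: relations(1)[symmetric] ev_pCons H.r_distr H.m_assoc)
  finally show ?case .
qed simp

text \<open>The commutator with Z is a derivation on polynomials in X and Y, and on X and Y it
  agrees with \<open>delta\<close> by the defining relations. This is what turns \<open>Zop\<close>
  into left multiplication by Z.\<close>

lemma ev_Z: "Z \<otimes>\<^bsub>H\<^esub> ev r = ev r \<otimes>\<^bsub>H\<^esub> Z \<oplus>\<^bsub>H\<^esub> ev (delta r)"
proof (induction r rule: bipoly_induct)
  case (const c)
  show ?case unfolding ev_cst delta_cst by (simp add: H.smult_mult_left H.smult_mult_right)
next
  case (add r s)
  then show ?case by (simp add: P.e_add delta_add H.l_distr H.r_distr H.a_ac)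
next
  case (mult_x r)
  have "delta (xx * r) = smult [:l1:] (xx * r) + smult [:- \<alpha>:] (yy * r) + xx * delta r"
  proof -
    have "smult [:l1:] p = cst l1 * p" "smult [:- \<alpha>:] p = - (cst \<alpha> * p)" for p :: "'k bipoly"
      using smult_minus_left[of "[:\<alpha>:]" p] by simp_all
    then show ?thesis
      unfolding delta_mult delta_xx by (simp only: algebra_simps right_minus add_0_right add_0_left)
  qed
  then have d: "ev (delta (xx * r)) = l1 \<odot>\<^bsub>H\<^esub> (X \<otimes>\<^bsub>H\<^esub> ev r) \<oplus>\<^bsub>H\<^esub> (- \<alpha>) \<odot>\<^bsub>H\<^esub> (Y \<otimes>\<^bsub>H\<^esub> ev r) \<oplus>\<^bsub>H\<^esub> X \<otimes>\<^bsub>H\<^esub> ev (delta r)"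
    by (simp only: P.e_add ev_smult ev_xx ev_yy)
  have "Z \<otimes>\<^bsub>H\<^esub> ev (xx * r) = (Z \<otimes>\<^bsub>H\<^esub> X) \<otimes>\<^bsub>H\<^esub> ev r"
    unfolding ev_xx by (simp add: H.m_assoc)
  also have "\<dots> = X \<otimes>\<^bsub>H\<^esub> (Z \<otimes>\<^bsub>H\<^esub> ev r) \<oplus>\<^bsub>H\<^esub> (l1 \<odot>\<^bsub>H\<^esub> (X \<otimes>\<^bsub>H\<^esub> ev r) \<oplus>\<^bsub>H\<^esub> (- \<alpha>) \<odot>\<^bsub>H\<^esub> (Y \<otimes>\<^bsub>H\<^esub> ev r))"
    unfolding relations(2) by (simp add: H.l_distr H.m_assoc H.smult_mult_left)
  also have "\<dots> = ev (xx * r) \<otimes>\<^bsub>H\<^esub> Z \<oplus>\<^bsub>H\<^esub> ev (delta (xx * r))"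
    unfolding d unfolding mult_x ev_xx by (simp add: H.r_distr H.m_assoc H.a_ac)
  finally show ?case .
next
  case (mult_y r)
  have "delta (yy * r) = smult [:l2:] (yy * r) + yy * delta r"
  proof -
    have "smult [:l2:] p = cst l2 * p" for p :: "'k bipoly" by simp
    then show ?thesis
      unfolding delta_mult delta_yy by (simp only: algebra_simps)
  qed
  then have d: "ev (delta (yy * r)) = l2 \<odot>\<^bsub>H\<^esub> (Y \<otimes>\<^bsub>H\<^esub> ev r) \<oplus>\<^bsub>H\<^esub> Y \<otimes>\<^bsub>H\<^esub> ev (delta r)"
    by (simp only: P.e_add ev_smult ev_xx ev_yy)
  have "Z \<otimes>\<^bsub>H\<^esub> ev (yy * r) = (Z \<otimes>\<^bsub>H\<^esub> Y) \<otimes>\<^bsub>H\<^esub> ev r"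
    unfolding ev_yy by (simp add: H.m_assoc)
  also have "\<dots> = Y \<otimes>\<^bsub>H\<^esub> (Z \<otimes>\<^bsub>H\<^esub> ev r) \<oplus>\<^bsub>H\<^esub> l2 \<odot>\<^bsub>H\<^esub> (Y \<otimes>\<^bsub>H\<^esub> ev r)"
    unfolding relations(3) by (simp add: H.l_distr H.m_assoc H.smult_mult_left)
  also have "\<dots> = ev (yy * r) \<otimes>\<^bsub>H\<^esub> Z \<oplus>\<^bsub>H\<^esub> ev (delta (yy * r))"
    unfolding d unfolding mult_y ev_yy by (simp add: H.r_distr H.m_assoc H.a_ac)
  finally show ?case .
qed

lemma psi_xx: "psi (smult xx q) = X \<otimes>\<^bsub>H\<^esub> psi q"
proof (induction q)
  case (pCons r q)
  have "psi (smult xx (pCons r q)) = ev (xx * r) \<oplus>\<^bsub>H\<^esub> psi (smult xx q) \<otimes>\<^bsub>H\<^esub> Z"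
    by (simp only: smult_pCons psi_pCons)
  then show ?case unfolding pCons ev_xx by (simp add: psi_pCons H.r_distr H.m_assoc)
qed simp

lemma psi_yy: "psi (smult yy q) = Y \<otimes>\<^bsub>H\<^esub> psi q"
proof (induction q)
  case (pCons r q)
  have "psi (smult yy (pCons r q)) = ev (yy * r) \<oplus>\<^bsub>H\<^esub> psi (smult yy q) \<otimes>\<^bsub>H\<^esub> Z"
    by (simp only: smult_pCons psi_pCons)
  then show ?case unfolding pCons ev_yy by (simp add: psi_pCons H.r_distr H.m_assoc)
qed simp

lemma psi_Zop: "psi (Zop q) = Z \<otimes>\<^bsub>H\<^esub> psi q"
proof (induction q)
  case 0
  then show ?case by (simp add: Zop_def)
next
  case (pCons r q)
  have "Zop (pCons r q) = pCons (delta r) ([:r:] + Zop q)"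
    by (rule poly_eqI) (simp add: coeff_Zop coeff_pCons split: nat.split)
  then have "psi (Zop (pCons r q)) = ev (delta r) \<oplus>\<^bsub>H\<^esub> (ev r \<oplus>\<^bsub>H\<^esub> Z \<otimes>\<^bsub>H\<^esub> psi q) \<otimes>\<^bsub>H\<^esub> Z"
    by (simp add: psi_pCons psi_add psi_const pCons)
  also have "\<dots> = (ev r \<otimes>\<^bsub>H\<^esub> Z \<oplus>\<^bsub>H\<^esub> ev (delta r)) \<oplus>\<^bsub>H\<^esub> Z \<otimes>\<^bsub>H\<^esub> (psi q \<otimes>\<^bsub>H\<^esub> Z)"
    by (simp add: H.l_distr H.m_assoc H.a_ac)
  also have "\<dots> = Z \<otimes>\<^bsub>H\<^esub> psi (pCons r q)"
    unfolding ev_Z[symmetric] psi_pCons by (simp add: H.r_distr)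
  finally show ?case .
qed

section \<open>The action on the polynomial model and the PBW isomorphism\<close>

primrec gen_op :: "gen \<Rightarrow> 'k pbw \<Rightarrow> 'k pbw" where
  "gen_op GX = smult xx" | "gen_op GY = smult yy" | "gen_op GZ = Zop"

text \<open>A word acts as the composite of the operators of its letters. This prescribes the left
  regular representation before the monomials are known to be a basis of H.\<close>

definition act :: "(gen list \<Rightarrow>\<^sub>0 'k) \<Rightarrow> 'k pbw \<Rightarrow> 'k pbw" where
  "act p q = lin_ext pbw_scale (\<lambda>w. foldr gen_op w q) p"

sublocale VS: vector_space "pbw_scale :: 'k \<Rightarrow> _"
  by (rule vector_space_pbw_scale)

lemma gen_op_add: "gen_op g (p + q) = gen_op g p + gen_op g q"
  by (cases g) (simp_all add: Zop_add smult_add_right)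

lemma gen_op_scale: "gen_op g (pbw_scale c q) = pbw_scale c (gen_op g q)"
  by (cases g) (simp_all add: Zop_smult mult.commute del: mult_pCons_left mult_pCons_right)

lemma foldr_gen_op: "foldr gen_op w (p + q) = foldr gen_op w p + foldr gen_op w q"
  "foldr gen_op w (pbw_scale c q) = pbw_scale c (foldr gen_op w q)"
  by (induction w) (simp_all add: gen_op_add gen_op_scale)

lemma act_add_left: "act (p + p') q = act p q + act p' q" and act_diff_left: "act (p - p') q = act p q - act p' q"
  and act_scale_left: "act (pm_scale c p) q = pbw_scale c (act p q)"
  and act_single: "act (Poly_Mapping.single w c) q = pbw_scale c (foldr gen_op w q)"
  unfolding act_def by (rule VS.lin_ext_add VS.lin_ext_diff VS.lin_ext_scale VS.lin_ext_single)+

lemma act_mult: "act (p \<otimes>\<^bsub>FA\<^esub> p') q = act p (act p' q)"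
proof -
  have "act (p \<otimes>\<^bsub>FA\<^esub> p') q = lin_ext pbw_scale (\<lambda>x. lin_ext pbw_scale (\<lambda>y. foldr gen_op x (foldr gen_op y q)) p') p"
    by (simp add: act_def free_alg_def monoid_alg_mult[where M = word_monoid] VS.lin_ext_comp)
  also have "\<dots> = act p (act p' q)"
    unfolding act_def by (intro lin_ext_cong lin_ext_linear_comp[symmetric] vector_space_pbw_scale foldr_gen_op)
  finally show ?thesis .
qed

text \<open>The elements acting as zero on every q form a two-sided ideal, and the operators of the
  generators satisfy the defining relations. So the action descends to H; this is the substance of
  the PBW theorem.\<close>

lemma act_I:
  assumes "p \<in> I" shows "act p q = 0"
proof -
  let ?K = "{p. \<forall>q. act p q = 0}"
  have act0: "act p 0 = 0" for p
    by (simp add: act_def lin_ext_def) (metis (no_types, lifting) foldr_gen_op(2) smult_0_right mult_zero_left smult_0_left pCons_0_0 sum.neutral VS.scale_zero_left VS.scale_zero_right)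
  have "ideal ?K FA"
  proof (rule idealI)
    show "ring FA" by unfold_locales
    have "lin_subspace ?K FA"
      by (rule F.lin_subspaceI) (simp_all add: act_add_left act_scale_left, simp add: act_def)
    then show "subgroup ?K (add_monoid FA)" by (simp add: lin_subspace_def)
  qed (simp_all add: act_mult act0)
  moreover have "HA_rels l1 l2 \<alpha> \<subseteq> ?K"
  proof -
    have "smult xx (smult yy q) = smult yy (smult xx q)" for q :: "'k pbw" by simp
    moreover have "Zop (smult xx q) = smult xx (Zop q) + (pbw_scale l1 (smult xx q) - pbw_scale \<alpha> (smult yy q))" for q
      by (simp add: Zop_smult delta_xx smult_diff_left del: mult_pCons_left mult_pCons_right)
    moreover have "Zop (smult yy q) = smult yy (Zop q) + pbw_scale l2 (smult yy q)" for q
      by (simp add: Zop_smult delta_yy del: mult_pCons_left mult_pCons_right)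
    ultimately show ?thesis
      unfolding HA_rels_def free_monom_def
      by (auto simp: act_diff_left act_single simp flip: one_pCons simp del: smult_smult)
  qed
  ultimately have "I \<subseteq> ?K"
    unfolding HA_ideal_def by (rule F.genideal_minimal)
  then show ?thesis using assms by blast
qed

text \<open>An element h is recovered as a polynomial by letting it act on 1; the choice of a
  preimage in the free algebra is harmless by \<open>act_I\<close>.\<close>

definition phi where "phi = quot_lift FA I (\<lambda>p. act p 1)"

lemma phi_proj: "phi (proj p) = act p 1"
  unfolding phi_def proj_def
proof (rule F.quot_lift_proj)
  fix y assume "I +>\<^bsub>FA\<^esub> p = I +>\<^bsub>FA\<^esub> y"
  then have "act (p - y) 1 = 0" using proj_eq_iff act_I by (metis proj_def)
  then show "act p 1 = act y 1" by (simp add: act_diff_left)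
qed simp

lemma phi_add: "h \<in> carrier H \<Longrightarrow> h' \<in> carrier H \<Longrightarrow> phi (h \<oplus>\<^bsub>H\<^esub> h') = phi h + phi h'"
  by (auto simp: carrier_H phi_proj act_add_left simp flip: proj_simps(3))

lemma phi_scale: "h \<in> carrier H \<Longrightarrow> phi (c \<odot>\<^bsub>H\<^esub> h) = pbw_scale c (phi h)"
  by (auto simp: carrier_H phi_proj act_scale_left simp flip: proj_simps(5))

lemma phi_1: "phi \<one>\<^bsub>H\<^esub> = 1"
  by (simp add: phi_proj act_single flip: proj_simps(4) one_pCons)

lemma phi_gen_mult:
  assumes "h \<in> carrier H"
  shows "phi (X \<otimes>\<^bsub>H\<^esub> h) = smult xx (phi h)" "phi (Y \<otimes>\<^bsub>H\<^esub> h) = smult yy (phi h)" "phi (Z \<otimes>\<^bsub>H\<^esub> h) = Zop (phi h)"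
proof -
  obtain p where h: "h = proj p" using assms carrier_H by auto
  show "phi (X \<otimes>\<^bsub>H\<^esub> h) = smult xx (phi h)" "phi (Y \<otimes>\<^bsub>H\<^esub> h) = smult yy (phi h)" "phi (Z \<otimes>\<^bsub>H\<^esub> h) = Zop (phi h)"
    unfolding h proj_gen[symmetric] proj_simps(2)[symmetric] phi_proj act_mult act_single
    by (simp_all flip: one_pCons)
qed

text \<open>Checked letter by letter: \<open>psi\<close> turns the operator of a generator into left
  multiplication by that generator. At q = 1 this yields \<open>psi_phi\<close>, that is, the PBW
  monomials span H.\<close>

lemma psi_act: "psi (act p q) = proj p \<otimes>\<^bsub>H\<^esub> psi q"
proof -
  have "p \<in> carrier (monoid_alg word_monoid)" by simp
  with monoid_words show ?thesis
  proof (induction rule: monoid_alg_induct)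
    case zero
    have "proj 0 = \<zero>\<^bsub>H\<^esub>" using alg_hom_zero[OF F.kalg_axioms H.kalg_axioms proj_hom] by simp
    then show ?case by (simp add: act_def)
  next
    case (add p p')
    then show ?case by (simp add: act_add_left psi_add proj_simps H.l_distr)
  next
    case (smult c p)
    then show ?case by (simp add: act_scale_left psi_scale proj_simps H.smult_mult_left)
  next
    case (base w)
    have "psi (foldr gen_op w q) = proj (wd w) \<otimes>\<^bsub>H\<^esub> psi q"
    proof (induction w)
      case Nil
      then show ?case using proj_simps(4) by simp
    next
      case (Cons g w)
      have "wd (g # w) = wd [g] \<otimes>\<^bsub>FA\<^esub> wd w" by simp
      then have *: "proj (wd (g # w)) = proj (wd [g]) \<otimes>\<^bsub>H\<^esub> proj (wd w)" by (simp only: proj_simps(2))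
      have "psi (gen_op g (foldr gen_op w q)) = proj (wd [g]) \<otimes>\<^bsub>H\<^esub> psi (foldr gen_op w q)"
        by (cases g) (simp_all add: psi_xx psi_yy psi_Zop proj_gen)
      then show ?case by (simp add: * Cons H.m_assoc proj_simps)
    qed
    then show ?case by (simp add: act_single flip: one_pCons)
  qed
qed

lemma psi_phi: "h \<in> carrier H \<Longrightarrow> psi (phi h) = h"
  by (auto simp: carrier_H phi_proj psi_act psi_1 proj_simps(1)[unfolded carrier_H])

text \<open>The independence half of PBW. Both \<open>phi\<close> and \<open>psi\<close> exchange
  the operators of the model with left multiplications in H and respect constants, and these data
  generate the model.\<close>

lemma phi_psi [simp]: "phi (psi q) = q"
proof (induction q rule: pbw_Zop_induct)
  case (const c)
  have "psi [:cst c:] = c \<odot>\<^bsub>H\<^esub> \<one>\<^bsub>H\<^esub>" by (simp only: psi_const ev_cst)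
  then show ?case by (simp add: phi_scale phi_1)
qed (simp_all add: psi_add phi_add psi_xx psi_yy psi_Zop phi_gen_mult)

end

lemma (in kalg_pair) tensor_induct [consumes 1, case_names add smult pt]:
  assumes "t \<in> carrier T"
    and add: "\<And>x y. x \<in> carrier T \<Longrightarrow> y \<in> carrier T \<Longrightarrow> P x \<Longrightarrow> P y \<Longrightarrow> P (x \<oplus>\<^bsub>T\<^esub> y)"
    and smult: "\<And>c x. x \<in> carrier T \<Longrightarrow> P x \<Longrightarrow> P (c \<odot>\<^bsub>T\<^esub> x)"
    and pt: "\<And>a b. a \<in> carrier A \<Longrightarrow> b \<in> carrier B \<Longrightarrow> P (pt a b)"
  shows "P t"
proof -
  have c: "N +>\<^bsub>M\<^esub> m \<in> carrier T" if "m \<in> carrier M" for m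
    unfolding T_simps(1) using that by (rule imageI)
  from assms(1)[unfolded T_simps(1)] obtain m where m: "t = N +>\<^bsub>M\<^esub> m" "m \<in> carrier M"
    by (rule imageE)
  from monoid_prod m(2) have "P (N +>\<^bsub>M\<^esub> m)"
  proof (induction rule: monoid_alg_induct)
    case zero
    \<comment> \<open>The zero coset is 0 times a pure tensor, so the induction rule has no separate
      case for zero.\<close>
    have "P (0 \<odot>\<^bsub>T\<^esub> pt \<zero>\<^bsub>A\<^esub> \<zero>\<^bsub>B\<^esub>)" by (intro smult pt pt_closed) simp_all
    moreover have "0 \<odot>\<^bsub>T\<^esub> pt \<zero>\<^bsub>A\<^esub> \<zero>\<^bsub>B\<^esub> = N +>\<^bsub>M\<^esub> 0"
      unfolding pure_tensor_def T_simps(6)[OF single_in_M[OF A.zero_closed B.zero_closed]] by simp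
    ultimately show ?case by simp
  next
    case (add p q)
    then show ?case using assms(2)[OF c c, of p q] T_simps(2)[of p q] by simp
  next
    case (smult k p)
    then show ?case using assms(3)[OF c, of p k] T_simps(6)[of p k] by simp
  next
    case (base z)
    then show ?case using pt[of "fst z" "snd z"] by (cases z) (simp add: pure_tensor_def)
  qed
  then show ?thesis unfolding m(1) .
qed

section \<open>The comultiplication\<close>

context ha
begin

sublocale HH: kalg_pair H H
  by unfold_locales

abbreviation "TT \<equiv> tensor_alg H H"
abbreviation "pt \<equiv> pure_tensor H H"
abbreviation "\<Delta> \<equiv> HA_comult l1 l2 \<alpha>"
abbreviation "e \<equiv> \<one>\<^bsub>H\<^esub>"

definition "DX = pt X e \<oplus>\<^bsub>TT\<^esub> pt e X"
definition "DY = pt Y e \<oplus>\<^bsub>TT\<^esub> pt e Y"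
text \<open>The minus sign is written as scaling by -1, so that products expand by the laws for sums
  and scalars alone.\<close>

definition "DZ = pt Z e \<oplus>\<^bsub>TT\<^esub> pt e Z \<oplus>\<^bsub>TT\<^esub> pt X Y \<oplus>\<^bsub>TT\<^esub> (- 1) \<odot>\<^bsub>TT\<^esub> pt Y X"

lemma D_closed [simp]: "DX \<in> carrier TT" "DY \<in> carrier TT" "DZ \<in> carrier TT"
  by (simp_all add: DX_def DY_def DZ_def)

lemmas tensor_expand = HH.T.l_distr HH.T.r_distr HH.pt_mult HH.T.smult_mult_left HH.T.smult_mult_right
  HH.T.smult_add_right HH.T.smult_smult

text \<open>The cross terms X \<otimes> Y - Y \<otimes> X commute with \<open>DX\<close> and
  \<open>DY\<close>, because X and Y commute. Only the primitive parts contribute to the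
  commutators, and these reproduce the relations of H.\<close>

lemma D_relations:
  "DY \<otimes>\<^bsub>TT\<^esub> DX = DX \<otimes>\<^bsub>TT\<^esub> DY"
  "DZ \<otimes>\<^bsub>TT\<^esub> DX = DX \<otimes>\<^bsub>TT\<^esub> DZ \<oplus>\<^bsub>TT\<^esub> (l1 \<odot>\<^bsub>TT\<^esub> DX \<oplus>\<^bsub>TT\<^esub> (- \<alpha>) \<odot>\<^bsub>TT\<^esub> DY)"
  "DZ \<otimes>\<^bsub>TT\<^esub> DY = DY \<otimes>\<^bsub>TT\<^esub> DZ \<oplus>\<^bsub>TT\<^esub> l2 \<odot>\<^bsub>TT\<^esub> DY"
  unfolding DX_def DY_def DZ_def
  by (simp_all add: tensor_expand relations HH.pt_add_left HH.pt_add_right HH.pt_smult HH.T.a_ac)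

text \<open>Representatives of \<open>DX\<close>, \<open>DY\<close>, \<open>DZ\<close> in the monoid
  algebra of pairs define a homomorphism from the free algebra. After projection to the tensor
  algebra it respects the relations and factors through H.\<close>

lemma comult_exists: "\<exists>D \<in> alg_hom H TT. D X = DX \<and> D Y = DY \<and> D Z = DZ"
proof -
  have "\<exists>m \<in> carrier HH.M. HH.N +>\<^bsub>HH.M\<^esub> m = t" if "t \<in> carrier TT" for t
  proof -
    from that[unfolded HH.T_simps(1)] obtain m where m: "t = HH.N +>\<^bsub>HH.M\<^esub> m" "m \<in> carrier HH.M"
      by (rule imageE)
    show ?thesis by (rule bexI[of _ m], rule m(1)[symmetric], rule m(2))
  qed
  then obtain r where r: "\<And>t. t \<in> carrier TT \<Longrightarrow> r t \<in> carrier HH.M \<and> HH.N +>\<^bsub>HH.M\<^esub> r t = t" by metis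
  note rc = r[THEN conjunct1] and rp = r[THEN conjunct2]
  define f where "f g = (case g of GX \<Rightarrow> r DX | GY \<Rightarrow> r DY | GZ \<Rightarrow> r DZ)" for g
  have fc: "f g \<in> carrier HH.M" for g
    unfolding f_def by (cases g; simp only: gen.case) (rule rc, rule D_closed)+
  show ?thesis
  proof (rule bexE[OF free_alg_hom_monoid_alg[OF HH.monoid_prod fc]])
    fix F assume F: "F \<in> alg_hom free_alg HH.M" "\<forall>g. F (wd [g]) = f g"
    define G where "G = (+>\<^bsub>HH.M\<^esub>) HH.N \<circ> F"
    have G: "G \<in> alg_hom FA TT"
      unfolding G_def tensor_alg_def by (rule alg_hom_comp[OF F(1) HH.M.quot_proj_hom[OF HH.ideal_N]])
    have g: "G (wd [GX]) = DX" "G (wd [GY]) = DY" "G (wd [GZ]) = DZ"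
      unfolding G_def comp_apply F(2)[rule_format] f_def gen.case by (rule rp, rule D_closed)+
    show ?thesis
    proof (rule HA_hom_exists[OF HH.T.kalg_axioms G, unfolded g, OF D_relations])
      fix D assume D: "D \<in> alg_hom H TT" "\<And>p. D (proj p) = G p"
      have "D X = DX" "D Y = DY" "D Z = DZ"
        unfolding proj_gen[symmetric] D(2) g by (rule refl)+
      then show ?thesis by (intro bexI[OF _ D(1)] conjI)
    qed
  qed
qed

lemma comult: "\<Delta> \<in> alg_hom H TT" "\<Delta> X = DX" "\<Delta> Y = DY" "\<Delta> Z = DZ"
proof -
  obtain D where D: "D \<in> alg_hom H TT" "D X = DX" "D Y = DY" "D Z = DZ" using comult_exists by blast
  \<comment> \<open>The definite description behind \<open>HA_comult\<close> asks for an extensional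
    function, so the homomorphism is cut off outside the carrier.\<close>
  let ?D = "restrict D (carrier H)"
  have D': "?D \<in> alg_hom H TT" "?D X = DX" "?D Y = DY" "?D Z = DZ"
    using D by (auto simp: alg_hom_def ring_hom_def)
  have *: "\<Delta> = (THE \<Delta>'. \<Delta>' \<in> extensional (carrier H) \<and> \<Delta>' \<in> alg_hom H TT \<and> \<Delta>' X = DX \<and> \<Delta>' Y = DY \<and> \<Delta>' Z = DZ)"
    unfolding HA_comult_def Let_def X_def[symmetric] Y_def[symmetric] Z_def[symmetric] DX_def DY_def DZ_def
      HH.T.smult_minus_1[OF HH.pt_closed[OF gen_closed(2,1)]] a_minus_def ..
  have "\<Delta> = ?D"
    unfolding *
  proof (rule the_equality)
    fix D2 assume D2: "D2 \<in> extensional (carrier H) \<and> D2 \<in> alg_hom H TT \<and> D2 X = DX \<and> D2 Y = DY \<and> D2 Z = DZ"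
    show "D2 = ?D"
    proof (rule extensionalityI)
      fix h assume "h \<in> carrier H"
      then have h: "h \<in> alg_gen H {X, Y, Z}" by (simp add: H_generated)
      have u: "D2 u = ?D u" if "u \<in> {X, Y, Z}" for u
      proof -
        from that consider "u = X" | "u = Y" | "u = Z" by blast
        then show ?thesis by cases (simp_all only: D2 D')
      qed
      have "D2 \<in> alg_hom H TT" using D2 by (elim conjE)
      then show "D2 h = ?D h"
        by (rule alg_hom_eq_on_alg_gen[OF H.kalg_axioms _ D'(1) _ u h]) simp_all
    next
      show "D2 \<in> extensional (carrier H)" using D2 by (elim conjE)
      show "?D \<in> extensional (carrier H)" by (rule restrict_extensional)
    qed
  next
    show "?D \<in> extensional (carrier H) \<and> ?D \<in> alg_hom H TT \<and> ?D X = DX \<and> ?D Y = DY \<and> ?D Z = DZ"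
      by (intro conjI restrict_extensional D')
  qed
  then show "\<Delta> \<in> alg_hom H TT" "\<Delta> X = DX" "\<Delta> Y = DY" "\<Delta> Z = DZ"
    by (simp_all only: D')
qed

lemmas comult_simps = alg_homD[OF comult(1)]

subsection \<open>Slices of the comultiplication\<close>

definition functional :: "('k pbw \<Rightarrow> 'k) \<Rightarrow> bool" where
  "functional f \<longleftrightarrow> (\<forall>p q. f (p + q) = f p + f q) \<and> (\<forall>c q. f (pbw_scale c q) = c * f q)"

text \<open>This is id \<otimes> f, read through \<open>phi\<close>. The functional consumes the
  right factor, so the slice of a tensor in S \<otimes> H lands in the image of S.\<close>

definition slice :: "('k pbw \<Rightarrow> 'k) \<Rightarrow> _ \<Rightarrow> 'k pbw" where
  "slice f = (SOME G. (\<forall>a\<in>carrier H. \<forall>b\<in>carrier H. G (pt a b) = pbw_scale (f (phi b)) (phi a)) \<and>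
     (\<forall>x\<in>carrier TT. \<forall>y\<in>carrier TT. G (x \<oplus>\<^bsub>TT\<^esub> y) = G x + G y) \<and>
     (\<forall>c. \<forall>x\<in>carrier TT. G (c \<odot>\<^bsub>TT\<^esub> x) = pbw_scale c (G x)))"

lemma slice:
  assumes "functional f"
  shows "a \<in> carrier H \<Longrightarrow> b \<in> carrier H \<Longrightarrow> slice f (pt a b) = pbw_scale (f (phi b)) (phi a)"
    "x \<in> carrier TT \<Longrightarrow> y \<in> carrier TT \<Longrightarrow> slice f (x \<oplus>\<^bsub>TT\<^esub> y) = slice f x + slice f y"
    "x \<in> carrier TT \<Longrightarrow> slice f (c \<odot>\<^bsub>TT\<^esub> x) = pbw_scale c (slice f x)"
proof -
  let ?P = "\<lambda>G. (\<forall>a\<in>carrier H. \<forall>b\<in>carrier H. G (pt a b) = pbw_scale (f (phi b)) (phi a)) \<and>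
     (\<forall>x\<in>carrier TT. \<forall>y\<in>carrier TT. G (x \<oplus>\<^bsub>TT\<^esub> y) = G x + G y) \<and>
     (\<forall>c. \<forall>x\<in>carrier TT. G (c \<odot>\<^bsub>TT\<^esub> x) = pbw_scale c (G x))"
  have "\<exists>G. ?P G"
  proof (rule HH.tensor_lift_exists[OF vector_space_pbw_scale, of "\<lambda>a b. pbw_scale (f (phi b)) (phi a)"])
    fix G :: "_ \<Rightarrow> 'k pbw"
    assume 1: "\<And>a b. a \<in> carrier H \<Longrightarrow> b \<in> carrier H \<Longrightarrow> G (pt a b) = pbw_scale (f (phi b)) (phi a)"
      and 2: "\<And>x y. x \<in> carrier TT \<Longrightarrow> y \<in> carrier TT \<Longrightarrow> G (x \<oplus>\<^bsub>TT\<^esub> y) = G x + G y"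
      and 3: "\<And>c x. x \<in> carrier TT \<Longrightarrow> G (c \<odot>\<^bsub>TT\<^esub> x) = pbw_scale c (G x)"
    have "?P G" using 1 2 3 by simp
    then show ?thesis by (rule exI[of ?P G])
  qed (use assms in \<open>simp_all add: functional_def phi_add phi_scale VS.scale_left_distrib VS.scale_right_distrib mult.commute\<close>)
  then have "?P (slice f)" unfolding slice_def by (rule someI_ex)
  then show "a \<in> carrier H \<Longrightarrow> b \<in> carrier H \<Longrightarrow> slice f (pt a b) = pbw_scale (f (phi b)) (phi a)"
    "x \<in> carrier TT \<Longrightarrow> y \<in> carrier TT \<Longrightarrow> slice f (x \<oplus>\<^bsub>TT\<^esub> y) = slice f x + slice f y"
    "x \<in> carrier TT \<Longrightarrow> slice f (c \<odot>\<^bsub>TT\<^esub> x) = pbw_scale c (slice f x)" by simp_all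
qed

lemma functional_gen_op: "functional f \<Longrightarrow> functional (\<lambda>q. f (gen_op g q))"
  by (simp add: functional_def gen_op_add gen_op_scale)

text \<open>In multiplication by a' \<otimes> b' the left factor passes outside the slice as
  \<open>v\<close>, while the right factor is absorbed into the functional as precomposition with
  \<open>u\<close>.\<close>

lemma slice_pt_mult:
  assumes f: "functional f" "functional (\<lambda>q. f (u q))" and t: "t \<in> carrier TT"
    and c: "a' \<in> carrier H" "b' \<in> carrier H"
    and v: "\<And>p q. v (p + q) = v p + v q" "\<And>c q. v (pbw_scale c q) = pbw_scale c (v q)"
    and a': "\<And>a. a \<in> carrier H \<Longrightarrow> phi (a' \<otimes>\<^bsub>H\<^esub> a) = v (phi a)"
    and b': "\<And>b. b \<in> carrier H \<Longrightarrow> phi (b' \<otimes>\<^bsub>H\<^esub> b) = u (phi b)"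
  shows "slice f (pt a' b' \<otimes>\<^bsub>TT\<^esub> t) = v (slice (\<lambda>q. f (u q)) t)"
  using t
proof (induction rule: HH.tensor_induct)
  case (add x y)
  then show ?case using c by (simp add: HH.T.r_distr slice[OF f(1)] slice[OF f(2)] v)
next
  case (smult c x)
  then show ?case using c by (simp add: HH.T.smult_mult_right slice[OF f(1)] slice[OF f(2)] v)
next
  case (pt a b)
  then show ?case using c by (simp add: HH.pt_mult slice[OF f(1)] slice[OF f(2)] a' b' v)
qed

lemma slice_lin:
  assumes f: "functional f" "functional g" and t: "t \<in> carrier TT"
  shows "slice (\<lambda>q. c * f q + d * g q) t = pbw_scale c (slice f t) + pbw_scale d (slice g t)"
proof -
  have fg: "functional (\<lambda>q. c * f q + d * g q)"
    using f by (simp add: functional_def algebra_simps)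
  show ?thesis using t
  proof (induction rule: HH.tensor_induct)
    case (add x y)
    then show ?case by (simp add: slice[OF f(1)] slice[OF f(2)] slice[OF fg] smult_add_right)
  next
    case (smult c x)
    then show ?case by (simp add: slice[OF f(1)] slice[OF f(2)] slice[OF fg] smult_add_right mult.commute)
  next
    case (pt a b)
    then show ?case by (simp add: slice[OF f(1)] slice[OF f(2)] slice[OF fg] VS.scale_left_distrib)
  qed
qed

text \<open>The action of the functional f on H by convolution, (id \<otimes> f) \<circ> \<Delta>,
  transported to the model.\<close>

definition D :: "('k pbw \<Rightarrow> 'k) \<Rightarrow> 'k pbw \<Rightarrow> 'k pbw" where
  "D f q = slice f (\<Delta> (psi q))"

lemma D_lin: "functional f \<Longrightarrow> functional g \<Longrightarrow> D (\<lambda>q. c * f q + d * g q) q = pbw_scale c (D f q) + pbw_scale d (D g q)"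
  unfolding D_def by (rule slice_lin) (simp_all add: comult_simps(1))

lemma D_add: "functional f \<Longrightarrow> D f (p + q) = D f p + D f q"
  by (simp add: D_def psi_add comult_simps slice)

lemma D_scale: "functional f \<Longrightarrow> D f (pbw_scale c q) = pbw_scale c (D f q)"
  by (simp add: D_def psi_scale comult_simps slice)

lemma D_1: "functional f \<Longrightarrow> D f 1 = pbw_scale (f 1) 1"
  by (simp add: D_def psi_1 comult_simps HH.pt_one slice phi_1)

text \<open>Multiplicativity of \<Delta>, sliced summand by summand: g \<otimes> 1 acts on the
  result and 1 \<otimes> g on the functional. The last two terms of \<open>D_Zop\<close> come from X
  \<otimes> Y - Y \<otimes> X, where both happen at once.\<close>

lemma D_xx: "functional f \<Longrightarrow> D f (smult xx q) = smult xx (D f q) + D (\<lambda>q. f (smult xx q)) q"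
  and D_yy: "functional f \<Longrightarrow> D f (smult yy q) = smult yy (D f q) + D (\<lambda>q. f (smult yy q)) q"
  and D_Zop: "functional f \<Longrightarrow> D f (Zop q) = Zop (D f q) + D (\<lambda>q. f (Zop q)) q
      + smult xx (D (\<lambda>q. f (smult yy q)) q) - smult yy (D (\<lambda>q. f (smult xx q)) q)"
proof -
  assume f: "functional f"
  have g: "functional (\<lambda>q. f (smult xx q))" "functional (\<lambda>q. f (smult yy q))" "functional (\<lambda>q. f (Zop q))"
    using functional_gen_op[OF f, of GX] functional_gen_op[OF f, of GY] functional_gen_op[OF f, of GZ] by simp_all
  define t where "t = \<Delta> (psi q)"
  have t: "t \<in> carrier TT" by (simp add: t_def comult_simps)
  have f': "functional (\<lambda>q. f (id q))" using f by simp
  note sl = slice_pt_mult[OF f _ t, where v = "smult xx", OF _ gen_closed(1)]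
    slice_pt_mult[OF f _ t, where v = "smult yy", OF _ gen_closed(2)]
    slice_pt_mult[OF f _ t, where v = Zop, OF _ gen_closed(3)]
    slice_pt_mult[OF f _ t, where v = id, OF _ H.one_closed]
  have s: "slice f (pt X e \<otimes>\<^bsub>TT\<^esub> t) = smult xx (slice f t)" "slice f (pt e X \<otimes>\<^bsub>TT\<^esub> t) = slice (\<lambda>q. f (smult xx q)) t"
    "slice f (pt Y e \<otimes>\<^bsub>TT\<^esub> t) = smult yy (slice f t)" "slice f (pt e Y \<otimes>\<^bsub>TT\<^esub> t) = slice (\<lambda>q. f (smult yy q)) t"
    "slice f (pt Z e \<otimes>\<^bsub>TT\<^esub> t) = Zop (slice f t)" "slice f (pt e Z \<otimes>\<^bsub>TT\<^esub> t) = slice (\<lambda>q. f (Zop q)) t"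
    "slice f (pt X Y \<otimes>\<^bsub>TT\<^esub> t) = smult xx (slice (\<lambda>q. f (smult yy q)) t)"
    "slice f (pt Y X \<otimes>\<^bsub>TT\<^esub> t) = smult yy (slice (\<lambda>q. f (smult xx q)) t)"
    using sl(1)[where u = id, OF f'] sl(4)[where u = "smult xx", OF g(1)]
      sl(2)[where u = id, OF f'] sl(4)[where u = "smult yy", OF g(2)]
      sl(3)[where u = id, OF f'] sl(4)[where u = Zop, OF g(3)]
      sl(1)[where u = "smult yy", OF g(2)] sl(2)[where u = "smult xx", OF g(1)]
    by (simp_all add: phi_gen_mult smult_add_right Zop_add gen_op_scale[of GZ, simplified] mult.commute)
  show "D f (smult xx q) = smult xx (D f q) + D (\<lambda>q. f (smult xx q)) q"
    using t unfolding D_def psi_xx comult_simps(2)[OF gen_closed(1) psi_closed] comult(2) DX_def t_def[symmetric]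
    by (simp add: HH.T.l_distr slice[OF f] s)
  show "D f (smult yy q) = smult yy (D f q) + D (\<lambda>q. f (smult yy q)) q"
    using t unfolding D_def psi_yy comult_simps(2)[OF gen_closed(2) psi_closed] comult(3) DY_def t_def[symmetric]
    by (simp add: HH.T.l_distr slice[OF f] s)
  have "pbw_scale (- 1) p = - p" "smult [:[:0, - 1:]:] p = - smult yy p" for p :: "'k pbw"
    using smult_minus_left[of 1 p] smult_minus_left[of yy p] by (simp_all add: one_pCons)
  then show "D f (Zop q) = Zop (D f q) + D (\<lambda>q. f (Zop q)) q
      + smult xx (D (\<lambda>q. f (smult yy q)) q) - smult yy (D (\<lambda>q. f (smult xx q)) q)"
    using t unfolding D_def psi_Zop comult_simps(2)[OF gen_closed(3) psi_closed] comult(4) DZ_def t_def[symmetric]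
    by (simp add: HH.T.l_distr HH.T.smult_mult_left slice[OF f] s)
qed

text \<open>By the coideal condition \<Delta>(s) is a combination of tensors a \<otimes> h with a in
  S, and id \<otimes> f sends each of them to a multiple of a.\<close>

lemma coideal_D_closed:
  assumes S: "right_coideal_subalg H \<Delta> S" and f: "functional f" and q: "q \<in> phi ` S"
  shows "D f q \<in> phi ` S"
proof -
  have sub: "subalg S H" using S by (simp add: right_coideal_subalg_def)
  note sD = H.subalgD[OF sub]
  obtain s where s: "s \<in> S" "q = phi s" using q by blast
  have sc: "x \<in> S \<Longrightarrow> x \<in> carrier H" for x using sD(1) by blast
  have "\<Delta> s \<in> HH.span_left S" using S s unfolding right_coideal_subalg_def by blast
  moreover have "{pt a b |a b. a \<in> S \<and> b \<in> carrier H} \<subseteq> carrier TT"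
  proof clarify
    fix a b assume "a \<in> S" "b \<in> carrier H"
    then show "pt a b \<in> carrier TT" using sc HH.pt_closed by simp
  qed
  ultimately have "slice f (\<Delta> s) \<in> phi ` S"
  proof (induction rule: HH.T.lin_span_induct)
    case zero
    have "slice f (0 \<odot>\<^bsub>TT\<^esub> \<zero>\<^bsub>TT\<^esub>) = 0" by (subst slice(3)[OF f]) simp_all
    moreover have "0 = phi (0 \<odot>\<^bsub>H\<^esub> e)" by (subst phi_scale) simp_all
    ultimately show ?case using sD(2,5) by (metis HH.T.smult_0_right image_eqI)
  next
    case (add x y)
    then obtain a b where ab: "slice f x = phi a" "slice f y = phi b" "a \<in> S" "b \<in> S" by (elim imageE)
    have "slice f (x \<oplus>\<^bsub>TT\<^esub> y) = phi (a \<oplus>\<^bsub>H\<^esub> b)"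
      unfolding slice(2)[OF f add(1,2)] ab(1,2) phi_add[OF sc[OF ab(3)] sc[OF ab(4)]] ..
    then show ?case using sD(3)[OF ab(3,4)] by (rule image_eqI)
  next
    case (smult c x)
    then obtain a where a: "slice f x = phi a" "a \<in> S" by (elim imageE)
    have "slice f (c \<odot>\<^bsub>TT\<^esub> x) = phi (c \<odot>\<^bsub>H\<^esub> a)"
      unfolding slice(3)[OF f smult(1)] a(1) phi_scale[OF sc[OF a(2)]] ..
    then show ?case using sD(5)[OF a(2)] by (rule image_eqI)
  next
    case (base x)
    then obtain a b where ab: "x = pt a b" "a \<in> S" "b \<in> carrier H" by blast
    have "slice f x = phi (f (phi b) \<odot>\<^bsub>H\<^esub> a)"
      unfolding ab(1) slice(1)[OF f sc[OF ab(2)] ab(3)] phi_scale[OF sc[OF ab(2)]] ..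
    then show ?case using sD(5)[OF ab(2)] by (rule image_eqI)
  qed
  then show ?thesis by (simp add: D_def s psi_phi sc)
qed

subsection \<open>The three basic slices\<close>

text \<open>\<open>c1\<close> is the counit, and the other three are the coordinates of X, Y, Z in
  the PBW basis. The indices stand for the powers of z, x and y, from the inside out.\<close>

definition "c1 q = coeff (coeff (coeff q 0) 0) 0" for q :: "'k pbw"
definition "cX q = coeff (coeff (coeff q 0) 1) 0" for q :: "'k pbw"
definition "cY q = coeff (coeff (coeff q 0) 0) 1" for q :: "'k pbw"
definition "cZ q = coeff (coeff (coeff q 1) 0) 0" for q :: "'k pbw"

lemma functional_c [simp]: "functional c1" "functional cX" "functional cY" "functional cZ"
  by (simp_all add: functional_def c1_def cX_def cY_def cZ_def)

lemma functional_0 [simp]: "functional (\<lambda>q. 0)"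
  by (simp add: functional_def)

lemma delta_alt: "delta r = smult [:l1:] (pCons 0 (dx r)) - smult [:0, \<alpha>:] (dx r) + smult [:0, l2:] (dy r)"
proof -
  have "smult [:l1:] (pCons 0 p) = cst l1 * xx * p" "smult [:0, c:] p = cst c * yy * p" for c and p :: "'k bipoly"
    by simp_all
  then show ?thesis unfolding delta_def by (simp only: algebra_simps)
qed

lemma coeff_delta: "coeff (coeff (delta r) 0) 0 = 0" "coeff (coeff (delta r) 1) 0 = l1 * coeff (coeff r 1) 0"
  "coeff (coeff (delta r) 0) 1 = l2 * coeff (coeff r 0) 1 - \<alpha> * coeff (coeff r 1) 0"
  by (simp_all add: delta_alt coeff_pderiv coeff_map_poly)

text \<open>Each functional precomposed with a left multiplication is again a combination of the
  four. With this table the rules \<open>D_xx\<close>, \<open>D_yy\<close>, \<open>D_Zop\<close>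
  become closed recursions.\<close>

lemma c_gen_op:
  "c1 (smult xx q) = 0" "c1 (smult yy q) = 0" "c1 (Zop q) = 0"
  "cX (smult xx q) = c1 q" "cX (smult yy q) = 0" "cX (Zop q) = l1 * cX q"
  "cY (smult xx q) = 0" "cY (smult yy q) = c1 q" "cY (Zop q) = l2 * cY q - \<alpha> * cX q"
  "cZ (smult xx q) = 0" "cZ (smult yy q) = 0" "cZ (Zop q) = c1 q"
  by (simp_all add: c1_def cX_def cY_def cZ_def coeff_Zop coeff_delta[simplified])

lemma D_0: "D (\<lambda>q. 0) q = 0"
  using D_lin[of "\<lambda>q. 0" "\<lambda>q. 0" 0 0 q] by simp

text \<open>One of the counit laws. Since \<open>c1\<close> vanishes on all left multiples of
  generators, D \<open>c1\<close> commutes with the left multiplications and fixes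
  constants.\<close>

lemma D_c1: "D c1 q = q"
proof (induction q rule: pbw_Zop_induct)
  case (const c)
  have "[:cst c:] = pbw_scale c 1" by simp
  moreover have "c1 1 = 1" by (simp add: c1_def)
  ultimately show ?case using D_scale[of c1 c 1] D_1[of c1] by simp
qed (simp_all add: D_add D_xx D_yy D_Zop c_gen_op D_0)

abbreviation "dX \<equiv> D cX"
abbreviation "dY \<equiv> D cY"

lemma dX: "dX (smult xx q) = smult xx (dX q) + q" "dX (smult yy q) = smult yy (dX q)"
  "dX (Zop q) = Zop (dX q) + pbw_scale l1 (dX q) - smult yy q" "dX [:cst c:] = 0"
  using D_lin[of cX cX l1 0 q] D_scale[of cX c 1] D_1[of cX]
  by (simp_all add: D_xx D_yy D_Zop c_gen_op D_0 D_c1, simp add: cX_def)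

text \<open>The term with \<alpha> arises because [Z, X] has Y-coordinate -\<alpha>, so that
  \<open>cY\<close> after \<open>Zop\<close> involves \<open>cX\<close>.\<close>

lemma dY: "dY (smult xx q) = smult xx (dY q)" "dY (smult yy q) = smult yy (dY q) + q"
  "dY (Zop q) = Zop (dY q) + pbw_scale l2 (dY q) - pbw_scale \<alpha> (dX q) + smult xx q" "dY [:cst c:] = 0"
  using D_lin[of cY cX l2 "- \<alpha>" q] D_scale[of cY c 1] D_1[of cY] VS.scale_minus_left[of \<alpha> "dX q"]
  by (simp_all add: D_xx D_yy D_Zop c_gen_op D_0 D_c1, simp add: cY_def)

lemma pderiv_Zop: "pderiv (Zop q) = Zop (pderiv q) + q"
proof (rule poly_eqI)
  fix n
  have m: "delta (of_nat m * r) = of_nat m * delta r" for m r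
    by (induction m) (simp_all add: delta_add algebra_simps)
  have two: "delta (2 * r) = 2 * delta r" for r
    using m[of 2 r] by simp
  show "coeff (pderiv (Zop q)) n = coeff (Zop (pderiv q) + q) n"
    by (cases n) (simp_all add: coeff_pderiv coeff_Zop delta_add m two ring_distribs add_ac)
qed

text \<open>Both operators commute with multiplication by x and y, vanish on constants and satisfy D
  (Zop q) = Zop (D q) + q; these rules determine them.\<close>

lemma D_cZ: "D cZ q = pderiv q"
proof (induction q rule: pbw_Zop_induct)
  case (const c)
  have "[:cst c:] = pbw_scale c 1" by simp
  moreover have "cZ 1 = 0" by (simp add: cZ_def)
  ultimately show ?case using D_scale[of cZ c 1] D_1[of cZ] by (simp add: pderiv_pCons)
qed (simp_all add: D_add D_xx D_yy D_Zop c_gen_op D_0 D_c1 pderiv_add pderiv_smult pderiv_Zop)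

end

section \<open>Subalgebras of the polynomial ring stable under both derivatives\<close>

definition lin_form :: "'k::field_char_0 \<Rightarrow> 'k \<Rightarrow> 'k bipoly" where
  "lin_form a b = cst a * xx + cst b * yy"

definition dtransv :: "'k::field_char_0 \<Rightarrow> 'k \<Rightarrow> 'k bipoly \<Rightarrow> 'k bipoly" where
  "dtransv a b r = cst a * dy r - cst b * dx r"

text \<open>Substitution of ax + by into a polynomial in one variable, by Horner's scheme.\<close>

definition poly_in :: "'k::field_char_0 \<Rightarrow> 'k \<Rightarrow> 'k poly \<Rightarrow> 'k bipoly" where
  "poly_in a b p = fold_coeffs (\<lambda>c r. cst c + lin_form a b * r) p 0"

lemma smult_pCons_1 [simp]:
  fixes p :: "'a::comm_semiring_1 poly poly" and q :: "'a poly poly poly"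
  shows "smult [:1:] p = p" "smult [:[:1:]:] q = q"
  by (simp_all flip: one_pCons)

lemma poly_in_0 [simp]: "poly_in a b 0 = 0"
  by (simp add: poly_in_def)

lemma poly_in_pCons: "poly_in a b (pCons c p) = cst c + lin_form a b * poly_in a b p"
  by (cases "c = 0 \<and> p = 0") (auto simp: poly_in_def)

lemma dx_simps: "dx (cst c) = 0" "dx xx = 1" "dx yy = 0" "dy (cst c) = 0" "dy xx = 0" "dy yy = 1"
  by (simp_all add: pderiv_pCons dy_pCons one_pCons)

lemma d_mult: "dx (r * s) = dx r * s + r * dx s" "dy (r * s) = dy r * s + r * dy s"
  by (simp_all add: pderiv_mult dy_mult mult.commute add.commute)

lemmas d_simps = d_mult dx_simps pderiv_add pderiv_diff dy_add dy_diff

lemma d_lin_form: "dx (lin_form a b) = cst a" "dy (lin_form a b) = cst b"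
  unfolding lin_form_def d_simps by simp_all

lemma d_poly_in: "dx (poly_in a b p) = cst a * poly_in a b (pderiv p)"
  "dy (poly_in a b p) = cst b * poly_in a b (pderiv p)"
proof -
  have add: "poly_in a b (p + q) = poly_in a b p + poly_in a b q" for p q
    by (induction p q rule: poly_induct2) (simp_all add: poly_in_pCons algebra_simps del: mult_pCons_left mult_pCons_right)
  have "dx (poly_in a b p) = cst a * poly_in a b (pderiv p) \<and> dy (poly_in a b p) = cst b * poly_in a b (pderiv p)"
  proof (induction p)
    case (pCons c p)
    have "poly_in a b (pderiv (pCons c p)) = poly_in a b p + lin_form a b * poly_in a b (pderiv p)"
      by (simp add: pderiv_pCons add poly_in_pCons)
    then show ?case
      unfolding poly_in_pCons d_simps d_lin_form using pCons
      by (simp only: algebra_simps) simp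
  qed (simp add: pderiv_0)
  then show "dx (poly_in a b p) = cst a * poly_in a b (pderiv p)" "dy (poly_in a b p) = cst b * poly_in a b (pderiv p)"
    by blast+
qed

text \<open>Characteristic zero makes i + 1 invertible, so each monomial has an
  antiderivative.\<close>

lemma pderiv_surj: "\<exists>P. pderiv P = (p :: 'k::field_char_0 poly)"
proof -
  have "\<exists>P. pderiv P = (\<Sum>i\<in>I. monom (f i) i)" if "finite I" for I and f :: "nat \<Rightarrow> 'k"
    using that
  proof (induction I)
    case empty
    show ?case by (rule exI[of _ 0]) simp
  next
    case (insert i I)
    then obtain P where P: "pderiv P = (\<Sum>i\<in>I. monom (f i) i)" by blast
    have "pderiv (monom (f i / of_nat (Suc i)) (Suc i)) = monom (f i) i"
      by (simp add: pderiv_monom del: of_nat_Suc)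
    then show ?case using insert P by (intro exI[of _ "monom (f i / of_nat (Suc i)) (Suc i) + P"]) (simp add: pderiv_add)
  qed
  from this[of "{..degree p}" "coeff p"] show ?thesis by (simp add: poly_as_sum_of_monoms)
qed

lemma const_if_derivs_0:
  fixes r :: "'k::field_char_0 bipoly"
  assumes "dx r = 0" "dy r = 0" obtains c where "r = cst c"
proof -
  have "coeff r (Suc n) = 0" for n
  proof -
    have "coeff (coeff (dx r) n) m = 0" for m using assms by simp
    then have "of_nat (Suc n) * coeff (coeff r (Suc n)) m = 0" for m
      by (simp add: coeff_pderiv of_nat_poly algebra_simps flip: of_nat_Suc)
    then show ?thesis by (intro poly_eqI) (simp del: of_nat_Suc)
  qed
  then obtain t where t: "r = [:t:]" by (metis pCons_cases coeff_pCons_Suc leading_coeff_0_iff poly_eqI coeff_0)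
  then have "pderiv t = 0" using assms(2) by (simp add: dy_pCons)
  then obtain c where "t = [:c:]" using pderiv_eq_0_iff degree_eq_zeroE by blast
  then show thesis using that t by blast
qed

lemma dtransv_comm: "dx (dtransv a b r) = dtransv a b (dx r)" "dy (dtransv a b r) = dtransv a b (dy r)"
  unfolding dtransv_def d_simps by (simp_all add: dx_dy)

lemma dtransv_simps: "dtransv a b (r + s) = dtransv a b r + dtransv a b s"
  "dtransv a b (r - s) = dtransv a b r - dtransv a b s"
  "dtransv a b (r * s) = dtransv a b r * s + r * dtransv a b s"
  "dtransv a b (cst c) = 0" "dtransv a b xx = - cst b" "dtransv a b yy = cst a" "dtransv a b (lin_form a b) = 0"
  unfolding dtransv_def d_simps d_lin_form by (simp_all only: algebra_simps) simp_all

lemma dtransv_poly_in: "dtransv a b (poly_in a b p) = 0"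
  unfolding dtransv_def d_poly_in by (simp only: algebra_simps) simp

context ha
begin

subsection \<open>Local nilpotence\<close>

text \<open>Every composite of n operators chosen from \<open>dX\<close>, \<open>dY\<close>,
  \<open>pderiv\<close> kills q. A single n serves all composites, as the three operators need not
  commute.\<close>

primrec nil :: "nat \<Rightarrow> 'k pbw \<Rightarrow> bool" where
  "nil 0 q = (q = 0)"
| "nil (Suc n) q = (nil n (dX q) \<and> nil n (dY q) \<and> nil n (pderiv q))"

lemma dXY_0 [simp]: "dX 0 = 0" "dY 0 = 0"
  using dX(4)[of 0] dY(4)[of 0] by simp_all

lemma nil_0 [simp]: "nil n 0"
  by (induction n) simp_all

lemma nil_add: "nil n p \<Longrightarrow> nil n q \<Longrightarrow> nil n (p + q)"
  by (induction n arbitrary: p q) (simp_all add: D_add pderiv_add)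

lemma nil_scale: "nil n q \<Longrightarrow> nil n (pbw_scale c q)"
  by (induction n arbitrary: q) (simp_all add: D_scale pderiv_smult)

lemma nil_diff: "nil n p \<Longrightarrow> nil n q \<Longrightarrow> nil n (p - q)"
  using nil_add[of n p "pbw_scale (- 1) q"] nil_scale[of n q "- 1"] smult_minus_left[of 1 q] by (simp add: one_pCons)

lemma nil_Suc: "nil n q \<Longrightarrow> nil (Suc n) q"
  by (induction n arbitrary: q) simp_all

lemma nil_mono: "m \<le> n \<Longrightarrow> nil m q \<Longrightarrow> nil n q"
  by (induction rule: dec_induct) (auto intro: nil_Suc simp del: nil.simps)

lemma nil_xx: "nil n q \<Longrightarrow> nil (Suc n) (smult xx q)"
proof (induction n arbitrary: q)
  case (Suc n)
  have "nil (Suc n) (smult xx (dX q) + q)" by (rule nil_add) (use Suc in \<open>simp_all del: nil.simps(2) add: nil.simps(2)[of n q]\<close>)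
  then show ?case unfolding nil.simps(2)[of "Suc n"] dX dY pderiv_smult
    using Suc by (simp del: nil.simps(2) add: nil.simps(2)[of n q])
qed simp

lemma nil_yy: "nil n q \<Longrightarrow> nil (Suc n) (smult yy q)"
proof (induction n arbitrary: q)
  case (Suc n)
  have "nil (Suc n) (smult yy (dY q) + q)" by (rule nil_add) (use Suc in \<open>simp_all del: nil.simps(2) add: nil.simps(2)[of n q]\<close>)
  then show ?case unfolding nil.simps(2)[of "Suc n"] dX dY pderiv_smult
    using Suc by (simp del: nil.simps(2) add: nil.simps(2)[of n q])
qed simp

text \<open>Here the index grows by two: \<open>dX (Zop q)\<close> and \<open>dY (Zop q)\<close>
  contain the multiples of q by y and x, which cost one step more than q itself.\<close>

lemma nil_Zop: "nil n q \<Longrightarrow> nil (Suc (Suc n)) (Zop q)"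
proof (induction n arbitrary: q)
  case 0
  then show ?case by (simp add: Zop_def)
next
  case (Suc n)
  have q: "nil n (dX q)" "nil n (dY q)" "nil n (pderiv q)" using Suc.prems by simp_all
  note Z = Suc.IH[OF q(1)] Suc.IH[OF q(2)] Suc.IH[OF q(3)]
  have m: "nil (Suc (Suc n)) p" if "nil n p" for p using that nil_Suc by blast
  show ?case
    unfolding nil.simps(2)[of "Suc (Suc n)"] dX dY pderiv_Zop
    by (intro conjI nil_add nil_diff nil_scale Z nil_yy nil_xx Suc.prems m q nil_Suc[OF Suc.prems])
qed

lemma locally_nilpotent: "\<exists>n. nil n q"
proof (induction q rule: pbw_Zop_induct)
  case (const c)
  show ?case by (rule exI[of _ "Suc 0"]) (simp add: dX dY pderiv_pCons)
next
  case (add p q)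
  then obtain m n where "nil m p" "nil n q" by blast
  then have "nil (max m n) (p + q)" by (intro nil_add nil_mono[of m "max m n"] nil_mono[of n "max m n"]) simp_all
  then show ?case ..
qed (blast intro: nil_xx nil_yy nil_Zop)+

text \<open>As long as one of the operators sends the element outside K, replace it by that image.
  Local nilpotence ends this, because 0 lies in K.\<close>

lemma minimal_outside:
  assumes V: "\<And>q. q \<in> V \<Longrightarrow> dX q \<in> V \<and> dY q \<in> V \<and> pderiv q \<in> V" and "q \<in> V" "q \<notin> K" "0 \<in> K"
  obtains s where "s \<in> V" "s \<notin> K" "dX s \<in> K" "dY s \<in> K" "pderiv s \<in> K"
proof -
  obtain n where "nil n q" using locally_nilpotent by blast
  then have "\<exists>s. s \<in> V \<and> s \<notin> K \<and> dX s \<in> K \<and> dY s \<in> K \<and> pderiv s \<in> K"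
    using assms(2,3)
  proof (induction n arbitrary: q)
    case (Suc n)
    then show ?case using V[OF Suc.prems(2)] by (metis nil.simps(2))
  qed (use assms(4) in simp)
  then show thesis using that by blast
qed

lemma dX_smult: "dX (smult r q) = smult r (dX q) + smult (dx r) q"
proof (induction r arbitrary: q rule: bipoly_induct)
  case (const c)
  then show ?case using D_scale[of cX c q] by (simp add: pderiv_pCons)
next
  case (add r s)
  then show ?case by (simp add: smult_add_left D_add pderiv_add)
next
  case (mult_x r)
  have "dX (smult xx (smult r q)) = smult (xx * r) (dX q) + smult (dx (xx * r)) q"
    unfolding dX mult_x unfolding d_simps smult_add_left smult_add_right smult_smult by (simp add: mult.commute)
  then show ?case by simp
next
  case (mult_y r)
  have "dX (smult yy (smult r q)) = smult (yy * r) (dX q) + smult (dx (yy * r)) q"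
    unfolding dX mult_y unfolding d_simps smult_add_left smult_add_right smult_smult by simp
  then show ?case by simp
qed

lemma dY_smult: "dY (smult r q) = smult r (dY q) + smult (dy r) q"
proof (induction r arbitrary: q rule: bipoly_induct)
  case (const c)
  then show ?case using D_scale[of cY c q] by (simp add: dy_pCons)
next
  case (add r s)
  then show ?case by (simp add: smult_add_left D_add dy_add)
next
  case (mult_x r)
  have "dY (smult xx (smult r q)) = smult (xx * r) (dY q) + smult (dy (xx * r)) q"
    unfolding dY mult_x unfolding d_simps smult_add_left smult_add_right smult_smult by simp
  then show ?case by simp
next
  case (mult_y r)
  have "dY (smult yy (smult r q)) = smult (yy * r) (dY q) + smult (dy (yy * r)) q"
    unfolding dY mult_y unfolding d_simps smult_add_left smult_add_right smult_smult by (simp add: mult.commute)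
  then show ?case by simp
qed

lemma d_const: "dX [:r:] = [:dx r:]" "dY [:r:] = [:dy r:]"
proof -
  have one: "[:cst 1:] = (1 :: 'k pbw)" by (simp add: one_pCons)
  show "dX [:r:] = [:dx r:]" "dY [:r:] = [:dy r:]"
    using dX_smult[of r 1] dY_smult[of r 1] dX(4)[of 1] dY(4)[of 1] unfolding one by simp_all
qed

text \<open>Induction on the nilpotency index: the derivation commutes with both partial
  derivatives, so these are polynomials in u = ax + by already. An antiderivative P is then found
  such that r - P(u) is constant.\<close>

lemma dtransv_ker:
  fixes a b :: 'k
  assumes "(a, b) \<noteq> (0, 0)" "dtransv a b r = 0"
  obtains p where "r = poly_in a b p"
proof -
  obtain n where "nil n [:r:]" using locally_nilpotent by blast
  then have "\<exists>p. r = poly_in a b p" using assms(2)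
  proof (induction n arbitrary: r)
    case 0
    then show ?case by (intro exI[of _ 0]) simp
  next
    case (Suc n)
    have "dtransv a b (dx r) = 0" "dtransv a b (dy r) = 0"
      using Suc.prems(2) unfolding dtransv_comm[symmetric] by simp_all
    moreover have "nil n [:dx r:]" "nil n [:dy r:]" using Suc.prems(1) by (simp_all add: d_const)
    ultimately obtain p q where pq: "dx r = poly_in a b p" "dy r = poly_in a b q"
      using Suc.IH by metis
    have sm: "cst c * poly_in a b p = poly_in a b (smult c p)" for c p
      by (induction p) (simp_all add: poly_in_pCons algebra_simps del: mult_pCons_left mult_pCons_right, simp add: mult.commute)
    have "\<exists>P. dx (r - poly_in a b P) = 0 \<and> dy (r - poly_in a b P) = 0"
    \<comment> \<open>The antiderivative is divided by a nonzero one of a and b. For a = 0 the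
      kernel condition says that \<open>dx r\<close> vanishes; otherwise it yields the second
      derivative from the first.\<close>
    proof (cases "a = 0")
      case True
      then have b: "b \<noteq> 0" using assms(1) by simp
      have "cst b * dx r = 0" using Suc.prems(2) True by (simp add: dtransv_def)
      then have dx0: "dx r = 0" using b by simp
      obtain P where P: "pderiv P = smult (1 / b) q" using pderiv_surj by blast
      have "dx (r - poly_in a b P) = 0"
        unfolding pderiv_diff d_poly_in dx0 True by simp
      moreover have "dy (r - poly_in a b P) = 0"
        unfolding dy_diff d_poly_in P sm[symmetric] pq(2) using b by simp
      ultimately show ?thesis by blast
    next
      case False
      obtain P where P: "pderiv P = smult (1 / a) p" using pderiv_surj by blast
      have x: "dx (r - poly_in a b P) = 0"
        using False by (simp add: pderiv_diff d_poly_in P sm pq del: mult_pCons_left mult_pCons_right)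
      have "dtransv a b (r - poly_in a b P) = 0"
        using Suc.prems(2) by (simp add: dtransv_simps dtransv_poly_in)
      then have "cst a * dy (r - poly_in a b P) = 0" unfolding dtransv_def x by simp
      then show ?thesis using x False by auto
    qed
    then obtain P where P: "dx (r - poly_in a b P) = 0" "dy (r - poly_in a b P) = 0" by blast
    obtain c where "r - poly_in a b P = cst c" using const_if_derivs_0[OF P] .
    then have "r = cst c + poly_in a b P" by (simp add: algebra_simps)
    also have "\<dots> = poly_in a b (P + [:c:])"
      by (cases P) (simp add: poly_in_pCons algebra_simps)
    finally show ?case ..
  qed
  then show thesis using that by blast
qed

lemma minimal_outside_bipoly:
  assumes W: "\<And>r. r \<in> W \<Longrightarrow> dx r \<in> W \<and> dy r \<in> W" and "r \<in> W" "r \<notin> K" "0 \<in> K"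
  obtains s where "s \<in> W" "s \<notin> K" "dx s \<in> K" "dy s \<in> (K :: 'k bipoly set)"
proof -
  let ?i = "\<lambda>r. [:r:] :: 'k pbw"
  have inj: "?i r \<in> ?i ` A \<longleftrightarrow> r \<in> A" for r A by auto
  \<comment> \<open>The operator \<open>pderiv\<close> kills the embedded polynomials, so 0 is
    adjoined to make the embedded set stable.\<close>
  have cl: "q \<in> insert 0 (?i ` W) \<Longrightarrow> dX q \<in> insert 0 (?i ` W) \<and> dY q \<in> insert 0 (?i ` W) \<and> pderiv q \<in> insert 0 (?i ` W)" for q
    using W by (elim insertE imageE) (simp_all add: d_const pderiv_pCons)
  have K0: "0 \<in> ?i ` K" using assms(4) by (rule rev_image_eqI) simp
  have r: "?i r \<in> insert 0 (?i ` W)" "?i r \<notin> ?i ` K" using assms(2,3) inj by blast+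
  obtain s where s: "s \<in> insert 0 (?i ` W)" "s \<notin> ?i ` K" "dX s \<in> ?i ` K" "dY s \<in> ?i ` K" "pderiv s \<in> ?i ` K"
    by (rule minimal_outside[OF cl r K0])
  from s(1,2) K0 have "s \<in> ?i ` W" by (metis insertE)
  then obtain s' where s': "s = ?i s'" "s' \<in> W" by (rule imageE)
  show thesis
    by (rule that[OF s'(2)]) (use s(2-4) in \<open>simp_all only: s'(1) d_const inj not_False_eq_True\<close>)
qed

text \<open>An element outside the constants whose derivatives are constant is a linear form u up to
  a constant, so W contains all polynomials in u. An element of W outside these, with both
  derivatives among them, has constant transversal derivative; it differs from a multiple of a
  second linear form by a polynomial in u, so W contains x and y. The pair (a, b) is scaled to (0,
  1) or to a = 1.\<close>

lemma bipoly_stable_cases: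
  fixes W :: "'k bipoly set"
  assumes c: "\<And>c. cst c \<in> W" and a: "\<And>r s. r \<in> W \<Longrightarrow> s \<in> W \<Longrightarrow> r + s \<in> W"
    and m: "\<And>r s. r \<in> W \<Longrightarrow> s \<in> W \<Longrightarrow> r * s \<in> W"
    and d: "\<And>r. r \<in> W \<Longrightarrow> dx r \<in> W \<and> dy r \<in> W"
  obtains (const) "W = range cst"
    | (line) a b where "a = 0 \<and> b = 1 \<or> a = 1" "W = {r. dtransv a b r = 0}"
    | (all) "W = UNIV"
proof (cases "W \<subseteq> range cst")
  case True
  then show ?thesis using const c by blast
next
  case False
  then obtain r where "r \<in> W" "r \<notin> range cst" by blast
  moreover have "0 \<in> range (cst :: 'k \<Rightarrow> _)" by (rule range_eqI[of _ _ 0]) simp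
  ultimately obtain s where s: "s \<in> W" "s \<notin> range cst" "dx s \<in> range cst" "dy s \<in> range cst"
    using minimal_outside_bipoly[of W r "range cst"] d by blast
  obtain a0 b0 where ab0: "dx s = cst a0" "dy s = cst b0" using s by blast
  have md: "r - t \<in> W" if "r \<in> W" "t \<in> W" for r t
  proof -
    have "r - t = r + cst (- 1) * t"
      using smult_minus_left[of 1 t] by (simp add: one_pCons)
    then show ?thesis using a m c that by metis
  qed
  have "dx (s - lin_form a0 b0) = 0" "dy (s - lin_form a0 b0) = 0"
    unfolding d_simps d_lin_form ab0 by simp_all
  then obtain c0 where "s - lin_form a0 b0 = cst c0" by (rule const_if_derivs_0)
  then have "lin_form a0 b0 = s - cst c0" by (simp add: algebra_simps)
  then have l0: "lin_form a0 b0 \<in> W" using md s(1) c by simp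
  have nz: "a0 \<noteq> 0 \<or> b0 \<noteq> 0"
  proof (rule ccontr)
    assume "\<not> ?thesis"
    then have "dx s = 0" "dy s = 0" using ab0 by simp_all
    then show False using const_if_derivs_0 s(2) by blast
  qed
  obtain a b where ab: "a = 0 \<and> b = 1 \<or> a = 1" "lin_form a b \<in> W"
  proof (cases "a0 = 0")
    case True
    then have "lin_form 0 1 = cst (1 / b0) * lin_form a0 b0" using nz by (simp add: lin_form_def)
    then have "lin_form 0 1 \<in> W" using m c l0 by metis
    then show thesis using that by blast
  next
    case False
    then have "lin_form 1 (b0 / a0) = cst (1 / a0) * lin_form a0 b0" by (simp add: lin_form_def)
    then have "lin_form 1 (b0 / a0) \<in> W" using m c l0 by metis
    then show thesis using that by blast
  qed
  have ker: "{r. dtransv a b r = 0} \<subseteq> W"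
  proof clarify
    fix r assume "dtransv a b r = 0"
    moreover have "(a, b) \<noteq> (0, 0)" using ab(1) by auto
    ultimately obtain p where p: "r = poly_in a b p" by (metis dtransv_ker)
    have "poly_in a b p \<in> W"
    proof (induction p)
      case 0
      then show ?case using c[of 0] by simp
    qed (auto simp: poly_in_pCons intro!: a m c ab)
    then show "r \<in> W" by (simp add: p)
  qed
  show ?thesis
  proof (cases "W \<subseteq> {r. dtransv a b r = 0}")
    case True
    then show ?thesis using line ab ker by blast
  next
    case False
    then obtain r where "r \<in> W" "r \<notin> {r. dtransv a b r = 0}" by blast
    moreover have "0 \<in> {r. dtransv a b r = 0}" using dtransv_simps(4)[of a b 0] by simp
    ultimately obtain s where s: "s \<in> W" "s \<notin> {r. dtransv a b r = 0}" "dtransv a b (dx s) = 0" "dtransv a b (dy s) = 0"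
      using minimal_outside_bipoly[of W r "{r. dtransv a b r = 0}"] d by blast
    have "dx (dtransv a b s) = 0" "dy (dtransv a b s) = 0" unfolding dtransv_comm using s by simp_all
    then obtain e0 where e0: "dtransv a b s = cst e0" by (rule const_if_derivs_0)
    then have e0nz: "e0 \<noteq> 0" using s(2) by auto
    \<comment> \<open>A linear form with transversal derivative 1: that derivation sends y to a and
      x to -b, so y serves for a = 1 and -x for (a, b) = (0, 1).\<close>
    define w where "w = (if a = 1 then yy else cst (-1) * xx :: 'k bipoly)"
    have w: "dtransv a b w = cst 1"
      using ab(1) unfolding w_def by (auto simp: dtransv_simps simp del: mult_pCons_left mult_pCons_right) simp_all
    have "dtransv a b (s - cst e0 * w) = 0"
      unfolding dtransv_simps w e0 by simp
    then have "s - cst e0 * w \<in> W" using ker by blast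
    then have "s - (s - cst e0 * w) \<in> W" using md s(1) by blast
    moreover have "s - (s - cst e0 * w) = cst e0 * w" by simp
    ultimately have "cst e0 * w \<in> W" by metis
    then have "cst (1 / e0) * (cst e0 * w) \<in> W" by (rule m[OF c])
    moreover have "cst (1 / e0) * (cst e0 * w) = w" using e0nz by simp
    ultimately have wW: "w \<in> W" by simp
    have "xx \<in> W \<and> yy \<in> W"
    proof (cases "a = 1")
      case True
      then have y: "yy \<in> W" using wW by (simp add: w_def)
      have "xx = lin_form a b - cst b * yy" by (simp add: lin_form_def True)
      then show ?thesis using md m c ab y by metis
    next
      case False
      then have "a = 0" "b = 1" using ab by auto
      then have y: "yy = lin_form a b" by (simp add: lin_form_def)
      have "xx = cst (- 1) * w" using False by (simp add: w_def)
      then show ?thesis using m c wW ab(2) y by metis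
    qed
    then have "r \<in> W" for r
      by (induction r rule: bipoly_induct) (auto intro: c a m simp del: mult_pCons_left mult_pCons_right)
    then show ?thesis using all by blast
  qed
qed

section \<open>Classification of the right coideal subalgebras\<close>

definition mult_v :: "'k bipoly \<Rightarrow> 'k pbw \<Rightarrow> 'k pbw" where
  "mult_v r q = Zop q + smult r q"

text \<open>What is used of a right coideal subalgebra in the polynomial model: \<open>mult_v r\<close> is left multiplication by
  \<open>z + r\<close>, and \<open>pderiv\<close> is \<open>D\<^sub>Z\<close>.\<close>

definition coid :: "'k pbw set \<Rightarrow> bool" where
  "coid V \<longleftrightarrow> 1 \<in> V \<and> (\<forall>p\<in>V. \<forall>q\<in>V. p + q \<in> V) \<and> (\<forall>c. \<forall>q\<in>V. pbw_scale c q \<in> V) \<and>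
     (\<forall>r q. [:r:] \<in> V \<longrightarrow> q \<in> V \<longrightarrow> smult r q \<in> V) \<and>
     (\<forall>r q. [:r, 1:] \<in> V \<longrightarrow> q \<in> V \<longrightarrow> mult_v r q \<in> V) \<and>
     (\<forall>q\<in>V. dX q \<in> V \<and> dY q \<in> V \<and> pderiv q \<in> V)"

lemma ev_mult: "ev (r * s) = ev r \<otimes>\<^bsub>H\<^esub> ev s"
proof (induction r rule: bipoly_induct)
  case (const c)
  then show ?case using ev_smult[of c s] by (simp add: ev_cst H.smult_mult_left)
next
  case (add r t)
  then show ?case by (simp add: P.e_add H.l_distr distrib_right)
next
  case (mult_x r)
  then show ?case using ev_xx[of "r * s"] ev_xx[of r] by (simp add: H.m_assoc mult.assoc)
next
  case (mult_y r)
  then show ?case using ev_yy[of "r * s"] ev_yy[of r] by (simp add: H.m_assoc mult.assoc)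
qed

lemma psi_smult: "psi (smult r q) = ev r \<otimes>\<^bsub>H\<^esub> psi q"
proof (induction q)
  case (pCons s q)
  then show ?case by (simp add: psi_pCons ev_mult H.r_distr H.m_assoc)
qed simp

lemma psi_v: "psi [:r, 1:] = ev r \<oplus>\<^bsub>H\<^esub> Z"
  using psi_1 by (simp add: psi_pCons[of r] flip: one_pCons)

lemma psi_mult_v: "psi (mult_v r q) = psi [:r, 1:] \<otimes>\<^bsub>H\<^esub> psi q"
  unfolding mult_v_def psi_add psi_Zop psi_smult psi_v by (simp add: H.l_distr H.a_comm)

lemma mem_phi_image:
  assumes "subalg S H" shows "q \<in> phi ` S \<longleftrightarrow> psi q \<in> S"
proof
  assume "q \<in> phi ` S"
  then obtain s where s: "q = phi s" "s \<in> S" by (rule imageE)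
  then have "psi q = s" using psi_phi H.subalgD(1)[OF assms] by blast
  then show "psi q \<in> S" using s by simp
next
  assume "psi q \<in> S"
  then have "phi (psi q) \<in> phi ` S" by (rule imageI)
  then show "q \<in> phi ` S" by simp
qed

lemma coid_phi:
  assumes "right_coideal_subalg H \<Delta> S" shows "coid (phi ` S)"
proof -
  have sub: "subalg S H" using assms by (simp add: right_coideal_subalg_def)
  note sD = H.subalgD[OF sub]
  note mem = mem_phi_image[OF sub]
  show ?thesis
    unfolding coid_def
  proof (intro conjI ballI allI impI)
    fix q assume "q \<in> phi ` S"
    then show "dX q \<in> phi ` S" "dY q \<in> phi ` S" "pderiv q \<in> phi ` S"
      using coideal_D_closed[OF assms, of cX q] coideal_D_closed[OF assms, of cY q]
        coideal_D_closed[OF assms, of cZ q] D_cZ by simp_all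
  qed (simp_all add: mem psi_1 psi_add psi_scale psi_smult psi_mult_v sD psi_const ev_cst H.smult_mult_left)
qed

text \<open>Induction on the degree in \<open>z\<close>: since \<open>\<partial>\<^sub>z v\<^sup>n\<^sup>+\<^sup>1 = (n + 1) v\<^sup>n\<close> for \<open>v = z + r\<close>, the form of \<open>\<partial>\<^sub>z q\<close> can be integrated.\<close>

lemma coid_ore_form:
  assumes V: "coid V" and v: "[:r, 1:] \<in> V" and q: "q \<in> V"
  shows "\<exists>N f. (\<forall>n. [:f n:] \<in> V) \<and> q = (\<Sum>n\<le>N. smult (f n) ((mult_v r ^^ n) 1))"
  using q
proof (induction "degree q" arbitrary: q rule: less_induct)
  case less
  note V = V[unfolded coid_def]
  have pw: "(mult_v r ^^ n) 1 \<in> V" for n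
    using V v by (induction n) auto
  have sumV: "(\<Sum>n\<in>J. g n) \<in> V" if "finite J" "\<And>n. n \<in> J \<Longrightarrow> g n \<in> V" for J and g :: "nat \<Rightarrow> _"
    using that
  proof (induction J)
    case empty
    have "pbw_scale 0 1 \<in> V" using V by blast
    then show ?case by simp
  qed (use V in auto)
  show ?case
  proof (cases "degree q = 0")
    case True
    then obtain r' where r': "q = [:r':]" by (rule degree_eq_zeroE)
    show ?thesis
      by (rule exI[of _ 0], rule exI[of _ "\<lambda>_. r'"]) (use less r' in simp)
  next
    case False
    then have "degree (pderiv q) < degree q" by (simp add: degree_pderiv)
    from less.hyps[OF this, of] obtain N f where f: "\<forall>n. [:f n:] \<in> V" "pderiv q = (\<Sum>n\<le>N. smult (f n) ((mult_v r ^^ n) 1))"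
      using V less.prems by blast
    \<comment> \<open>Division by n + 1 compensates for the factor in the derivative of the power
      with exponent n + 1.\<close>
    define g where "g n = cst (1 / of_nat (Suc n)) * f n" for n
    have g: "[:g n:] \<in> V" for n
    proof -
      have "pbw_scale (1 / of_nat (Suc n)) [:f n:] \<in> V" using V f by blast
      then show ?thesis by (simp add: g_def)
    qed
    define t where "t = (\<Sum>n\<le>N. smult (g n) ((mult_v r ^^ Suc n) 1))"
    have tV: "t \<in> V" unfolding t_def by (rule sumV) (use V g pw in blast)+
    have dp: "pderiv ((mult_v r ^^ Suc n) 1) = of_nat (Suc n) * (mult_v r ^^ n) 1" for n
    proof (induction n)
      case 0
      have "mult_v r 1 = [:r, 1:]" using Zop_const[of 1] by (simp add: mult_v_def one_pCons Zop_def)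
      then show ?case by (simp add: pderiv_pCons one_pCons)
    next
      case (Suc n)
      have Zn: "Zop (of_nat m * p) = of_nat m * Zop p" for m p
        by (induction m) (simp_all add: Zop_add algebra_simps, simp add: Zop_def)
      have "pderiv ((mult_v r ^^ Suc (Suc n)) 1) = mult_v r (pderiv ((mult_v r ^^ Suc n) 1)) + (mult_v r ^^ Suc n) 1"
        by (simp add: mult_v_def pderiv_add pderiv_Zop pderiv_smult)
      also have "\<dots> = of_nat (Suc n) * (mult_v r ^^ Suc n) 1 + (mult_v r ^^ Suc n) 1"
        unfolding Suc by (simp add: mult_v_def Zn distrib_left del: of_nat_Suc)
      finally show ?case by (simp add: algebra_simps)
    qed
    have "pderiv t = pderiv q"
    proof -
      have ps: "pderiv (\<Sum>n\<in>J. h n) = (\<Sum>n\<in>J. pderiv (h n))" for J and h :: "nat \<Rightarrow> 'k pbw"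
        by (induction J rule: infinite_finite_induct) (simp_all add: pderiv_add)
      have "smult (g n) (of_nat (Suc n) * p) = smult (f n) p" for n p
      proof -
        have "smult (g n) (of_nat (Suc n) * p) = smult (g n * of_nat (Suc n)) p"
          by (simp add: of_nat_poly[of "Suc n"] del: of_nat_Suc)
        also have "g n * of_nat (Suc n) = f n"
          unfolding g_def of_nat_poly by (simp del: of_nat_Suc)
        finally show ?thesis .
      qed
      then show ?thesis unfolding t_def f(2) ps pderiv_smult dp by simp
    qed
    then have "pderiv (q - t) = 0" by (simp add: pderiv_diff)
    then obtain r' where r': "q - t = [:r':]" using pderiv_eq_0_iff degree_eq_zeroE by blast
    have "q + pbw_scale (- 1) t \<in> V" using V less.prems tV by blast
    moreover have "q + pbw_scale (- 1) t = q - t"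
      using smult_minus_left[of 1 t] by (simp add: one_pCons)
    ultimately have r'V: "[:r':] \<in> V" using r' by simp
    \<comment> \<open>The constant of integration r' becomes the coefficient of the zeroth power,
      and the integrated coefficients move up by one.\<close>
    define h where "h n = (case n of 0 \<Rightarrow> r' | Suc m \<Rightarrow> g m)" for n
    have "(\<Sum>n\<le>Suc N. smult (h n) ((mult_v r ^^ n) 1)) = smult r' 1 + t"
      unfolding sum.atMost_Suc_shift t_def h_def by simp
    also have "\<dots> = q" using r' by (simp add: algebra_simps)
    finally have "q = (\<Sum>n\<le>Suc N. smult (h n) ((mult_v r ^^ n) 1))" by simp
    moreover have "\<forall>n. [:h n:] \<in> V" using r'V g by (auto simp: h_def split: nat.split)
    ultimately show ?thesis by blast
  qed
qed

lemma ev_1: "ev 1 = \<one>\<^bsub>H\<^esub>"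
  using ev_cst[of 1] by (simp add: one_pCons)

lemma ev_gens: "ev xx = X" "ev yy = Y"
  using ev_xx[of 1] ev_yy[of 1] ev_1 by simp_all

lemma ev_lin_form: "ev (lin_form a b) = a \<odot>\<^bsub>H\<^esub> X \<oplus>\<^bsub>H\<^esub> b \<odot>\<^bsub>H\<^esub> Y"
  unfolding lin_form_def P.e_add ev_mult ev_cst ev_gens by (simp add: H.smult_mult_left)

lemma ev_poly_in_mem:
  assumes "subalg G H" "ev (lin_form a b) \<in> G" shows "ev (poly_in a b p) \<in> G"
proof (induction p)
  case 0
  then show ?case using H.subalgD(6)[OF assms(1)] by simp
next
  case (pCons c p)
  then show ?case
    unfolding poly_in_pCons P.e_add ev_mult ev_cst using H.subalgD(2-5)[OF assms(1)] assms(2) by simp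
qed

lemma ev_mem:
  assumes "subalg G H" "X \<in> G" "Y \<in> G" shows "ev r \<in> G"
  by (induction r rule: bipoly_induct)
    (simp_all only: P.e_add ev_xx ev_yy ev_cst H.subalgD(2-5)[OF assms(1)] assms(2,3))

lemma psi_mult_v_pow: "psi ((mult_v r ^^ n) 1) = psi [:r, 1:] [^]\<^bsub>H\<^esub> n"
proof (induction n)
  case (Suc n)
  have "psi ((mult_v r ^^ Suc n) 1) = psi [:r, 1:] \<otimes>\<^bsub>H\<^esub> psi [:r, 1:] [^]\<^bsub>H\<^esub> n"
    by (simp only: funpow.simps comp_apply psi_mult_v Suc)
  also have "\<dots> = psi [:r, 1:] [^]\<^bsub>H\<^esub> Suc n" by (rule H.nat_pow_Suc2[symmetric]) simp
  finally show ?case .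
qed (simp add: psi_1)

lemma coid_diff: "coid V \<Longrightarrow> p \<in> V \<Longrightarrow> q \<in> V \<Longrightarrow> p - q \<in> V"
proof -
  assume V: "coid V" "p \<in> V" "q \<in> V"
  then have "p + pbw_scale (- 1) q \<in> V" unfolding coid_def by blast
  then show "p - q \<in> V" using smult_minus_left[of 1 q] by (simp add: one_pCons)
qed

text \<open>The coefficients delivered by \<open>coid_ore_form\<close> lie in S and in the
  polynomials in x and y, hence are polynomials in u. So every element of S is assembled from u and
  v = z + r.\<close>

lemma ore_generated:
  assumes S: "subalg S H" and V: "coid (phi ` S)"
    and ab: "(a, b) \<noteq> (0, 0)" and W: "{r. [:r:] \<in> phi ` S} = {r. dtransv a b r = 0}"
    and v: "[:r, 1:] \<in> phi ` S"
  shows "S = alg_gen H {ev (lin_form a b), ev r \<oplus>\<^bsub>H\<^esub> Z}" (is "S = ?G")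
proof
  have "[:lin_form a b:] \<in> phi ` S" using W dtransv_simps(7)[of a b] by blast
  then have "ev (lin_form a b) \<in> S" unfolding mem_phi_image[OF S] psi_const .
  moreover have "ev r \<oplus>\<^bsub>H\<^esub> Z \<in> S" using v unfolding mem_phi_image[OF S] psi_v .
  ultimately show "?G \<subseteq> S" by (intro H.alg_gen_least[OF S]) simp
  have G: "subalg ?G H" by (rule H.subalg_alg_gen) simp
  note GD = H.subalgD[OF G]
  have g: "ev (lin_form a b) \<in> ?G" "ev r \<oplus>\<^bsub>H\<^esub> Z \<in> ?G" by (rule subsetD[OF H.alg_gen_superset], simp)+
  show "S \<subseteq> ?G"
  proof
    fix s assume s: "s \<in> S"
    then have "phi s \<in> phi ` S" by (rule imageI)
    from coid_ore_form[OF V v this] obtain N f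
      where f: "\<forall>n. [:f n:] \<in> phi ` S" "phi s = (\<Sum>n\<le>N. smult (f n) ((mult_v r ^^ n) 1))" by blast
    have "psi (smult (f n) ((mult_v r ^^ n) 1)) \<in> ?G" for n
    proof -
      have "dtransv a b (f n) = 0" using f(1) W by blast
      then obtain p where "f n = poly_in a b p" by (rule dtransv_ker[OF ab])
      then have "ev (f n) \<in> ?G" using ev_poly_in_mem[OF G g(1)] by simp
      then show ?thesis
        unfolding psi_smult psi_mult_v_pow psi_v by (intro GD(4) H.subalg_pow[OF G] g)
    qed
    note m = this
    have "finite J \<Longrightarrow> psi (\<Sum>n\<in>J. smult (f n) ((mult_v r ^^ n) 1)) \<in> ?G" for J
      by (induction J rule: finite_induct) (simp_all add: psi_add GD m)
    then have "psi (phi s) \<in> ?G" using f(2) by simp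
    then show "s \<in> ?G" using psi_phi H.subalgD(1)[OF S] s by auto
  qed
qed

lemma delta_lin_form:
  "delta (lin_form a b) = cst a * (cst l1 * xx - cst \<alpha> * yy) + cst b * (cst l2 * yy)"
  unfolding lin_form_def delta_add delta_mult delta_cst delta_xx delta_yy by simp

text \<open>As \<open>delta u\<close> is again a linear form, its transversal derivative is a
  scalar, namely the determinant of the coefficients of u and \<open>delta u\<close>. It vanishes
  exactly if u is an eigenvector of \<open>delta\<close>.\<close>

lemma dtransv_delta_lin_form: "dtransv a b (delta (lin_form a b)) = cst (a * (b * (l2 - l1) - \<alpha> * a))"
proof -
  have "dtransv a b (delta (lin_form a b)) = cst a * (cst l1 * - cst b - cst \<alpha> * cst a) + cst b * (cst l2 * cst a)"
    by (simp only: delta_lin_form dtransv_simps mult_zero_left add_0_left)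
  then show ?thesis by (simp add: algebra_simps)
qed

text \<open>The normalisation in \<open>bipoly_stable_cases\<close> decides the family: a = 0 leads
  to the planes over y, and a = 1 to those over x + by, where the eigenvector condition forces b = 0
  if l1 and l2 differ and \<alpha> = 0 if they agree.\<close>

lemma coideal_cases:
  assumes hyp: "l1 \<noteq> l2 \<Longrightarrow> \<alpha> = 0" and S: "right_coideal_subalg H \<Delta> S"
  obtains "S = scalars H" | "S = carrier H"
    | a b where "(a, b) \<noteq> (0, 0)" "S = alg_gen H {a \<odot>\<^bsub>H\<^esub> X \<oplus>\<^bsub>H\<^esub> b \<odot>\<^bsub>H\<^esub> Y}"
    | "S = alg_gen H {Y, X}"
    | c where "S = alg_gen H {Y, Z \<oplus>\<^bsub>H\<^esub> c \<odot>\<^bsub>H\<^esub> X \<ominus>\<^bsub>H\<^esub> Y \<otimes>\<^bsub>H\<^esub> X}"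
    | b where "l1 \<noteq> l2" "S = alg_gen H {X, Z \<oplus>\<^bsub>H\<^esub> b \<odot>\<^bsub>H\<^esub> Y \<oplus>\<^bsub>H\<^esub> Y \<otimes>\<^bsub>H\<^esub> X}"
    | a b where "l1 = l2" "\<alpha> = 0"
      "S = alg_gen H {X \<oplus>\<^bsub>H\<^esub> a \<odot>\<^bsub>H\<^esub> Y, Z \<oplus>\<^bsub>H\<^esub> b \<odot>\<^bsub>H\<^esub> Y \<oplus>\<^bsub>H\<^esub> a \<odot>\<^bsub>H\<^esub> (Y [^]\<^bsub>H\<^esub> (2::nat)) \<oplus>\<^bsub>H\<^esub> Y \<otimes>\<^bsub>H\<^esub> X}"
proof -
  note goals = that
  have sub: "subalg S H" using S by (simp add: right_coideal_subalg_def)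
  note sD = H.subalgD[OF sub]
  define V where "V = phi ` S"
  have V: "coid V" unfolding V_def by (rule coid_phi[OF S])
  note Vc = V[unfolded coid_def]
  have mem: "q \<in> V \<longleftrightarrow> psi q \<in> S" for q unfolding V_def by (rule mem_phi_image[OF sub])
  have cst_mem: "[:cst c:] \<in> V" for c
    unfolding mem psi_const ev_cst using sD(2,5) by simp
  have sphi: "\<exists>q. q \<in> V \<and> s = psi q" if "s \<in> S" for s
    using that sD(1) psi_phi[of s] unfolding V_def by (intro exI[of _ "phi s"]) auto
  define W where "W = {r. [:r:] \<in> V}"
  have W: "r \<in> W \<longleftrightarrow> ev r \<in> S" for r by (simp add: W_def mem psi_const)
  have Wst: "cst c \<in> W" "r \<in> W \<Longrightarrow> s \<in> W \<Longrightarrow> r + s \<in> W" "r \<in> W \<Longrightarrow> s \<in> W \<Longrightarrow> r * s \<in> W" for c r s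
    using cst_mem sD unfolding W by (simp_all only: ev_cst P.e_add ev_mult)
  have Wd: "dx r \<in> W \<and> dy r \<in> W" if "r \<in> W" for r
  proof -
    have "dX [:r:] \<in> V" "dY [:r:] \<in> V" using Vc that unfolding W_def by blast+
    then show ?thesis unfolding d_const W_def by simp
  qed
  consider (const) "W = range cst" | (line) a b where "a = 0 \<and> b = 1 \<or> a = 1" "W = {r. dtransv a b r = 0}" | (all) "W = UNIV"
    by (rule bipoly_stable_cases[OF Wst Wd]) blast+
  note cs = this
  show thesis
  proof (cases "V \<subseteq> range (\<lambda>r. [:r:])")
    case True
    have Sev: "\<exists>r\<in>W. s = ev r" if "s \<in> S" for s
    proof -
      from sphi[OF that] obtain q where q: "q \<in> V" "s = psi q" by blast
      then obtain r where "q = [:r:]" using True by blast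
      then show ?thesis using q by (intro bexI[of _ r]) (simp_all add: psi_const W_def)
    qed
    from cs show thesis
    proof cases
      case const
      have "S = scalars H"
      proof
        show "S \<subseteq> scalars H"
        proof
          fix s assume "s \<in> S"
          then obtain r where "r \<in> W" "s = ev r" using Sev by blast
          moreover from this obtain c where "r = cst c" using const by blast
          ultimately have "s = c \<odot>\<^bsub>H\<^esub> \<one>\<^bsub>H\<^esub>" by (simp only: ev_cst)
          then show "s \<in> scalars H" by (simp add: scalars_def)
        qed
      qed (rule H.scalars_subset[OF sub])
      then show thesis by (rule goals(1))
    next
      case (line a b)
      have ab: "(a, b) \<noteq> (0, 0)" using line(1) by auto
      have "S = alg_gen H {ev (lin_form a b)}" (is "S = ?G")
      proof
        have "lin_form a b \<in> W" using line(2) dtransv_simps(7)[of a b] by blast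
        then show "?G \<subseteq> S" by (intro H.alg_gen_least[OF sub]) (simp add: W)
        have G: "subalg ?G H" by (rule H.subalg_alg_gen) simp
        have g: "ev (lin_form a b) \<in> ?G" by (rule subsetD[OF H.alg_gen_superset]) simp
        show "S \<subseteq> ?G"
        proof
          fix s assume "s \<in> S"
          then obtain r where r: "r \<in> W" "s = ev r" using Sev by blast
          then have "dtransv a b r = 0" using line(2) by blast
          then obtain p where "r = poly_in a b p" by (rule dtransv_ker[OF ab])
          then show "s \<in> ?G" using ev_poly_in_mem[OF G g] r(2) by simp
        qed
      qed
      then show thesis unfolding ev_lin_form by (rule goals(3)[OF ab])
    next
      case all
      have "S = alg_gen H {Y, X}" (is "S = ?G")
      proof
        have "xx \<in> W" "yy \<in> W" using all by blast+
        then show "?G \<subseteq> S" unfolding W ev_gens by (intro H.alg_gen_least[OF sub]) simp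
        have G: "subalg ?G H" by (rule H.subalg_alg_gen) simp
        have "X \<in> ?G" "Y \<in> ?G" by (rule subsetD[OF H.alg_gen_superset], simp)+
        then show "S \<subseteq> ?G" using Sev ev_mem[OF G] by blast
      qed
      then show thesis by (rule goals(4))
    qed
  next
    case False
    let ?K = "range (\<lambda>r. [:r:] :: 'k pbw)"
    obtain q0 where "q0 \<in> V" "q0 \<notin> ?K" using False by blast
    moreover have "dX q \<in> V \<and> dY q \<in> V \<and> pderiv q \<in> V" if "q \<in> V" for q using Vc that by blast
    moreover have K0: "0 \<in> ?K" by (rule range_eqI[of _ _ 0]) simp
    ultimately obtain s where s: "s \<in> V" "s \<notin> ?K" "dX s \<in> ?K" "dY s \<in> ?K" "pderiv s \<in> ?K"
      using minimal_outside[of V q0 ?K] by metis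
    \<comment> \<open>The z-derivative of s is constant in z, so in characteristic zero s has degree
      at most 1 in z.\<close>
    have "coeff s (Suc (Suc n)) = 0" for n
    proof -
      obtain r where "pderiv s = [:r:]" using s(5) by blast
      then have "coeff (pderiv s) (Suc n) = 0" by simp
      then have "of_nat (Suc (Suc n)) * coeff s (Suc (Suc n)) = 0" by (simp only: coeff_pderiv)
      then show ?thesis by (simp only: mult_eq_0_iff of_nat_eq_0_iff) simp
    qed
    then have s2: "s = [:coeff s 0, coeff s 1:]"
      by (intro poly_eqI) (auto simp: coeff_pCons split: nat.split)
    define r0 r1 where "r0 = coeff s 0" "r1 = coeff s 1"
    have sr: "s = [:r0:] + smult r1 [:0, 1:]" using s2 by (simp add: r0_r1_def)
    have z: "[:0, 1:] = Zop 1" using Zop_const[of "cst 1"] by (simp add: one_pCons)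
    have d1: "dX 1 = 0" "dY 1 = 0" using dX(4)[of 1] dY(4)[of 1] by (simp_all flip: one_pCons)
    have Z0: "Zop 0 = 0" by (simp add: Zop_def)
    have dz: "dX [:0, 1:] = - [:yy:]" "dY [:0, 1:] = [:xx:]"
      unfolding z dX dY d1 Z0 by simp_all
    have dXs: "dX s = [:dx r0 - r1 * yy, dx r1:]" and dYs: "dY s = [:dy r0 + r1 * xx, dy r1:]"
      unfolding sr D_add[OF functional_c(2)] D_add[OF functional_c(3)] dX_smult dY_smult d_const dz
      using smult_minus_left[of "[:0, 1:]" r1] by simp_all
    \<comment> \<open>The coefficients of z in \<open>dX s\<close> and \<open>dY s\<close> are
      \<open>dx r1\<close> and \<open>dy r1\<close>; they vanish since both images are free of z. So
      r1 is a scalar, and it is not 0 because s involves z.\<close>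
    have "dx r1 = 0" "dy r1 = 0" using s(3,4) unfolding dXs dYs by auto
    then obtain c where c: "r1 = cst c" by (rule const_if_derivs_0)
    have c0: "c \<noteq> 0"
    proof
      assume "c = 0"
      then have "s = [:r0:]" using sr c by simp
      then show False using s(2) by blast
    qed
    define w0 where "w0 = cst (1 / c) * r0"
    have "pbw_scale (1 / c) s \<in> V" using Vc s(1) by blast
    also have "pbw_scale (1 / c) s = [:w0, 1:]" unfolding sr c w0_def using c0 by (simp flip: one_pCons)
    finally have v: "[:w0, 1:] \<in> V" .
    have w0s: "[:w0, 1:] = [:w0:] + [:0, 1:]" by simp
    have "dX [:w0, 1:] \<in> V" "dY [:w0, 1:] \<in> V" using Vc v by blast+
    then have p: "dx w0 - yy \<in> W" "dy w0 + xx \<in> W"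
      unfolding w0s D_add[OF functional_c(2)] D_add[OF functional_c(3)] d_const dz W_def
      by (simp_all only: add_uminus_conv_diff diff_pCons add_pCons add_0_right diff_self mem_Collect_eq)
    from cs show thesis
    proof cases
      case const
      obtain c d where cd: "dx w0 - yy = cst c" "dy w0 + xx = cst d" using p const by blast
      \<comment> \<open>The two mixed second derivatives of w0 would be 1 and -1.\<close>
      have "dy (dx w0 - yy) = 0" "dx (dy w0 + xx) = 0" unfolding cd d_simps by simp_all
      then have "dy (dx w0) = 1" "dy (dx w0) = - 1"
        unfolding d_simps dx_dy by (simp_all add: add_eq_0_iff2)
      then show thesis by (simp flip: one_pCons)
    next
      case all
      have "[:w0:] \<in> V" using all unfolding W_def by blast
      then have "[:w0, 1:] - [:w0:] \<in> V" using coid_diff[OF V v] by blast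
      then have "psi [:0, 1:] \<in> S" by (simp add: mem)
      then have "Z \<in> S" unfolding psi_v by simp
      moreover have "xx \<in> W" "yy \<in> W" using all by blast+
      ultimately have "alg_gen H {X, Y, Z} \<subseteq> S"
        unfolding W ev_gens by (intro H.alg_gen_least[OF sub]) simp
      then have "S = carrier H" using H_generated sD(1) by simp
      then show thesis by (rule goals(2))
    next
      case (line a b)
      have ab: "(a, b) \<noteq> (0, 0)" using line(1) by auto
      have WV: "{r. [:r:] \<in> phi ` S} = {r. dtransv a b r = 0}" using line(2) unfolding W_def V_def .
      let ?u = "lin_form a b"
      define w where "w = (if a = 1 then yy else cst (-1) * xx :: 'k bipoly)"
      have w: "dtransv a b w = cst 1"
        using line(1) unfolding w_def by (auto simp: dtransv_simps simp del: mult_pCons_left mult_pCons_right) simp_all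
      have "dtransv a b (dx w0 - yy) = 0" "dtransv a b (dy w0 + xx) = 0" using p line(2) by blast+
      then have e: "dx (dtransv a b w0) = cst a" "dy (dtransv a b w0) = cst b"
        unfolding dtransv_simps dtransv_comm by (simp_all only: add_uminus_conv_diff right_minus_eq)
      have "dx (dtransv a b w0 - ?u) = 0" "dy (dtransv a b w0 - ?u) = 0"
        unfolding pderiv_diff dy_diff e d_lin_form by simp_all
      then obtain k where "dtransv a b w0 - ?u = cst k" by (rule const_if_derivs_0)
      then have k: "dtransv a b w0 = ?u + cst k" by (simp add: algebra_simps)
      \<comment> \<open>Since u has transversal derivative 0 and w has 1, the derivatives of r and
        w0 agree. Thus w0 - r lies in S and may be subtracted.\<close>
      define r where "r = (?u + cst k) * w"
      have "dtransv a b (w0 - r) = 0"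
        unfolding r_def dtransv_simps k w by (simp flip: one_pCons)
      then have "[:w0 - r:] \<in> V" using line(2) unfolding W_def by blast
      then have "[:w0, 1:] - [:w0 - r:] \<in> V" by (rule coid_diff[OF V v])
      then have vr: "[:r, 1:] \<in> V" by simp
      have uV: "[:?u:] \<in> V" using line(2) dtransv_simps(7)[of a b] unfolding W_def by blast
      \<comment> \<open>The commutator of \<open>z + r\<close> and \<open>u\<close> is \<open>delta u\<close>.\<close>
      have "mult_v r [:?u:] - smult ?u [:r, 1:] \<in> V"
        using Vc vr uV by (intro coid_diff[OF V]) blast+
      also have "mult_v r [:?u:] - smult ?u [:r, 1:] = [:delta ?u:]"
        by (simp add: mult_v_def Zop_const mult.commute)
      finally have "dtransv a b (delta ?u) = 0" using line(2) unfolding W_def by blast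
      then have con: "a * (b * (l2 - l1) - \<alpha> * a) = 0" unfolding dtransv_delta_lin_form by simp
      have Seq: "S = alg_gen H {ev ?u, ev r \<oplus>\<^bsub>H\<^esub> Z}"
        using ore_generated[OF sub V[unfolded V_def] ab WV vr[unfolded V_def]] .
      show thesis
      proof (cases "a = 1")
        case True
        \<comment> \<open>Here w = y, and r = (x + by + k) y expands to ky + by^2 + yx.\<close>
        have u: "ev ?u = X \<oplus>\<^bsub>H\<^esub> b \<odot>\<^bsub>H\<^esub> Y" by (simp add: ev_lin_form True)
        have er: "ev r \<oplus>\<^bsub>H\<^esub> Z = Z \<oplus>\<^bsub>H\<^esub> k \<odot>\<^bsub>H\<^esub> Y \<oplus>\<^bsub>H\<^esub> b \<odot>\<^bsub>H\<^esub> (Y [^]\<^bsub>H\<^esub> (2::nat)) \<oplus>\<^bsub>H\<^esub> Y \<otimes>\<^bsub>H\<^esub> X"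
          unfolding r_def ev_mult P.e_add u ev_cst using True
          by (simp add: w_def ev_gens H.l_distr H.smult_mult_left numeral_2_eq_2 relations(1) H.a_ac)
        show thesis
        proof (cases "l1 = l2")
          case eq: True
          then have "\<alpha> = 0" using con True by simp
          then show thesis using goals(7)[OF eq, of b k] Seq unfolding u er by blast
        next
          case neq: False
          then have "b = 0" using con True hyp by simp
          then have "S = alg_gen H {X, Z \<oplus>\<^bsub>H\<^esub> k \<odot>\<^bsub>H\<^esub> Y \<oplus>\<^bsub>H\<^esub> Y \<otimes>\<^bsub>H\<^esub> X}"
            using Seq unfolding u er by simp
          then show thesis by (rule goals(6)[OF neq])
        qed
      next
        case False
        \<comment> \<open>Here w = -x, and r = -(y + k) x, so the parameter c of the family is
          -k.\<close>
        then have a0: "a = 0" "b = 1" using line(1) by auto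
        have u: "ev ?u = Y" by (simp add: ev_lin_form a0)
        have "ev r = (Y \<oplus>\<^bsub>H\<^esub> k \<odot>\<^bsub>H\<^esub> \<one>\<^bsub>H\<^esub>) \<otimes>\<^bsub>H\<^esub> ((- 1) \<odot>\<^bsub>H\<^esub> X)"
          unfolding r_def ev_mult P.e_add u ev_cst using False
          by (simp add: w_def ev_mult ev_cst ev_gens H.smult_mult_left del: mult_pCons_left mult_pCons_right)
        also have "\<dots> = (- k) \<odot>\<^bsub>H\<^esub> X \<oplus>\<^bsub>H\<^esub> (- 1) \<odot>\<^bsub>H\<^esub> (Y \<otimes>\<^bsub>H\<^esub> X)"
          by (simp add: H.l_distr H.smult_mult_left H.smult_mult_right H.smult_smult H.smult_add_right H.a_comm)
        also have "\<dots> = (- k) \<odot>\<^bsub>H\<^esub> X \<ominus>\<^bsub>H\<^esub> Y \<otimes>\<^bsub>H\<^esub> X"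
          by (simp add: a_minus_def H.smult_minus_1)
        finally have er: "ev r \<oplus>\<^bsub>H\<^esub> Z = Z \<oplus>\<^bsub>H\<^esub> (- k) \<odot>\<^bsub>H\<^esub> X \<ominus>\<^bsub>H\<^esub> Y \<otimes>\<^bsub>H\<^esub> X"
          by (simp add: a_minus_def H.a_ac)
        show thesis using Seq unfolding u er by (rule goals(5))
      qed
    qed
  qed
qed

end

text \<open>The pure tensors occurring in \<open>\<Delta> v\<close> are replaced by variables, so that \<open>algebra\<close> treats them as atoms.\<close>

lemma (in ring) comult_cancel:
  assumes "zE \<in> carrier R" "eZ \<in> carrier R" "p \<in> carrier R" "q \<in> carrier R" "bE \<in> carrier R" "eB \<in> carrier R"
    "sE \<in> carrier R" "s \<in> carrier R" "eS \<in> carrier R" "dE \<in> carrier R" "eD \<in> carrier R"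
  shows "(zE \<oplus> eZ \<oplus> p \<ominus> q) \<oplus> (bE \<oplus> eB) \<ominus> (dE \<oplus> q \<oplus> p \<oplus> eD)
      = (zE \<oplus> bE \<ominus> dE) \<oplus> (eZ \<oplus> eB \<ominus> eD) \<ominus> (q \<oplus> q)"
    "(zE \<oplus> eZ \<oplus> p \<ominus> q) \<oplus> (bE \<oplus> eB) \<oplus> (sE \<oplus> s \<oplus> s \<oplus> eS) \<oplus> (dE \<oplus> q \<oplus> p \<oplus> eD)
      = (zE \<oplus> bE \<oplus> sE \<oplus> dE) \<oplus> (eZ \<oplus> eB \<oplus> eS \<oplus> eD) \<oplus> ((p \<oplus> s) \<oplus> (p \<oplus> s))"
  using assms by algebra+

section \<open>The converse: the listed subalgebras are right coideals\<close>

context ha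
begin

text \<open>\<Delta> is a homomorphism and the tensors with left factor in the subalgebra form a
  subalgebra, so the condition propagates from generators.\<close>

lemma right_coideal_alg_gen:
  assumes U: "U \<subseteq> carrier H" and D: "\<And>u. u \<in> U \<Longrightarrow> \<Delta> u \<in> HH.span_left (alg_gen H U)"
  shows "right_coideal_subalg H \<Delta> (alg_gen H U)"
proof -
  let ?G = "alg_gen H U"
  have G: "subalg ?G H" by (rule H.subalg_alg_gen[OF U])
  note L = HH.T.subalgD[OF HH.subalg_span_left[OF G]]
  have "\<Delta> x \<in> HH.span_left ?G" if "x \<in> ?G" for x
    using that U
  proof (induction rule: H.alg_gen_induct)
    case one
    then show ?case unfolding comult_simps(4) by (rule L(2))
  next
    case (add x y)
    show ?case unfolding comult_simps(3)[OF add(1,2)] by (rule L(3)[OF add(3,4)])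
  next
    case (mult x y)
    show ?case unfolding comult_simps(2)[OF mult(1,2)] by (rule L(4)[OF mult(3,4)])
  next
    case (smult c x)
    show ?case unfolding comult_simps(5)[OF smult(1)] by (rule L(5)[OF smult(2)])
  qed (rule D)
  then have "\<Delta> ` ?G \<subseteq> HH.span_left ?G" by (rule image_subsetI)
  then show ?thesis unfolding right_coideal_subalg_def using G by (intro conjI)
qed

lemma pt_in_span_left:
  assumes "a \<in> S" "h \<in> carrier H" shows "pt a h \<in> HH.span_left S"
  by (rule subsetD[OF HH.T.lin_span_superset], rule CollectI, rule exI[of _ a], rule exI[of _ h],
      rule conjI, rule refl, rule conjI, rule assms(1), rule assms(2))

lemma right_coideal_scalars: "right_coideal_subalg H \<Delta> (scalars H)"
proof -
  note S = H.scalars_subalg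
  note L = HH.T.subalgD[OF HH.subalg_span_left[OF S]]
  have "\<Delta> x \<in> HH.span_left (scalars H)" if "x \<in> scalars H" for x
  proof -
    obtain c where x: "x = c \<odot>\<^bsub>H\<^esub> e" using \<open>x \<in> scalars H\<close> unfolding scalars_def by (rule rangeE)
    show ?thesis unfolding x comult_simps(5)[OF H.one_closed] comult_simps(4) by (intro L)
  qed
  then have "\<Delta> ` scalars H \<subseteq> HH.span_left (scalars H)" by (rule image_subsetI)
  then show ?thesis unfolding right_coideal_subalg_def using S by (intro conjI)
qed

lemma right_coideal_carrier: "right_coideal_subalg H \<Delta> (carrier H)"
proof -
  note S = H.subalg_carrier
  note L = HH.T.subalgD[OF HH.subalg_span_left[OF S]]
  have "t \<in> HH.span_left (carrier H)" if "t \<in> carrier TT" for t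
    using that
  proof (induction rule: HH.tensor_induct)
    case (add x y)
    then show ?case by (intro L)
  next
    case (smult c x)
    then show ?case by (intro L)
  qed (rule pt_in_span_left)
  then have "\<Delta> ` carrier H \<subseteq> HH.span_left (carrier H)"
    by (intro image_subsetI) (simp add: comult_simps(1))
  then show ?thesis unfolding right_coideal_subalg_def using S by (intro conjI)
qed

lemma comult_diff: "x \<in> carrier H \<Longrightarrow> y \<in> carrier H \<Longrightarrow> \<Delta> (x \<ominus>\<^bsub>H\<^esub> y) = \<Delta> x \<ominus>\<^bsub>TT\<^esub> \<Delta> y"
  unfolding a_minus_def by (simp add: comult_simps flip: H.smult_minus_1 HH.T.smult_minus_1)

lemma pt_diff_left: "a \<in> carrier H \<Longrightarrow> b \<in> carrier H \<Longrightarrow> h \<in> carrier H \<Longrightarrow> pt (a \<ominus>\<^bsub>H\<^esub> b) h = pt a h \<ominus>\<^bsub>TT\<^esub> pt b h"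
  unfolding a_minus_def by (simp add: HH.pt_add_left HH.pt_smult flip: H.smult_minus_1 HH.T.smult_minus_1)

lemma pt_diff_right: "a \<in> carrier H \<Longrightarrow> b \<in> carrier H \<Longrightarrow> h \<in> carrier H \<Longrightarrow> pt h (a \<ominus>\<^bsub>H\<^esub> b) = pt h a \<ominus>\<^bsub>TT\<^esub> pt h b"
  unfolding a_minus_def by (simp add: HH.pt_add_right HH.pt_smult flip: H.smult_minus_1 HH.T.smult_minus_1)

lemma DZ_alt: "DZ = pt Z e \<oplus>\<^bsub>TT\<^esub> pt e Z \<oplus>\<^bsub>TT\<^esub> pt X Y \<ominus>\<^bsub>TT\<^esub> pt Y X"
  by (simp add: DZ_def a_minus_def HH.T.smult_minus_1)

lemma comult_lin: "\<Delta> (a \<odot>\<^bsub>H\<^esub> X \<oplus>\<^bsub>H\<^esub> b \<odot>\<^bsub>H\<^esub> Y)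
   = pt (a \<odot>\<^bsub>H\<^esub> X \<oplus>\<^bsub>H\<^esub> b \<odot>\<^bsub>H\<^esub> Y) e \<oplus>\<^bsub>TT\<^esub> pt e (a \<odot>\<^bsub>H\<^esub> X \<oplus>\<^bsub>H\<^esub> b \<odot>\<^bsub>H\<^esub> Y)"
  by (simp add: comult_simps comult DX_def DY_def HH.pt_add_left HH.pt_add_right HH.pt_smult HH.T.smult_add_right HH.T.a_ac)

lemma right_coideal_line: "right_coideal_subalg H \<Delta> (alg_gen H {a \<odot>\<^bsub>H\<^esub> X \<oplus>\<^bsub>H\<^esub> b \<odot>\<^bsub>H\<^esub> Y})" (is "right_coideal_subalg H \<Delta> (alg_gen H {?l})")
proof (rule right_coideal_alg_gen)
  have G: "subalg (alg_gen H {?l}) H" by (rule H.subalg_alg_gen) simp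
  note L = HH.T.subalgD[OF HH.subalg_span_left[OF G]]
  have l: "?l \<in> alg_gen H {?l}" by (rule subsetD[OF H.alg_gen_superset]) simp
  fix u assume "u \<in> {?l}"
  then have u: "u = ?l" by simp
  show "\<Delta> u \<in> HH.span_left (alg_gen H {?l})"
    unfolding u comult_lin by (rule L(3); rule pt_in_span_left) (simp_all add: l H.subalgD(2)[OF G])
qed simp

lemma right_coideal_XY: "right_coideal_subalg H \<Delta> (alg_gen H {Y, X})"
proof (rule right_coideal_alg_gen)
  have G: "subalg (alg_gen H {Y, X}) H" by (rule H.subalg_alg_gen) simp
  note L = HH.T.subalgD[OF HH.subalg_span_left[OF G]]
  have l: "X \<in> alg_gen H {Y, X}" "Y \<in> alg_gen H {Y, X}" by (rule subsetD[OF H.alg_gen_superset], simp)+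
  have "\<Delta> X \<in> HH.span_left (alg_gen H {Y, X})" "\<Delta> Y \<in> HH.span_left (alg_gen H {Y, X})"
    unfolding comult DX_def DY_def by (rule L(3); rule pt_in_span_left; simp add: l H.subalgD(2)[OF G])+
  then show "\<Delta> u \<in> HH.span_left (alg_gen H {Y, X})" if "u \<in> {Y, X}" for u
    using that by (elim insertE) simp_all
qed simp

text \<open>The cross terms of \<Delta>(YX) are Y \<otimes> X + X \<otimes> Y. Subtracting them
  cancels X \<otimes> Y in \<Delta>(Z) and leaves -2 Y \<otimes> X, whose left factor is allowed.
  The summand cX is primitive and adds no cross term.\<close>

lemma right_coideal_YZ:
  "right_coideal_subalg H \<Delta> (alg_gen H {Y, Z \<oplus>\<^bsub>H\<^esub> c \<odot>\<^bsub>H\<^esub> X \<ominus>\<^bsub>H\<^esub> Y \<otimes>\<^bsub>H\<^esub> X})" (is "right_coideal_subalg H \<Delta> (alg_gen H {Y, ?v})")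
proof (rule right_coideal_alg_gen)
  have G: "subalg (alg_gen H {Y, ?v}) H" by (rule H.subalg_alg_gen) simp
  note L = HH.T.subalgD[OF HH.subalg_span_left[OF G]]
  have l: "Y \<in> alg_gen H {Y, ?v}" "?v \<in> alg_gen H {Y, ?v}" by (rule subsetD[OF H.alg_gen_superset], simp)+
  have "\<Delta> ?v = (pt Z e \<oplus>\<^bsub>TT\<^esub> pt e Z \<oplus>\<^bsub>TT\<^esub> pt X Y \<ominus>\<^bsub>TT\<^esub> pt Y X) \<oplus>\<^bsub>TT\<^esub> (pt (c \<odot>\<^bsub>H\<^esub> X) e \<oplus>\<^bsub>TT\<^esub> pt e (c \<odot>\<^bsub>H\<^esub> X))
     \<ominus>\<^bsub>TT\<^esub> (pt (Y \<otimes>\<^bsub>H\<^esub> X) e \<oplus>\<^bsub>TT\<^esub> pt Y X \<oplus>\<^bsub>TT\<^esub> pt X Y \<oplus>\<^bsub>TT\<^esub> pt e (Y \<otimes>\<^bsub>H\<^esub> X))"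
  proof -
    have "DY \<otimes>\<^bsub>TT\<^esub> DX = pt (Y \<otimes>\<^bsub>H\<^esub> X) e \<oplus>\<^bsub>TT\<^esub> pt Y X \<oplus>\<^bsub>TT\<^esub> pt X Y \<oplus>\<^bsub>TT\<^esub> pt e (Y \<otimes>\<^bsub>H\<^esub> X)"
      by (simp add: DX_def DY_def HH.T.l_distr HH.T.r_distr HH.pt_mult HH.T.a_ac)
    moreover have "c \<odot>\<^bsub>TT\<^esub> DX = pt (c \<odot>\<^bsub>H\<^esub> X) e \<oplus>\<^bsub>TT\<^esub> pt e (c \<odot>\<^bsub>H\<^esub> X)"
      by (simp add: DX_def HH.T.smult_add_right HH.pt_smult)
    ultimately show ?thesis
      by (simp add: comult_diff comult_simps comult DZ_alt)
  qed
  also have "\<dots> = pt ?v e \<oplus>\<^bsub>TT\<^esub> pt e ?v \<ominus>\<^bsub>TT\<^esub> (pt Y X \<oplus>\<^bsub>TT\<^esub> pt Y X)"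
    by (subst HH.T.comult_cancel(1)[where sE = "pt e e" and s = "pt e e" and eS = "pt e e"])
      (simp_all add: HH.pt_add_left HH.pt_add_right pt_diff_left pt_diff_right)
  finally have v: "\<Delta> ?v = pt ?v e \<oplus>\<^bsub>TT\<^esub> pt e ?v \<ominus>\<^bsub>TT\<^esub> (pt Y X \<oplus>\<^bsub>TT\<^esub> pt Y X)" .
  have "\<Delta> ?v \<in> HH.span_left (alg_gen H {Y, ?v})"
    unfolding v by (intro L(3) L(8) pt_in_span_left l H.subalgD(2)[OF G]) simp_all
  moreover have "\<Delta> Y \<in> HH.span_left (alg_gen H {Y, ?v})"
    unfolding comult DY_def by (intro L(3) pt_in_span_left l H.subalgD(2)[OF G]) simp_all
  ultimately show "\<Delta> u \<in> HH.span_left (alg_gen H {Y, ?v})" if "u \<in> {Y, ?v}" for u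
    using that by (elim insertE) simp_all
qed simp

text \<open>Adding YX cancels -Y \<otimes> X and doubles X \<otimes> Y. The square aY^2 contributes
  2a Y \<otimes> Y, which completes this to 2 u \<otimes> Y with u = X + aY.\<close>

lemma right_coideal_UZ:
  "right_coideal_subalg H \<Delta> (alg_gen H {X \<oplus>\<^bsub>H\<^esub> a \<odot>\<^bsub>H\<^esub> Y,
      Z \<oplus>\<^bsub>H\<^esub> b \<odot>\<^bsub>H\<^esub> Y \<oplus>\<^bsub>H\<^esub> a \<odot>\<^bsub>H\<^esub> (Y [^]\<^bsub>H\<^esub> (2::nat)) \<oplus>\<^bsub>H\<^esub> Y \<otimes>\<^bsub>H\<^esub> X})" (is "right_coideal_subalg H \<Delta> (alg_gen H {?u, ?v})")
proof (rule right_coideal_alg_gen)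
  let ?s = "a \<odot>\<^bsub>H\<^esub> (Y [^]\<^bsub>H\<^esub> (2::nat))"
  have G: "subalg (alg_gen H {?u, ?v}) H" by (rule H.subalg_alg_gen) simp
  note L = HH.T.subalgD[OF HH.subalg_span_left[OF G]]
  have l: "?u \<in> alg_gen H {?u, ?v}" "?v \<in> alg_gen H {?u, ?v}" by (rule subsetD[OF H.alg_gen_superset], simp)+
  have Y2: "Y [^]\<^bsub>H\<^esub> (2::nat) = Y \<otimes>\<^bsub>H\<^esub> Y" by (simp add: numeral_2_eq_2)
  have "\<Delta> ?v = (pt Z e \<oplus>\<^bsub>TT\<^esub> pt e Z \<oplus>\<^bsub>TT\<^esub> pt X Y \<ominus>\<^bsub>TT\<^esub> pt Y X) \<oplus>\<^bsub>TT\<^esub> (pt (b \<odot>\<^bsub>H\<^esub> Y) e \<oplus>\<^bsub>TT\<^esub> pt e (b \<odot>\<^bsub>H\<^esub> Y))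
     \<oplus>\<^bsub>TT\<^esub> (pt ?s e \<oplus>\<^bsub>TT\<^esub> pt (a \<odot>\<^bsub>H\<^esub> Y) Y \<oplus>\<^bsub>TT\<^esub> pt (a \<odot>\<^bsub>H\<^esub> Y) Y \<oplus>\<^bsub>TT\<^esub> pt e ?s)
     \<oplus>\<^bsub>TT\<^esub> (pt (Y \<otimes>\<^bsub>H\<^esub> X) e \<oplus>\<^bsub>TT\<^esub> pt Y X \<oplus>\<^bsub>TT\<^esub> pt X Y \<oplus>\<^bsub>TT\<^esub> pt e (Y \<otimes>\<^bsub>H\<^esub> X))"
  proof -
    have "DY \<otimes>\<^bsub>TT\<^esub> DX = pt (Y \<otimes>\<^bsub>H\<^esub> X) e \<oplus>\<^bsub>TT\<^esub> pt Y X \<oplus>\<^bsub>TT\<^esub> pt X Y \<oplus>\<^bsub>TT\<^esub> pt e (Y \<otimes>\<^bsub>H\<^esub> X)"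
      by (simp add: DX_def DY_def HH.T.l_distr HH.T.r_distr HH.pt_mult HH.T.a_ac)
    moreover have "b \<odot>\<^bsub>TT\<^esub> DY = pt (b \<odot>\<^bsub>H\<^esub> Y) e \<oplus>\<^bsub>TT\<^esub> pt e (b \<odot>\<^bsub>H\<^esub> Y)"
      by (simp add: DY_def HH.T.smult_add_right HH.pt_smult)
    moreover have "a \<odot>\<^bsub>TT\<^esub> (DY \<otimes>\<^bsub>TT\<^esub> DY) = pt ?s e \<oplus>\<^bsub>TT\<^esub> pt (a \<odot>\<^bsub>H\<^esub> Y) Y \<oplus>\<^bsub>TT\<^esub> pt (a \<odot>\<^bsub>H\<^esub> Y) Y \<oplus>\<^bsub>TT\<^esub> pt e ?s"
      unfolding Y2 by (simp add: DY_def HH.T.l_distr HH.T.r_distr HH.pt_mult HH.T.smult_add_right HH.pt_smult HH.T.a_ac)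
    ultimately show ?thesis
      unfolding Y2 by (simp add: comult_simps comult DZ_alt)
  qed
  also have "\<dots> = pt ?v e \<oplus>\<^bsub>TT\<^esub> pt e ?v \<oplus>\<^bsub>TT\<^esub> (pt ?u Y \<oplus>\<^bsub>TT\<^esub> pt ?u Y)"
    by (subst HH.T.comult_cancel(2)) (simp_all add: HH.pt_add_left HH.pt_add_right)
  finally have v: "\<Delta> ?v = pt ?v e \<oplus>\<^bsub>TT\<^esub> pt e ?v \<oplus>\<^bsub>TT\<^esub> (pt ?u Y \<oplus>\<^bsub>TT\<^esub> pt ?u Y)" .
  have "\<Delta> ?v \<in> HH.span_left (alg_gen H {?u, ?v})"
    unfolding v by (intro L(3) pt_in_span_left l H.subalgD(2)[OF G]) simp_all
  moreover have "\<Delta> ?u \<in> HH.span_left (alg_gen H {?u, ?v})"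
  proof -
    have u: "\<Delta> ?u = pt ?u e \<oplus>\<^bsub>TT\<^esub> pt e ?u" using comult_lin[of 1 a] by simp
    show ?thesis unfolding u by (intro L(3) pt_in_span_left l H.subalgD(2)[OF G]) simp_all
  qed
  ultimately show "\<Delta> x \<in> HH.span_left (alg_gen H {?u, ?v})" if "x \<in> {?u, ?v}" for x
    using that by (elim insertE) simp_all
qed simp

end

section \<open>Ore extensions and GK-dimension\<close>

context kalg
begin

text \<open>Left independence of the powers of v over R, stated for initial segments of exponents;
  \<open>finsum_support\<close> relates these to the sums over supports in
  \<open>is_ore_extension\<close>.\<close>

definition free_powers :: "'a set \<Rightarrow> 'a \<Rightarrow> bool" where
  "free_powers R v \<longleftrightarrow> (\<forall>N f. (\<forall>n. f n \<in> R) \<longrightarrow> (\<Oplus>n\<in>{..N}. f n \<otimes> v [^] (n::nat)) = \<zero> \<longrightarrow> (\<forall>n\<le>N. f n = \<zero>))"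

lemma finsum_support:
  assumes R: "subalg R A" and v: "v \<in> carrier A" and f: "range f \<subseteq> R" and N: "\<And>n. f n \<noteq> \<zero> \<Longrightarrow> n \<le> N"
  shows "(\<Oplus>n\<in>{n. f n \<noteq> \<zero>}. f n \<otimes> v [^] (n::nat)) = (\<Oplus>n\<in>{..N}. f n \<otimes> v [^] n)"
proof -
  have "f n \<in> carrier A" for n using f subalgD(1)[OF R] by blast
  then show ?thesis
    using v N by (intro add.finprod_mono_neutral_cong_left) (auto simp: Pi_def)
qed

text \<open>The span of the products r v^n is stable under left multiplication by R and, because v r
  = r v + [v, r], by v. Its left stabiliser is a subalgebra, so it contains the generated algebra;
  apply it to 1.\<close>

lemma ore_elements:
  assumes R: "subalg R A" and v: "v \<in> carrier A"
    and comm: "\<And>r. r \<in> R \<Longrightarrow> v \<otimes> r \<ominus> r \<otimes> v \<in> R" and s: "s \<in> alg_gen A (insert v R)"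
  shows "\<exists>f N. (\<forall>n. f n \<in> R) \<and> (\<forall>n>N. f n = \<zero>) \<and> s = (\<Oplus>n\<in>{..N}. f n \<otimes> v [^] (n::nat))"
proof -
  note RD = subalgD[OF R]
  have RA: "r \<in> R \<Longrightarrow> r \<in> carrier A" for r using RD(1) by blast
  let ?B = "{r \<otimes> v [^] (n::nat) | r n. r \<in> R}"
  have B: "?B \<subseteq> carrier A" using RA v by auto
  note Q = lin_subspaceD[OF lin_subspace_lin_span[OF B]]
  have baseQ: "r \<otimes> v [^] n \<in> lin_span A ?B" if "r \<in> R" for r and n :: nat
    using that by (intro subsetD[OF lin_span_superset]) blast
  let ?L = "{x \<in> carrier A. \<forall>q \<in> lin_span A ?B. x \<otimes> q \<in> lin_span A ?B}"
  have QA: "q \<in> carrier A" if "q \<in> lin_span A ?B" for q using Q(1) that by blast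
  have "subalg ?L A"
  proof (rule subalgI)
    show "\<one> \<in> ?L" using QA by simp
    show "x \<oplus> y \<in> ?L" if "x \<in> ?L" "y \<in> ?L" for x y using that QA Q(3) by (simp add: l_distr)
    show "x \<otimes> y \<in> ?L" if "x \<in> ?L" "y \<in> ?L" for x y using that QA by (simp add: m_assoc)
    show "c \<odot> x \<in> ?L" if "x \<in> ?L" for c x using that QA Q(4) by (simp add: smult_mult_left)
  qed blast
  moreover have "insert v R \<subseteq> ?L"
  proof -
    have lin: "x \<in> ?L" if x: "x \<in> carrier A" and b: "\<And>r n. r \<in> R \<Longrightarrow> x \<otimes> (r \<otimes> v [^] (n::nat)) \<in> lin_span A ?B" for x
    proof -
      have "x \<otimes> q \<in> lin_span A ?B" if "q \<in> lin_span A ?B" for q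
        using that B
      proof (induction rule: lin_span_induct)
        case zero
        then show ?case using x Q(2) by simp
      next
        case (add p q)
        then show ?case using x Q(3) by (simp add: r_distr)
      next
        case (smult c p)
        then show ?case using x Q(4) by (simp add: smult_mult_right)
      next
        case (base q)
        then show ?case using b by blast
      qed
      then show ?thesis using x by blast
    qed
    have "v \<in> ?L"
    proof (rule lin[OF v])
      fix r and n :: nat assume r: "r \<in> R"
      let ?d = "v \<otimes> r \<ominus> r \<otimes> v"
      have c: "r \<in> carrier A" "v [^] n \<in> carrier A" using RA[OF r] v by simp_all
      have "v \<otimes> r = r \<otimes> v \<oplus> ?d" using c v by algebra
      then have "v \<otimes> (r \<otimes> v [^] n) = (r \<otimes> v \<oplus> ?d) \<otimes> v [^] n" using c v by (simp flip: m_assoc)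
      also have "\<dots> = r \<otimes> v [^] Suc n \<oplus> ?d \<otimes> v [^] n"
        using c v nat_pow_Suc2[OF v, of n] by (simp add: l_distr m_assoc)
      finally have eq: "v \<otimes> (r \<otimes> v [^] n) = r \<otimes> v [^] Suc n \<oplus> ?d \<otimes> v [^] n" .
      show "v \<otimes> (r \<otimes> v [^] n) \<in> lin_span A ?B"
        unfolding eq by (rule Q(3)[OF baseQ[OF r] baseQ[OF comm[OF r]]])
    qed
    moreover have "r \<in> ?L" if "r \<in> R" for r
    proof (rule lin[OF RA[OF that]])
      fix t and n :: nat assume t: "t \<in> R"
      have "r \<otimes> (t \<otimes> v [^] n) = (r \<otimes> t) \<otimes> v [^] n" using RA that t v by (simp add: m_assoc)
      then show "r \<otimes> (t \<otimes> v [^] n) \<in> lin_span A ?B" using baseQ RD(4)[OF that t] by simp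
    qed
    ultimately show ?thesis by blast
  qed
  ultimately have "s \<in> ?L" using alg_gen_least s by blast
  moreover have "\<one> \<in> lin_span A ?B" using baseQ[OF RD(2), of 0] by simp
  ultimately have "s \<otimes> \<one> \<in> lin_span A ?B" "s \<in> carrier A" by blast+
  then have "s \<in> lin_span A ?B" by simp
  then show ?thesis using B
  proof (induction rule: lin_span_induct)
    case zero
    have "(\<Oplus>n\<in>{..0::nat}. \<zero> \<otimes> v [^] n) = \<zero>" using v by simp
    then show ?case using RD(6) by (intro exI[of _ "\<lambda>_. \<zero>"] exI[of _ 0]) simp
  next
    case (add x y)
    obtain f N where f: "\<forall>n. f n \<in> R" "\<forall>n>N. f n = \<zero>" "x = (\<Oplus>n\<in>{..N}. f n \<otimes> v [^] (n::nat))" using add by blast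
    obtain g M where g: "\<forall>n. g n \<in> R" "\<forall>n>M. g n = \<zero>" "y = (\<Oplus>n\<in>{..M}. g n \<otimes> v [^] (n::nat))" using add by blast
    have ext: "(\<Oplus>n\<in>{..L}. h n \<otimes> v [^] (n::nat)) = (\<Oplus>n\<in>{..K}. h n \<otimes> v [^] n)"
      if "\<forall>n. h n \<in> R" "\<forall>n>L. h n = \<zero>" "L \<le> K" for h L K
      using that v RA by (intro add.finprod_mono_neutral_cong_left) (auto simp: Pi_def)
    have "x \<oplus> y = (\<Oplus>n\<in>{..max N M}. f n \<otimes> v [^] n) \<oplus> (\<Oplus>n\<in>{..max N M}. g n \<otimes> v [^] n)"
      using ext[OF f(1,2), of "max N M"] ext[OF g(1,2), of "max N M"] f(3) g(3) by simp
    also have "\<dots> = (\<Oplus>n\<in>{..max N M}. f n \<otimes> v [^] n \<oplus> g n \<otimes> v [^] n)"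
      by (rule add.finprod_multf[symmetric]) (use f g RA v in \<open>auto simp: Pi_def\<close>)
    also have "\<dots> = (\<Oplus>n\<in>{..max N M}. (f n \<oplus> g n) \<otimes> v [^] n)"
      by (rule add.finprod_cong') (use f g RA v in \<open>auto simp: Pi_def l_distr\<close>)
    finally show ?case
      using f g RD(3,6) by (intro exI[of _ "\<lambda>n. f n \<oplus> g n"] exI[of _ "max N M"]) auto
  next
    case (smult c x)
    then obtain f N where f: "\<forall>n. f n \<in> R" "\<forall>n>N. f n = \<zero>" "x = (\<Oplus>n\<in>{..N}. f n \<otimes> v [^] (n::nat))" by blast
    have "c \<odot> x = (\<Oplus>n\<in>{..N}. c \<odot> (f n \<otimes> v [^] n))"
      unfolding f(3) by (rule smult_finsum) (use f RA v in auto)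
    also have "\<dots> = (\<Oplus>n\<in>{..N}. (c \<odot> f n) \<otimes> v [^] n)"
      by (rule add.finprod_cong') (use f RA v in \<open>auto simp: Pi_def smult_mult_left\<close>)
    finally show ?case
      using f RD(5) by (intro exI[of _ "\<lambda>n. c \<odot> f n"] exI[of _ N]) auto
  next
    case (base x)
    then obtain r n where x: "x = r \<otimes> v [^] (n::nat)" "r \<in> R" by blast
    have "(\<Oplus>k\<in>{..n}. (if k = n then r else \<zero>) \<otimes> v [^] k) = (\<Oplus>k\<in>{..n}. if n = k then r \<otimes> v [^] k else \<zero>)"
      using v RA[OF x(2)] by (intro add.finprod_cong') (auto simp: Pi_def)
    also have "\<dots> = x"
      using v RA[OF x(2)] add.finprod_singleton[of n "{..n}" "\<lambda>k. r \<otimes> v [^] k"] x(1) by (simp add: Pi_def)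
    finally show ?case
      using x(2) RD(6) by (intro exI[of _ "\<lambda>k. if k = n then r else \<zero>"] exI[of _ n]) auto
  qed
qed

text \<open>The derivation is the commutator with v. Existence of expansions is
  \<open>ore_elements\<close>, and uniqueness is freeness applied to the difference of two
  expansions.\<close>

lemma is_ore_extensionI:
  assumes R: "subalg R A" and v: "v \<in> carrier A"
    and comm: "\<And>r. r \<in> R \<Longrightarrow> v \<otimes> r \<ominus> r \<otimes> v \<in> R" and free: "free_powers R v"
  shows "is_ore_extension A R v (\<lambda>r. v \<otimes> r \<ominus> r \<otimes> v) (alg_gen A (insert v R))"
  unfolding is_ore_extension_def is_derivation_def
proof (intro conjI ballI allI)
  note RD = subalgD[OF R]
  have RA: "r \<in> R \<Longrightarrow> r \<in> carrier A" for r using RD(1) by blast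
  have U: "insert v R \<subseteq> carrier A" using v RD(1) by blast
  show "subalg R A" by fact
  show "subalg (alg_gen A (insert v R)) A" by (rule subalg_alg_gen[OF U])
  show "R \<subseteq> alg_gen A (insert v R)" "v \<in> alg_gen A (insert v R)"
    using alg_gen_superset[of "insert v R"] by blast+
  show "(\<lambda>r. v \<otimes> r \<ominus> r \<otimes> v) \<in> R \<rightarrow> R" using comm by blast
  show "v \<otimes> (r \<oplus> s) \<ominus> (r \<oplus> s) \<otimes> v = (v \<otimes> r \<ominus> r \<otimes> v) \<oplus> (v \<otimes> s \<ominus> s \<otimes> v)" if "r \<in> R" "s \<in> R" for r s
    using RA that v by algebra
  show "v \<otimes> (r \<otimes> s) \<ominus> (r \<otimes> s) \<otimes> v = (v \<otimes> r \<ominus> r \<otimes> v) \<otimes> s \<oplus> r \<otimes> (v \<otimes> s \<ominus> s \<otimes> v)" if "r \<in> R" "s \<in> R" for r s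
    using RA that v by algebra
  show "v \<otimes> r = r \<otimes> v \<oplus> (v \<otimes> r \<ominus> r \<otimes> v)" if "r \<in> R" for r
    using RA that v by algebra
  show "v \<otimes> (c \<odot> r) \<ominus> (c \<odot> r) \<otimes> v = c \<odot> (v \<otimes> r \<ominus> r \<otimes> v)" if "r \<in> R" for c r
    using RA[OF that] v smult_smult[of "r \<otimes> v" c "-1"] smult_smult[of "r \<otimes> v" "-1" c]
    by (simp add: smult_mult_left smult_mult_right a_minus_def smult_add_right flip: smult_minus_1)
  fix s assume s: "s \<in> alg_gen A (insert v R)"
  obtain f N where f: "\<forall>n. f n \<in> R" "\<forall>n>N. f n = \<zero>" "s = (\<Oplus>n\<in>{..N}. f n \<otimes> v [^] (n::nat))"
    using ore_elements[OF R v comm s] by blast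
  show "\<exists>!f :: nat \<Rightarrow> 'a. range f \<subseteq> R \<and> finite {n. f n \<noteq> \<zero>} \<and> s = (\<Oplus>n\<in>{n. f n \<noteq> \<zero>}. f n \<otimes> v [^] n)"
  proof (rule ex1I[of _ f])
    have b: "f n \<noteq> \<zero> \<Longrightarrow> n \<le> N" for n using f(2) not_less by blast
    have "{n. f n \<noteq> \<zero>} \<subseteq> {..N}" using b by blast
    then have fin: "finite {n. f n \<noteq> \<zero>}" by (rule finite_subset) simp
    have r: "range f \<subseteq> R" using f(1) by blast
    have fs: "s = (\<Oplus>n\<in>{n. f n \<noteq> \<zero>}. f n \<otimes> v [^] n)"
      by (rule trans[OF f(3) finsum_support[OF R v r b, symmetric]])
    with r fin show "range f \<subseteq> R \<and> finite {n. f n \<noteq> \<zero>} \<and> s = (\<Oplus>n\<in>{n. f n \<noteq> \<zero>}. f n \<otimes> v [^] n)"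
      by (intro conjI)
    fix g :: "nat \<Rightarrow> 'a"
    assume "range g \<subseteq> R \<and> finite {n. g n \<noteq> \<zero>} \<and> s = (\<Oplus>n\<in>{n. g n \<noteq> \<zero>}. g n \<otimes> v [^] n)"
    then have g: "range g \<subseteq> R" "finite {n. g n \<noteq> \<zero>}" "s = (\<Oplus>n\<in>{n. g n \<noteq> \<zero>}. g n \<otimes> v [^] n)"
      by blast+
    \<comment> \<open>A common bound for both supports, so that the two expansions can be subtracted
      term by term.\<close>
    define M where "M = Max (insert N {n. g n \<noteq> \<zero>})"
    have M: "N \<le> M" unfolding M_def using g(2) by (intro Max_ge) simp_all
    have gM': "n \<le> M" if "g n \<noteq> \<zero>" for n unfolding M_def using g(2) that by (intro Max_ge) simp_all
    have bM: "n \<le> M" if "f n \<noteq> \<zero>" for n using b[OF that] M by (rule order_trans)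
    have fM: "s = (\<Oplus>n\<in>{..M}. f n \<otimes> v [^] n)"
      by (rule trans[OF fs finsum_support[OF R v r bM]])
    have gM: "s = (\<Oplus>n\<in>{..M}. g n \<otimes> v [^] n)"
      by (rule trans[OF g(3) finsum_support[OF R v g(1) gM']])
    have gR: "g n \<in> R" for n using g(1) by blast
    have sA: "s \<in> carrier A" using s alg_gen_least[OF subalg_carrier U] by blast
    have "s \<oplus> (- 1) \<odot> s = (\<Oplus>n\<in>{..M}. f n \<otimes> v [^] n) \<oplus> (\<Oplus>n\<in>{..M}. (- 1) \<odot> (g n \<otimes> v [^] n))"
      by (subst fM, subst gM, subst smult_finsum) (use RA gR v in \<open>simp_all add: Pi_def\<close>)
    also have "\<dots> = (\<Oplus>n\<in>{..M}. f n \<otimes> v [^] n \<oplus> (- 1) \<odot> (g n \<otimes> v [^] n))"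
      by (rule add.finprod_multf[symmetric]) (use f gR RA v in \<open>auto simp: Pi_def\<close>)
    also have "\<dots> = (\<Oplus>n\<in>{..M}. (f n \<ominus> g n) \<otimes> v [^] n)"
      by (rule add.finprod_cong')
        (use f gR RA v in \<open>auto simp: Pi_def l_distr a_minus_def smult_mult_left simp flip: smult_minus_1\<close>)
    finally have "(\<Oplus>n\<in>{..M}. (f n \<ominus> g n) \<otimes> v [^] n) = \<zero>"
      using sA by (simp add: smult_minus_1 r_neg)
    moreover have "\<forall>n. f n \<ominus> g n \<in> R" using f(1) gR RD(8) by blast
    ultimately have "\<forall>n\<le>M. f n \<ominus> g n = \<zero>"
      using free[unfolded free_powers_def, rule_format, of "\<lambda>n. f n \<ominus> g n" M] by blast
    then have "g n = f n" if "n \<le> M" for n using that RA f(1) gR by (simp add: r_right_minus_eq)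
    moreover have "g n = f n" if "\<not> n \<le> M" for n using that gM' bM by metis
    ultimately show "g = f" by blast
  qed
qed

text \<open>The commutator with v is a derivation, so the polynomials in u that it sends to
  polynomials in u form a subalgebra. It suffices to look at u.\<close>

lemma is_iterated_oreI:
  assumes u: "u \<in> carrier A" and v: "v \<in> carrier A" and d: "v \<otimes> u \<ominus> u \<otimes> v = d" "d \<in> alg_gen A {u}"
    and p: "is_polynomial_alg A u (alg_gen A {u})" and free: "free_powers (alg_gen A {u}) v"
  shows "is_iterated_ore A u v d"
proof -
  let ?R = "alg_gen A {u}"
  have R: "subalg ?R A" using u by (intro subalg_alg_gen) simp
  note RD = subalgD[OF R]
  have comm: "v \<otimes> r \<ominus> r \<otimes> v \<in> ?R" if "r \<in> ?R" for r
  proof -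
    let ?S = "{r \<in> ?R. v \<otimes> r \<ominus> r \<otimes> v \<in> ?R}"
    have RA: "r \<in> ?R \<Longrightarrow> r \<in> carrier A" for r using RD(1) by blast
    have "subalg ?S A"
    proof (rule subalgI)
      show "?S \<subseteq> carrier A" using RA by blast
      have "v \<otimes> \<one> \<ominus> \<one> \<otimes> v = \<zero>" using v by (simp add: a_minus_def r_neg)
      then show "\<one> \<in> ?S" using RD(2,6) by simp
    next
      fix x y assume xy: "x \<in> ?S" "y \<in> ?S"
      then have c: "x \<in> carrier A" "y \<in> carrier A" using RA by blast+
      have "v \<otimes> (x \<oplus> y) \<ominus> (x \<oplus> y) \<otimes> v = (v \<otimes> x \<ominus> x \<otimes> v) \<oplus> (v \<otimes> y \<ominus> y \<otimes> v)"
        "v \<otimes> (x \<otimes> y) \<ominus> (x \<otimes> y) \<otimes> v = (v \<otimes> x \<ominus> x \<otimes> v) \<otimes> y \<oplus> x \<otimes> (v \<otimes> y \<ominus> y \<otimes> v)"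
        using c v by algebra+
      then show "x \<oplus> y \<in> ?S" "x \<otimes> y \<in> ?S" using xy RD(3,4) by simp_all
    next
      fix c x assume x: "x \<in> ?S"
      then have "x \<in> carrier A" using RA by blast
      then have "v \<otimes> (c \<odot> x) \<ominus> (c \<odot> x) \<otimes> v = c \<odot> (v \<otimes> x \<ominus> x \<otimes> v)"
        using v smult_smult[of "x \<otimes> v" c "-1"] smult_smult[of "x \<otimes> v" "-1" c]
        by (simp add: smult_mult_left smult_mult_right a_minus_def smult_add_right flip: smult_minus_1)
      then show "c \<odot> x \<in> ?S" using x RD(5) by simp
    qed
    moreover have "{u} \<subseteq> ?S" using d alg_gen_superset[of "{u}"] by simp
    ultimately show ?thesis using alg_gen_least that by blast
  qed
  have "alg_gen A (insert v ?R) = alg_gen A {u, v}"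
  proof
    have uv: "subalg (alg_gen A {u, v}) A" using u v by (intro subalg_alg_gen) simp
    have "?R \<subseteq> alg_gen A {u, v}" by (rule alg_gen_mono) simp
    moreover have "v \<in> alg_gen A {u, v}" using alg_gen_superset[of "{u, v}"] by simp
    ultimately show "alg_gen A (insert v ?R) \<subseteq> alg_gen A {u, v}" by (intro alg_gen_least[OF uv]) simp
    have "{u, v} \<subseteq> insert v ?R" using alg_gen_superset[of "{u}"] by simp
    then show "alg_gen A {u, v} \<subseteq> alg_gen A (insert v ?R)" by (rule alg_gen_mono)
  qed
  then show ?thesis
    using is_ore_extensionI[OF R v comm free] d(1) p unfolding is_iterated_ore_def by metis
qed

section \<open>Independent families and dimension over the scalars\<close>

definition lin_indep :: "('i \<Rightarrow> 'a) \<Rightarrow> 'i set \<Rightarrow> bool" where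
  "lin_indep b J \<longleftrightarrow> finite J \<and> b ` J \<subseteq> carrier A \<and>
     (\<forall>c. (\<Oplus>j\<in>J. c j \<odot> b j) = \<zero> \<longrightarrow> (\<forall>j\<in>J. c j = 0))"

text \<open>The dimension in \<open>growth\<close> is taken over a subfield of the ring itself, so
  the multiples of 1 have to form a field; their inverses are inherited from the ground
  field.\<close>

lemma scalars_subfield:
  assumes "\<one> \<noteq> \<zero>" shows "subfield (scalars A) A"
proof (rule subfieldI)
  have s: "subring (scalars A) A" using scalars_subalg by (simp add: subalg_def)
  note S = subalgD[OF scalars_subalg]
  show "subcring (scalars A) A"
    by (rule subcringI[OF s]) (auto simp: scalars_def smult_mult_left smult_smult mult.commute)
  show "Units (A\<lparr>carrier := scalars A\<rparr>) = scalars A - {\<zero>}"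
  proof (intro equalityI subsetI)
    fix x assume "x \<in> Units (A\<lparr>carrier := scalars A\<rparr>)"
    then obtain y where xy: "x \<in> scalars A" "y \<in> scalars A" "y \<otimes> x = \<one>" by (auto simp: Units_def)
    then have "x \<noteq> \<zero>" using assms S(1) by (metis r_null subsetD)
    then show "x \<in> scalars A - {\<zero>}" using xy by simp
  next
    fix x assume "x \<in> scalars A - {\<zero>}"
    then obtain c where x: "x = c \<odot> \<one>" "x \<noteq> \<zero>" by (auto simp: scalars_def)
    then have c: "x = c \<odot> \<one>" "c \<noteq> 0" by auto
    have "(1 / c) \<odot> \<one> \<in> scalars A" "x \<in> scalars A" using c by (auto simp: scalars_def)
    moreover have "((1 / c) \<odot> \<one>) \<otimes> x = \<one>" "x \<otimes> ((1 / c) \<odot> \<one>) = \<one>"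
      using c by (simp_all add: smult_mult_left smult_smult)
    ultimately show "x \<in> Units (A\<lparr>carrier := scalars A\<rparr>)" by (auto simp: Units_def)
  qed
qed

lemma Span_scalars:
  assumes one: "\<one> \<noteq> \<zero>" and Us: "set Us \<subseteq> carrier A"
  shows "Span (scalars A) Us = lin_span A (set Us)"
proof
  have K: "subfield (scalars A) A" by (rule scalars_subfield[OF one])
  note L = lin_subspace_lin_span[OF Us]
  show "Span (scalars A) Us \<subseteq> lin_span A (set Us)"
  proof (rule Span_min[OF K Us])
    show "subgroup (lin_span A (set Us)) (add_monoid A)" using L by (simp add: lin_subspace_def)
    show "scalars A <#> set Us \<subseteq> lin_span A (set Us)"
    proof
      fix x assume "x \<in> scalars A <#> set Us"
      then obtain k u where x: "k \<in> scalars A" "u \<in> set Us" "x = k \<otimes> u" by (auto simp: set_mult_def)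
      then obtain c where k: "k = c \<odot> \<one>" by (auto simp: scalars_def)
      have "u \<in> carrier A" using x Us by blast
      then have "x = c \<odot> u" using x k by (simp add: smult_mult_left)
      then show "x \<in> lin_span A (set Us)"
        using lin_subspaceD(4)[OF L] lin_span_superset x(2) by blast
    qed
  qed
  show "lin_span A (set Us) \<subseteq> Span (scalars A) Us"
  proof (rule lin_span_least)
    show "lin_subspace (Span (scalars A) Us) A"
    proof (rule lin_subspaceI)
      fix c x assume x: "x \<in> Span (scalars A) Us"
      then have xc: "x \<in> carrier A" using Span_subgroup_props(1)[OF K Us] by blast
      have "(c \<odot> \<one>) \<otimes> x \<in> Span (scalars A) Us"
        by (rule Span_smult_closed[OF K Us _ x]) (simp add: scalars_def)
      then show "c \<odot> x \<in> Span (scalars A) Us" using xc by (simp add: smult_mult_left)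
    qed (use Span_subgroup_props[OF K Us] in blast)+
    show "set Us \<subseteq> Span (scalars A) Us" by (rule Span_base_incl[OF K Us])
  qed
qed

lemma lin_span_image_elements:
  assumes "finite J" "b ` J \<subseteq> carrier A" "x \<in> lin_span A (b ` J)"
  shows "\<exists>c. x = (\<Oplus>j\<in>J. c j \<odot> b j)"
  using assms(3,2)
proof (induction rule: lin_span_induct)
  case zero
  have "(\<Oplus>j\<in>J. 0 \<odot> b j) = (\<Oplus>j\<in>J. \<zero>)"
    using assms(2) by (intro add.finprod_cong') auto
  then show ?case by (intro exI[of _ "\<lambda>_. 0"]) simp
next
  case (add x y)
  then obtain c d where cd: "x = (\<Oplus>j\<in>J. c j \<odot> b j)" "y = (\<Oplus>j\<in>J. d j \<odot> b j)" by blast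
  have "x \<oplus> y = (\<Oplus>j\<in>J. c j \<odot> b j \<oplus> d j \<odot> b j)"
    unfolding cd by (rule add.finprod_multf[symmetric]) (use assms(2) in auto)
  also have "\<dots> = (\<Oplus>j\<in>J. (c j + d j) \<odot> b j)"
    using assms(2) by (intro add.finprod_cong') (auto simp: smult_add_left)
  finally show ?case by (rule exI[of _ "\<lambda>j. c j + d j"])
next
  case (smult k x)
  then obtain c where c: "x = (\<Oplus>j\<in>J. c j \<odot> b j)" by blast
  have "k \<odot> x = (\<Oplus>j\<in>J. k \<odot> (c j \<odot> b j))"
    unfolding c by (rule smult_finsum) (use assms(2) in auto)
  also have "\<dots> = (\<Oplus>j\<in>J. (k * c j) \<odot> b j)"
    using assms(2) by (intro add.finprod_cong') (auto simp: smult_smult)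
  finally show ?case by (rule exI[of _ "\<lambda>j. k * c j"])
next
  case (base x)
  then obtain i where i: "i \<in> J" "x = b i" by blast
  have "(\<Oplus>j\<in>J. (if i = j then 1 else 0) \<odot> b j) = (\<Oplus>j\<in>J. if i = j then b j else \<zero>)"
    using assms(2) by (intro add.finprod_cong') auto
  also have "\<dots> = b i" by (rule add.finprod_singleton) (use i assms in auto)
  finally show ?case using i by (intro exI[of _ "\<lambda>j. if i = j then 1 else 0"]) simp
qed

text \<open>\<open>lin_indep\<close> concerns indexed families, so equal vectors at two indices
  count as dependent and the cardinality of J is a dimension. A vector in the span of later ones
  would give a nontrivial relation.\<close>

lemma independent_map:
  assumes one: "\<one> \<noteq> \<zero>" and b: "lin_indep b J" and js: "set js \<subseteq> J" "distinct js"
  shows "independent (scalars A) (map b js)"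
  using js
proof (induction js)
  case (Cons i js)
  have J: "finite J" "b ` J \<subseteq> carrier A" using b by (auto simp: lin_indep_def)
  have bc: "b j \<in> carrier A" if "j \<in> J" for j using J that by blast
  have bs: "b ` set js \<subseteq> carrier A" using J Cons.prems by auto
  have "b i \<notin> lin_span A (b ` set js)"
  proof
    assume "b i \<in> lin_span A (b ` set js)"
    then obtain c where c: "b i = (\<Oplus>j\<in>set js. c j \<odot> b j)"
      using lin_span_image_elements[of "set js" b "b i"] bs by auto
    \<comment> \<open>The value -1 at i and 0 off the list turn an expression of b i through the
      others into a relation over all of J.\<close>
    define c' where "c' j = (if j = i then - 1 else if j \<in> set js then c j else 0)" for j
    have "(\<Oplus>j\<in>J. c' j \<odot> b j) = (\<Oplus>j\<in>insert i (set js). c' j \<odot> b j)"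
      using J(1) Cons.prems bc
      by (intro add.finprod_mono_neutral_cong_left[symmetric]) (auto simp: c'_def)
    also have "\<dots> = c' i \<odot> b i \<oplus> (\<Oplus>j\<in>set js. c' j \<odot> b j)"
      using Cons.prems bc by (intro add.finprod_insert) auto
    also have "(\<Oplus>j\<in>set js. c' j \<odot> b j) = (\<Oplus>j\<in>set js. c j \<odot> b j)"
      using Cons.prems bc by (intro add.finprod_cong') (auto simp: c'_def)
    also have "c' i \<odot> b i \<oplus> (\<Oplus>j\<in>set js. c j \<odot> b j) = \<zero>"
      unfolding c[symmetric] using bc Cons.prems by (simp add: c'_def smult_minus_1 l_neg)
    finally have "\<forall>j\<in>J. c' j = 0" using b by (simp add: lin_indep_def)
    then have "c' i = 0" using Cons.prems by simp
    then show False by (simp add: c'_def)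
  qed
  moreover have "Span (scalars A) (map b js) = lin_span A (b ` set js)"
    using Span_scalars[OF one, of "map b js"] bs by simp
  ultimately have "b i \<notin> Span (scalars A) (map b js)" by simp
  moreover have "independent (scalars A) (map b js)" using Cons by simp
  moreover have "b i \<in> carrier A" using bc Cons.prems by simp
  ultimately show ?case by (simp add: li_Cons)
qed simp

lemma dim_lin_span:
  assumes one: "\<one> \<noteq> \<zero>" and B: "finite B" "B \<subseteq> carrier A"
  shows "dimension (dim (scalars A) (lin_span A B)) (scalars A) (lin_span A B)"
proof -
  obtain Us where Us: "set Us = B" using finite_list[OF B(1)] by blast
  have K: "subfield (scalars A) A" by (rule scalars_subfield[OF one])
  have "finite_dimension (scalars A) (Span (scalars A) Us)"
    using Us B by (intro Span_finite_dimension[OF K]) simp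
  then have "finite_dimension (scalars A) (lin_span A B)" using Span_scalars[OF one, of Us] Us B by simp
  then show ?thesis using finite_dimensionE[OF K] by (simp add: over_def)
qed

lemma card_le_dim:
  assumes one: "\<one> \<noteq> \<zero>" and B: "finite B" "B \<subseteq> carrier A"
    and b: "lin_indep b J" "b ` J \<subseteq> lin_span A B"
  shows "card J \<le> dim (scalars A) (lin_span A B)"
proof -
  have "finite J" using b by (simp add: lin_indep_def)
  then obtain js where js: "set js = J" "distinct js" using finite_distinct_list by blast
  have "independent (scalars A) (map b js)" using independent_map[OF one b(1)] js by simp
  then have "length (map b js) \<le> dim (scalars A) (lin_span A B)"
    by (rule independent_length_le_dimension[OF scalars_subfield[OF one] dim_lin_span[OF one B]]) (use b js in auto)
  then show ?thesis using js distinct_card by fastforce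
qed

lemma dim_le_card:
  assumes one: "\<one> \<noteq> \<zero>" and B: "finite B" "B \<subseteq> carrier A"
    and b: "lin_indep b J" "B \<subseteq> lin_span A (b ` J)"
  shows "dim (scalars A) (lin_span A B) \<le> card J"
proof -
  have K: "subfield (scalars A) A" by (rule scalars_subfield[OF one])
  have J: "finite J" "b ` J \<subseteq> carrier A" using b by (auto simp: lin_indep_def)
  then obtain js where js: "set js = J" "distinct js" using finite_distinct_list by blast
  have ind: "independent (scalars A) (map b js)" using independent_map[OF one b(1)] js by simp
  obtain Vs where Vs: "independent (scalars A) Vs" "length Vs = dim (scalars A) (lin_span A B)"
    "Span (scalars A) Vs = lin_span A B" "set Vs \<subseteq> carrier A"
    using exists_base[OF K dim_lin_span[OF one B]] by blast
  have "set Vs \<subseteq> lin_span A B" using Span_base_incl[OF K Vs(4)] Vs(3) by simp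
  also have "\<dots> \<subseteq> lin_span A (b ` J)" by (rule lin_span_least[OF lin_subspace_lin_span[OF J(2)] b(2)])
  also have "\<dots> = Span (scalars A) (map b js)" using Span_scalars[OF one, of "map b js"] J js by simp
  finally have "length Vs \<le> length (map b js)" by (rule independent_length_le[OF K Vs(1) ind])
  then show ?thesis using Vs(2) js distinct_card by fastforce
qed

section \<open>Growth and bounds for the GK-dimension\<close>

abbreviation "words U n \<equiv> {foldr (\<otimes>) ws \<one> | ws. set ws \<subseteq> U \<and> length ws \<le> n}"

lemma words_finite: "finite U \<Longrightarrow> finite (words U n)"
proof -
  assume "finite U"
  then have "finite {ws. set ws \<subseteq> U \<and> length ws \<le> n}" by (rule finite_lists_length_le)
  moreover have "words U n = (\<lambda>ws. foldr (\<otimes>) ws \<one>) ` {ws. set ws \<subseteq> U \<and> length ws \<le> n}" by blast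
  ultimately show ?thesis by simp
qed

lemma foldr_mult_in:
  assumes "subalg S A" "set ws \<subseteq> S" shows "foldr (\<otimes>) ws \<one> \<in> S"
  using assms(2) by (induction ws) (simp_all add: subalgD[OF assms(1)])

lemma words_carrier: "U \<subseteq> carrier A \<Longrightarrow> words U n \<subseteq> carrier A"
  using foldr_mult_in[OF subalg_carrier] by blast

text \<open>Independent words bound the growth from below. Taking logarithms in n^k \<le> C growth,
  the quotient of logarithms is at least k - ln C / ln n, and the correction tends to 0.\<close>

lemma GK_dim_ge:
  fixes J :: "nat \<Rightarrow> 'i set"
  assumes one: "\<one> \<noteq> \<zero>" and U: "finite U" "U \<subseteq> S" "U \<subseteq> carrier A"
    and b: "\<And>n. lin_indep b (J n)" "\<And>n. b ` J n \<subseteq> words U n"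
    and C: "C > 0" "\<And>n. real n ^ k \<le> C * real (card (J n))"
  shows "ereal (real k) \<le> GK_dim A S"
proof -
  have grow: "card (J n) \<le> growth A U n" for n
    unfolding growth_def
    by (rule card_le_dim[OF one words_finite[OF U(1)] words_carrier[OF U(3)] b(1)])
      (use b(2) lin_span_superset in blast)
  have lim: "(\<lambda>n. ereal (real k - ln C / ln (real n))) \<longlonglongrightarrow> ereal (real k)"
  proof -
    have "filterlim (\<lambda>n. ln (real n)) at_top sequentially"
      by (rule filterlim_compose[OF ln_at_top filterlim_real_sequentially])
    then have "(\<lambda>n. real k - ln C / ln (real n)) \<longlonglongrightarrow> real k - 0"
      by (intro tendsto_intros tendsto_divide_0[of _ "ln C"] filterlim_at_top_imp_at_infinity) auto
    then show ?thesis by simp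
  qed
  have "eventually (\<lambda>n. ereal (real k - ln C / ln (real n)) \<le> ereal (ln (real (growth A U n)) / ln (real n))) sequentially"
    using eventually_ge_at_top[of 2]
  proof eventually_elim
    case (elim n)
    have n: "real n > 0" "ln (real n) > 0" using elim by simp_all
    have le: "real n ^ k \<le> C * real (growth A U n)"
      using C(2)[of n] grow[of n] C(1) by (meson mult_left_mono of_nat_le_iff less_imp_le order_trans)
    have pos: "real n ^ k > 0" using n by simp
    with le have g1: "C * real (growth A U n) > 0" by linarith
    then have g: "C * real (growth A U n) > 0" "real (growth A U n) > 0"
      using zero_less_mult_pos[OF g1 C(1)] by blast+
    have "real k * ln (real n) = ln (real n ^ k)" using n by (simp add: ln_realpow)
    also have "\<dots> \<le> ln (C * real (growth A U n))"
      using le pos g by simp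
    also have "\<dots> = ln C + ln (real (growth A U n))" using C(1) g(2) by (simp add: ln_mult)
    finally have "real k * ln (real n) - ln C \<le> ln (real (growth A U n))" by simp
    then have "(real k * ln (real n) - ln C) / ln (real n) \<le> ln (real (growth A U n)) / ln (real n)"
      using n(2) by (intro divide_right_mono) simp_all
    then show ?case using n(2) by (simp add: diff_divide_distrib)
  qed
  then have "limsup (\<lambda>n. ereal (real k - ln C / ln (real n))) \<le> limsup (\<lambda>n. ereal (ln (real (growth A U n)) / ln (real n)))"
    by (rule Limsup_mono)
  also have "limsup (\<lambda>n. ereal (real k - ln C / ln (real n))) = ereal (real k)"
    by (rule lim_imp_Limsup[OF _ lim]) simp
  also have "limsup (\<lambda>n. ereal (ln (real (growth A U n)) / ln (real n))) \<le> GK_dim A S"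
    unfolding GK_dim_def by (rule SUP_upper) (use U in blast)
  finally show ?thesis .
qed

text \<open>The spans of the b (J n) form a multiplicative filtration of polynomial size. A finite U
  lies in some step d, so words of length at most n lie in step d n, and the growth is at most (d n
  + 1)^k for this fixed d.\<close>

lemma GK_dim_le:
  fixes J :: "nat \<Rightarrow> 'i set"
  assumes one: "\<one> \<noteq> \<zero>" and b: "\<And>n. lin_indep b (J n)" and mono: "\<And>m n. m \<le> n \<Longrightarrow> J m \<subseteq> J n"
    and mult: "\<And>m n x y. x \<in> lin_span A (b ` J m) \<Longrightarrow> y \<in> lin_span A (b ` J n) \<Longrightarrow> x \<otimes> y \<in> lin_span A (b ` J (m + n))"
    and one_in: "\<one> \<in> lin_span A (b ` J 0)"
    and S: "\<And>s. s \<in> S \<Longrightarrow> \<exists>n. s \<in> lin_span A (b ` J n)"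
    and C: "\<And>n. card (J n) \<le> (n + 1) ^ k"
  shows "GK_dim A S \<le> ereal (real k)"
  unfolding GK_dim_def
proof (rule SUP_least)
  fix U assume "U \<in> {U. finite U \<and> U \<subseteq> S}"
  then have U: "finite U" "U \<subseteq> S" by auto
  have J: "b ` J n \<subseteq> carrier A" for n using b by (simp add: lin_indep_def)
  have smono: "lin_span A (b ` J m) \<subseteq> lin_span A (b ` J n)" if "m \<le> n" for m n
    using mono[OF that] by (intro lin_span_mono image_mono)
  have "\<exists>d. U \<subseteq> lin_span A (b ` J d)"
    using U
  proof (induction U)
    case (insert u U)
    then obtain d where d: "U \<subseteq> lin_span A (b ` J d)" by blast
    obtain n where "u \<in> lin_span A (b ` J n)" using insert.prems S by blast
    then have "insert u U \<subseteq> lin_span A (b ` J (max d n))"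
      using d smono[of d "max d n"] smono[of n "max d n"] by auto
    then show ?case ..
  qed simp
  then obtain d where d: "U \<subseteq> lin_span A (b ` J d)" by blast
  have UA: "U \<subseteq> carrier A" using d lin_span_subset_carrier[OF J] by blast
  have w: "foldr (\<otimes>) ws \<one> \<in> lin_span A (b ` J (d * length ws))" if "set ws \<subseteq> U" for ws
    using that
  proof (induction ws)
    case (Cons x ws)
    then have "x \<otimes> foldr (\<otimes>) ws \<one> \<in> lin_span A (b ` J (d + d * length ws))" using d by (intro mult) auto
    then show ?case by simp
  qed (use one_in in simp)
  have grow: "growth A U n \<le> (d * n + 1) ^ k" for n
  proof -
    have "words U n \<subseteq> lin_span A (b ` J (d * n))"
    proof
      fix x assume "x \<in> words U n"
      then obtain ws where ws: "x = foldr (\<otimes>) ws \<one>" "set ws \<subseteq> U" "length ws \<le> n" by blast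
      then show "x \<in> lin_span A (b ` J (d * n))" using w[of ws] smono[of "d * length ws" "d * n"] by auto
    qed
    then have "growth A U n \<le> card (J (d * n))"
      unfolding growth_def by (rule dim_le_card[OF one words_finite[OF U(1)] words_carrier[OF UA] b])
    then show ?thesis using C[of "d * n"] by simp
  qed
  \<comment> \<open>The logarithm of ((d + 1) n)^k is k ln n + c, so c / ln n is the error
    term.\<close>
  define c where "c = real k * ln (real (d + 1))"
  have lim: "(\<lambda>n. ereal (real k + c / ln (real n))) \<longlonglongrightarrow> ereal (real k)"
  proof -
    have "filterlim (\<lambda>n. ln (real n)) at_top sequentially"
      by (rule filterlim_compose[OF ln_at_top filterlim_real_sequentially])
    then have "(\<lambda>n. real k + c / ln (real n)) \<longlonglongrightarrow> real k + 0"
      by (intro tendsto_intros tendsto_divide_0[of _ c] filterlim_at_top_imp_at_infinity) auto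
    then show ?thesis by simp
  qed
  have "eventually (\<lambda>n. ereal (ln (real (growth A U n)) / ln (real n)) \<le> ereal (real k + c / ln (real n))) sequentially"
    using eventually_ge_at_top[of 2]
  proof eventually_elim
    case (elim n)
    have n: "real n > 0" "ln (real n) > 0" using elim by simp_all
    have "d * n + 1 \<le> (d + 1) * n" using elim by simp
    then have "(d * n + 1) ^ k \<le> ((d + 1) * n) ^ k" by (rule power_mono) simp
    then have "growth A U n \<le> ((d + 1) * n) ^ k" using grow order_trans by blast
    then have le: "real (growth A U n) \<le> (real (d + 1) * real n) ^ k"
      by (metis of_nat_le_iff of_nat_mult of_nat_power)
    have "ln (real (growth A U n)) \<le> ln ((real (d + 1) * real n) ^ k)"
    \<comment> \<open>Monotonicity of \<open>ln\<close> needs a positive argument. At 0 it takes the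
      default value 0, which is below the logarithm of a number that is at least 1.\<close>
    proof (cases "growth A U n = 0")
      case True
      have "1 \<le> real (d + 1) * real n" using elim by (simp add: mult_ge1_I)
      then have "1 \<le> (real (d + 1) * real n) ^ k" by simp
      then show ?thesis using True by simp
    next
      case False
      then show ?thesis using le n by simp
    qed
    also have "\<dots> = real k * (ln (real (d + 1)) + ln (real n))"
      using n by (simp add: ln_realpow ln_mult)
    finally have "ln (real (growth A U n)) / ln (real n) \<le> (real k * (ln (real (d + 1)) + ln (real n))) / ln (real n)"
      using n(2) by (intro divide_right_mono) simp_all
    then show ?case using n(2) by (simp add: c_def add_divide_distrib distrib_left)
  qed
  then have "limsup (\<lambda>n. ereal (ln (real (growth A U n)) / ln (real n))) \<le> limsup (\<lambda>n. ereal (real k + c / ln (real n)))"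
    by (rule Limsup_mono)
  also have "\<dots> = ereal (real k)" by (rule lim_imp_Limsup[OF _ lim]) simp
  finally show "limsup (\<lambda>n. ereal (ln (real (growth A U n)) / ln (real n))) \<le> ereal (real k)" .
qed

end

lemma (in kalg) lin_span_mult:
  assumes U: "U \<subseteq> carrier A" "V \<subseteq> carrier A" "W \<subseteq> carrier A"
    and uv: "\<And>u v. u \<in> U \<Longrightarrow> v \<in> V \<Longrightarrow> u \<otimes> v \<in> lin_span A W"
    and x: "x \<in> lin_span A U" and y: "y \<in> lin_span A V"
  shows "x \<otimes> y \<in> lin_span A W"
proof -
  note W = lin_subspaceD[OF lin_subspace_lin_span[OF U(3)]]
  have yc: "y \<in> carrier A" using y lin_span_subset_carrier[OF U(2)] by blast
  have uy: "u \<otimes> y \<in> lin_span A W" if u: "u \<in> U" for u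
    using y U(2)
  proof (induction rule: lin_span_induct)
    case (base v)
    then show ?case using uv u by blast
  qed (use u U(1) W(2-4) in \<open>auto simp: r_distr smult_mult_right\<close>)
  show ?thesis
    using x U(1)
  proof (induction rule: lin_span_induct)
    case (base u)
    then show ?case by (rule uy)
  qed (use yc W(2-4) in \<open>auto simp: l_distr smult_mult_left\<close>)
qed

lemma (in kalg) foldr_replicate: "u \<in> carrier A \<Longrightarrow> x \<in> carrier A \<Longrightarrow> foldr (\<otimes>) (replicate n u) x = u [^] n \<otimes> x"
proof (induction n)
  case (Suc n)
  then show ?case using nat_pow_Suc2[of u n] by (simp add: m_assoc del: nat_pow_Suc)
qed simp

lemma const_poly_sum: "[:(\<Sum>i\<in>I. f i):] = (\<Sum>i\<in>I. [:f i:])"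
proof (induction I rule: infinite_finite_induct)
  case (insert i I)
  have "[:f i + sum f I:] = [:f i:] + [:sum f I:]" by simp
  then show ?case using insert by simp
qed simp_all

lemma poly_in_add: "poly_in a b (p + q) = poly_in a b p + poly_in a b q"
  by (induction p q rule: poly_induct2) (simp_all add: poly_in_pCons algebra_simps del: mult_pCons_left mult_pCons_right)

lemma poly_in_monom: "poly_in a b (monom c i) = cst c * lin_form a b ^ i"
proof (induction i)
  case 0
  show ?case by (simp add: monom_0 poly_in_pCons)
next
  case (Suc i)
  then show ?case by (simp add: monom_Suc poly_in_pCons algebra_simps del: mult_pCons_left mult_pCons_right)
qed

text \<open>If p(u) = 0, differentiating gives a p'(u) = b p'(u) = 0, hence p'(u) = 0. By induction
  on the degree p' = 0, so p is constant.\<close>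

lemma poly_in_eq_0:
  assumes ab: "(a, b) \<noteq> (0, 0)" and "poly_in a b p = 0" shows "p = 0"
  using assms(2)
proof (induction "degree p" arbitrary: p rule: less_induct)
  case less
  have "cst a * poly_in a b (pderiv p) = 0" "cst b * poly_in a b (pderiv p) = 0"
    unfolding d_poly_in[symmetric] less.prems by simp_all
  then have 0: "poly_in a b (pderiv p) = 0" using ab by auto
  have "degree p = 0"
  proof (rule ccontr)
    assume "degree p \<noteq> 0"
    then have "degree (pderiv p) < degree p" by (simp add: degree_pderiv)
    then have "pderiv p = 0" using less.hyps 0 by blast
    then show False using \<open>degree p \<noteq> 0\<close> by (simp add: pderiv_eq_0_iff)
  qed
  then obtain c where "p = [:c:]" by (rule degree_eq_zeroE)
  then show "p = 0" using less.prems by (simp add: poly_in_pCons)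
qed

lemma lin_form_pow_free:
  assumes "(a, b) \<noteq> (0, 0)" "(\<Sum>i\<le>n. cst (c i) * lin_form a b ^ i) = 0" "i \<le> n" shows "c i = 0"
proof -
  have "poly_in a b (\<Sum>i\<in>I. monom (c i) i) = (\<Sum>i\<in>I. cst (c i) * lin_form a b ^ i)" for I
    by (induction I rule: infinite_finite_induct) (simp_all add: poly_in_add poly_in_monom del: mult_pCons_left mult_pCons_right)
  then have "poly_in a b (\<Sum>i\<le>n. monom (c i) i) = 0" using assms(2) by simp
  then have "(\<Sum>i\<le>n. monom (c i) i) = 0" by (rule poly_in_eq_0[OF assms(1)])
  then have "coeff (\<Sum>i\<le>n. monom (c i) i) i = 0" by simp
  then show ?thesis using assms(3) by (simp add: coeff_sum)
qed

section \<open>Independence in H read off from the model\<close>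

context ha
begin

lemma psi_eq_0: "psi q = \<zero>\<^bsub>H\<^esub> \<Longrightarrow> q = 0"
  using phi_psi[of q] phi_psi[of 0] by simp

lemma H_nontrivial: "e \<noteq> \<zero>\<^bsub>H\<^esub>"
  using psi_eq_0[of 1] psi_1 by auto

lemma psi_sum: "(\<Oplus>\<^bsub>H\<^esub>j\<in>J. psi (g j)) = psi (\<Sum>j\<in>J. g j)"
proof (induction J rule: infinite_finite_induct)
  case (insert j J)
  then show ?case by (simp add: psi_add)
qed (simp_all add: H.add.finprod_infinite)

text \<open>By PBW \<open>psi\<close> is linear with trivial kernel, so independence in H may be
  tested on polynomials.\<close>

lemma lin_indep_psi:
  assumes "finite J" "\<And>c. (\<Sum>j\<in>J. pbw_scale (c j) (q j)) = 0 \<Longrightarrow> (\<forall>j\<in>J. c j = 0)"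
  shows "H.lin_indep (\<lambda>j. psi (q j)) J"
  unfolding H.lin_indep_def
proof (intro conjI allI impI)
  fix c assume "(\<Oplus>\<^bsub>H\<^esub>j\<in>J. c j \<odot>\<^bsub>H\<^esub> psi (q j)) = \<zero>\<^bsub>H\<^esub>"
  then have "psi (\<Sum>j\<in>J. pbw_scale (c j) (q j)) = \<zero>\<^bsub>H\<^esub>" unfolding psi_sum[symmetric] psi_scale .
  then show "\<forall>j\<in>J. c j = 0" by (intro assms(2) psi_eq_0)
qed (use assms in auto)

lemma ev_pow: "ev (r ^ n) = ev r [^]\<^bsub>H\<^esub> n"
  by (induction n) (simp_all add: ev_1 ev_mult mult.commute[of r])

lemma ev_commute: "ev r \<otimes>\<^bsub>H\<^esub> ev s = ev s \<otimes>\<^bsub>H\<^esub> ev r"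
  by (simp add: mult.commute flip: ev_mult)

subsection \<open>Lines\<close>

text \<open>The kernel of a derivation is a subalgebra, and \<open>dtransv_ker\<close> shows that
  this one consists of polynomials in u. Membership in the line thus becomes a differential
  equation.\<close>

lemma alg_gen_line:
  assumes ab: "(a, b) \<noteq> (0, 0)"
  shows "alg_gen H {ev (lin_form a b)} = {ev r | r. dtransv a b r = 0}" (is "?G = ?R")
proof
  have "subalg ?R H"
  proof (rule H.subalgI)
    have "e = ev (cst 1)" by (simp add: ev_cst)
    then show "e \<in> ?R" using dtransv_simps(4)[of a b 1] by blast
  next
    fix x y assume "x \<in> ?R" "y \<in> ?R"
    then obtain r s where rs: "x = ev r" "y = ev s" "dtransv a b r = 0" "dtransv a b s = 0" by blast
    have "x \<oplus>\<^bsub>H\<^esub> y = ev (r + s)" "x \<otimes>\<^bsub>H\<^esub> y = ev (r * s)" using rs by (simp_all add: P.e_add ev_mult)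
    moreover have "dtransv a b (r + s) = 0" "dtransv a b (r * s) = 0" using rs by (simp_all add: dtransv_simps)
    ultimately show "x \<oplus>\<^bsub>H\<^esub> y \<in> ?R" "x \<otimes>\<^bsub>H\<^esub> y \<in> ?R" by blast+
  next
    fix c x assume "x \<in> ?R"
    then obtain r where r: "x = ev r" "dtransv a b r = 0" by blast
    have "c \<odot>\<^bsub>H\<^esub> x = ev (cst c * r)" unfolding ev_mult ev_cst r(1) by (simp add: H.smult_mult_left)
    moreover have "dtransv a b (cst c * r) = 0" unfolding dtransv_simps r by simp
    ultimately show "c \<odot>\<^bsub>H\<^esub> x \<in> ?R" by blast
  qed auto
  then show "?G \<subseteq> ?R" by (rule H.alg_gen_least) (use dtransv_simps(7)[of a b] in blast)
  have G: "subalg ?G H" by (rule H.subalg_alg_gen) simp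
  show "?R \<subseteq> ?G"
  proof
    fix x assume "x \<in> ?R"
    then obtain r where r: "x = ev r" "dtransv a b r = 0" by blast
    obtain p where "r = poly_in a b p" by (rule dtransv_ker[OF ab r(2)])
    moreover have "ev (lin_form a b) \<in> ?G" by (rule subsetD[OF H.alg_gen_superset]) simp
    ultimately show "x \<in> ?G" using ev_poly_in_mem[OF G] r(1) by simp
  qed
qed

lemma ev_eq_iff: "ev r = ev s \<longleftrightarrow> r = s"
proof
  assume eq: "ev r = ev s"
  have "[:r:] = phi (psi [:r:])" by (rule phi_psi[symmetric])
  also have "\<dots> = phi (psi [:s:])" unfolding psi_const eq ..
  also have "\<dots> = [:s:]" by (rule phi_psi)
  finally show "r = s" by simp
qed simp

lemma ev_poly_in_finsum:
  "degree p \<le> N \<Longrightarrow> ev (poly_in a b p) = (\<Oplus>\<^bsub>H\<^esub>i\<in>{..N}. coeff p i \<odot>\<^bsub>H\<^esub> (ev (lin_form a b) [^]\<^bsub>H\<^esub> i))"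
proof -
  assume N: "degree p \<le> N"
  have s: "poly_in a b (\<Sum>i\<in>I. monom (c i) i) = (\<Sum>i\<in>I. cst (c i) * lin_form a b ^ i)" for I and c :: "nat \<Rightarrow> 'k"
    by (induction I rule: infinite_finite_induct) (simp_all add: poly_in_add poly_in_monom del: mult_pCons_left mult_pCons_right)
  have "poly_in a b p = poly_in a b (\<Sum>i\<le>N. monom (coeff p i) i)"
    by (rule arg_cong[OF poly_as_sum_of_monoms'[OF N, symmetric]])
  also have "\<dots> = (\<Sum>i\<le>N. cst (coeff p i) * lin_form a b ^ i)" by (rule s)
  finally have "ev (poly_in a b p) = psi [:\<Sum>i\<le>N. cst (coeff p i) * lin_form a b ^ i:]"
    unfolding psi_const by (rule arg_cong)
  also have "\<dots> = (\<Oplus>\<^bsub>H\<^esub>i\<in>{..N}. coeff p i \<odot>\<^bsub>H\<^esub> (ev (lin_form a b) [^]\<^bsub>H\<^esub> i))"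
    unfolding const_poly_sum psi_sum[symmetric] psi_const ev_mult ev_cst ev_pow by (simp add: H.smult_mult_left)
  finally show ?thesis .
qed

lemma polynomial_alg_line:
  assumes ab: "(a, b) \<noteq> (0, 0)"
  shows "is_polynomial_alg H (ev (lin_form a b)) (alg_gen H {ev (lin_form a b)})"
proof -
  have eq: "(\<lambda>p :: 'k poly. \<Oplus>\<^bsub>H\<^esub>i\<in>{..degree p}. coeff p i \<odot>\<^bsub>H\<^esub> (ev (lin_form a b) [^]\<^bsub>H\<^esub> i))
      = (\<lambda>p. ev (poly_in a b p))"
    by (rule ext) (rule ev_poly_in_finsum[OF order_refl, symmetric])
  have "bij_betw (\<lambda>p. ev (poly_in a b p)) UNIV (alg_gen H {ev (lin_form a b)})"
    unfolding bij_betw_def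
  proof
    show "inj (\<lambda>p. ev (poly_in a b p))"
    proof (rule injI)
      fix p q assume "ev (poly_in a b p) = ev (poly_in a b q)"
      then have eq: "poly_in a b p = poly_in a b q" by (simp only: ev_eq_iff)
      have "poly_in a b (p - q) + poly_in a b q = poly_in a b p"
        using poly_in_add[of a b "p - q" q] by (simp only: diff_add_cancel)
      then have "poly_in a b (p - q) = 0" unfolding eq by simp
      then have "p - q = 0" by (rule poly_in_eq_0[OF ab])
      then show "p = q" by simp
    qed
    show "range (\<lambda>p. ev (poly_in a b p)) = alg_gen H {ev (lin_form a b)}"
      unfolding alg_gen_line[OF ab]
    proof (intro equalityI subsetI)
      fix x assume "x \<in> range (\<lambda>p. ev (poly_in a b p))"
      then obtain p where "x = ev (poly_in a b p)" by (rule rangeE)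
      then show "x \<in> {ev r | r. dtransv a b r = 0}"
        by (intro CollectI exI[of _ "poly_in a b p"] conjI dtransv_poly_in)
    next
      fix x assume "x \<in> {ev r | r. dtransv a b r = 0}"
      then obtain r where r: "x = ev r" "dtransv a b r = 0" by blast
      obtain p where "r = poly_in a b p" by (rule dtransv_ker[OF ab r(2)])
      then show "x \<in> range (\<lambda>p. ev (poly_in a b p))" using r(1) by (intro range_eqI[of _ _ p]) simp
    qed
  qed
  then show ?thesis unfolding is_polynomial_alg_def eq by (intro conjI P.e_closed)
qed

text \<open>The powers of u with exponent at most n are independent words of length at most n, and
  their spans form a multiplicative filtration of dimension n + 1. Both bounds apply with exponent
  1.\<close>

lemma GK_line:
  assumes ab: "(a, b) \<noteq> (0, 0)"
  shows "GK_dim H (alg_gen H {ev (lin_form a b)}) = 1"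
proof (rule antisym)
  let ?u = "ev (lin_form a b)"
  let ?b = "\<lambda>i::nat. ?u [^]\<^bsub>H\<^esub> i"
  have b: "?b = (\<lambda>i. psi [:lin_form a b ^ i:])" by (simp add: psi_const ev_pow)
  have ind: "H.lin_indep ?b {..n}" for n
    unfolding b
  proof (rule lin_indep_psi)
    fix k assume "(\<Sum>j\<in>{..n}. pbw_scale (k j) [:lin_form a b ^ j:]) = 0"
    then have "[:\<Sum>j\<le>n. cst (k j) * lin_form a b ^ j:] = 0" unfolding const_poly_sum by simp
    then show "\<forall>j\<in>{..n}. k j = 0" using lin_form_pow_free[OF ab, of k n] by simp
  qed simp
  have bc: "?b ` J \<subseteq> carrier H" for J by auto
  have "GK_dim H (alg_gen H {?u}) \<le> ereal (real 1)"
  proof (rule H.GK_dim_le[OF H_nontrivial ind])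
    show "x \<otimes>\<^bsub>H\<^esub> y \<in> lin_span H (?b ` {..m + n})" if "x \<in> lin_span H (?b ` {..m})" "y \<in> lin_span H (?b ` {..n})" for m n x y
    proof (rule H.lin_span_mult[OF bc bc bc _ that])
      fix u v assume "u \<in> ?b ` {..m}" "v \<in> ?b ` {..n}"
      then obtain i j where ij: "i \<le> m" "j \<le> n" "u = ?b i" "v = ?b j" by auto
      then have "u \<otimes>\<^bsub>H\<^esub> v = ?b (i + j)" by (simp add: H.nat_pow_mult)
      moreover have "?b (i + j) \<in> lin_span H (?b ` {..m + n})"
        by (rule subsetD[OF H.lin_span_superset], rule imageI) (use ij in simp)
      ultimately show "u \<otimes>\<^bsub>H\<^esub> v \<in> lin_span H (?b ` {..m + n})" by (simp only:)
    qed
    have "?b 0 \<in> lin_span H (?b ` {..0})" by (rule subsetD[OF H.lin_span_superset], rule imageI) simp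
    then show "e \<in> lin_span H (?b ` {..0})" by (simp only: H.nat_pow_0)
    show "\<exists>n. s \<in> lin_span H (?b ` {..n})" if s: "s \<in> alg_gen H {?u}" for s
    proof -
      obtain r where "s = ev r" "dtransv a b r = 0" using s unfolding alg_gen_line[OF ab] by blast
      then obtain p where p: "s = ev (poly_in a b p)" using dtransv_ker[OF ab] by metis
      have L: "lin_subspace (lin_span H (?b ` {..degree p})) H" by (rule H.lin_subspace_lin_span[OF bc])
      have "s \<in> lin_span H (?b ` {..degree p})"
        unfolding p ev_poly_in_finsum[OF order_refl]
        by (rule H.finsum_in_subspace[OF L], rule H.lin_subspaceD(4)[OF L], rule subsetD[OF H.lin_span_superset], rule imageI)
      then show ?thesis ..
    qed
  qed simp_all
  then show "GK_dim H (alg_gen H {?u}) \<le> 1" by (simp add: one_ereal_def)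
  have "ereal (real 1) \<le> GK_dim H (alg_gen H {?u})"
  proof (rule H.GK_dim_ge[OF H_nontrivial, of "{?u}" _ ?b "\<lambda>n. {..n}" 1])
    show "{?u} \<subseteq> alg_gen H {?u}" by (rule H.alg_gen_superset)
    show "?b ` {..n} \<subseteq> H.words {?u} n" for n
    proof
      fix x assume "x \<in> ?b ` {..n}"
      then obtain i where i: "i \<le> n" "x = ?b i" by auto
      have "x = foldr (\<otimes>\<^bsub>H\<^esub>) (replicate i ?u) e"
        unfolding i(2) by (subst H.foldr_replicate) simp_all
      moreover have "set (replicate i ?u) \<subseteq> {?u} \<and> length (replicate i ?u) \<le> n" using i(1) by auto
      ultimately show "x \<in> H.words {?u} n" by blast
    qed
  qed (simp_all add: ind)
  then show "1 \<le> GK_dim H (alg_gen H {?u})" by (simp add: one_ereal_def)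
qed

lemma GK_scalars: "GK_dim H (scalars H) \<le> 0"
proof -
  have ind: "H.lin_indep (\<lambda>_. e) {()}"
    using lin_indep_psi[of "{()}" "\<lambda>_. 1"] by (simp add: psi_1)
  have im: "(\<lambda>_. e) ` {()} = {e}" by simp
  have sc: "lin_span H {e} = scalars H"
  proof
    show "lin_span H {e} \<subseteq> scalars H"
      using H.lin_span_least[OF H.subalgD(9)[OF H.scalars_subalg]] H.subalgD(2)[OF H.scalars_subalg] by simp
    have L: "lin_subspace (lin_span H {e}) H" by (rule H.lin_subspace_lin_span) simp
    have "e \<in> lin_span H {e}" by (rule subsetD[OF H.lin_span_superset]) simp
    then show "scalars H \<subseteq> lin_span H {e}" using H.lin_subspaceD(4)[OF L] by (auto simp: scalars_def)
  qed
  have "GK_dim H (scalars H) \<le> ereal (real 0)"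
    by (rule H.GK_dim_le[where J = "\<lambda>_. {()}" and b = "\<lambda>_. e", OF H_nontrivial ind])
      (simp_all only: im sc H.subalgD(2,4)[OF H.scalars_subalg], simp_all)
  then show ?thesis by (simp add: zero_ereal_def)
qed

subsection \<open>Planes\<close>

text \<open>The common core of all planes. \<open>Q\<close> lists the models of the powers of v, and
  \<open>free\<close> is their independence over the polynomials in u. Since u is an eigenvector of
  the commutator with v, the elements u^i v^j are filtered by i + j compatibly with products, and
  their number up to n grows like n^2.\<close>

lemma ore_pair:
  assumes ab: "(a, b) \<noteq> (0, 0)" and u: "u = ev (lin_form a b)" and v: "v \<in> carrier H"
    and P: "\<And>j. psi (Q j) = v [^]\<^bsub>H\<^esub> (j::nat)"
    and free: "\<And>n f. (\<And>j. dtransv a b (f j) = 0) \<Longrightarrow> (\<Sum>j\<le>n. smult (f j) (Q j)) = 0 \<Longrightarrow> (\<forall>j\<le>n. f j = 0)"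
    and vu: "v \<otimes>\<^bsub>H\<^esub> u = u \<otimes>\<^bsub>H\<^esub> v \<oplus>\<^bsub>H\<^esub> l \<odot>\<^bsub>H\<^esub> u"
  shows "is_iterated_ore H u v (l \<odot>\<^bsub>H\<^esub> u)" "GK_dim H (alg_gen H {u, v}) = 2"
proof -
  have uc [simp]: "u \<in> carrier H" by (simp add: u)
  note [simp] = v
  have Gu: "subalg (alg_gen H {u}) H" by (rule H.subalg_alg_gen) simp
  have u_in: "u \<in> alg_gen H {u}" by (rule subsetD[OF H.alg_gen_superset]) simp
  show "is_iterated_ore H u v (l \<odot>\<^bsub>H\<^esub> u)"
  proof (rule H.is_iterated_oreI)
    show "v \<otimes>\<^bsub>H\<^esub> u \<ominus>\<^bsub>H\<^esub> u \<otimes>\<^bsub>H\<^esub> v = l \<odot>\<^bsub>H\<^esub> u"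
    proof -
      have "(u \<otimes>\<^bsub>H\<^esub> v \<oplus>\<^bsub>H\<^esub> l \<odot>\<^bsub>H\<^esub> u) \<ominus>\<^bsub>H\<^esub> u \<otimes>\<^bsub>H\<^esub> v = l \<odot>\<^bsub>H\<^esub> u"
        using H.m_closed[OF uc v] H.smult_closed[OF uc, of l] by algebra
      then show ?thesis unfolding vu .
    qed
    show "l \<odot>\<^bsub>H\<^esub> u \<in> alg_gen H {u}" by (rule H.subalgD(5)[OF Gu u_in])
    show "is_polynomial_alg H u (alg_gen H {u})" unfolding u by (rule polynomial_alg_line[OF ab])
    show "H.free_powers (alg_gen H {u}) v"
      unfolding H.free_powers_def
    proof (intro allI impI)
      fix N f n assume f: "\<forall>n. f n \<in> alg_gen H {u}" and s: "(\<Oplus>\<^bsub>H\<^esub>n\<in>{..N}. f n \<otimes>\<^bsub>H\<^esub> v [^]\<^bsub>H\<^esub> (n::nat)) = \<zero>\<^bsub>H\<^esub>"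
        and n: "n \<le> N"
      have "\<exists>r. f n = ev r \<and> dtransv a b r = 0" for n
        using f[rule_format, of n] unfolding u alg_gen_line[OF ab] by blast
      then obtain g where g: "\<And>n. f n = ev (g n)" "\<And>n. dtransv a b (g n) = 0" by metis
      have "psi (\<Sum>n\<in>{..N}. smult (g n) (Q n)) = \<zero>\<^bsub>H\<^esub>"
        using s unfolding psi_sum[symmetric] psi_smult P g(1) .
      then have "\<forall>n\<le>N. g n = 0" by (intro free[OF g(2)] psi_eq_0)
      then show "f n = \<zero>\<^bsub>H\<^esub>" using n g(1) by simp
    qed
  qed simp_all
  let ?b = "\<lambda>(i, j). u [^]\<^bsub>H\<^esub> (i::nat) \<otimes>\<^bsub>H\<^esub> v [^]\<^bsub>H\<^esub> (j::nat)"
  let ?J = "\<lambda>n. {(i, j). i + j \<le> n} :: (nat \<times> nat) set"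
  let ?F = "\<lambda>n. lin_span H (?b ` ?J n)"
  have Jsub: "?J n \<subseteq> {..n} \<times> {..n}" for n by auto
  have Jfin: "finite (?J n)" for n by (rule finite_subset[OF Jsub]) simp
  have bpsi: "?b = (\<lambda>x. psi (smult (lin_form a b ^ fst x) (Q (snd x))))"
    by (rule ext) (simp add: psi_smult P ev_pow u split: prod.split)
  have ind: "H.lin_indep ?b (?J n)" for n
    unfolding bpsi
  proof (rule lin_indep_psi[OF Jfin])
    fix c assume c: "(\<Sum>x\<in>?J n. pbw_scale (c x) (smult (lin_form a b ^ fst x) (Q (snd x)))) = 0"
    \<comment> \<open>Extension by zero from the triangle i + j \<le> n to the square lets the sum
      be regrouped into coefficients f j, polynomials in u, of the powers of v.\<close>
    define c' where "c' x = (if x \<in> ?J n then c x else 0)" for x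
    define f where "f j = (if j \<le> n then (\<Sum>i\<le>n. cst (c' (i, j)) * lin_form a b ^ i) else 0)" for j
    have "(\<Sum>x\<in>?J n. pbw_scale (c x) (smult (lin_form a b ^ fst x) (Q (snd x))))
        = (\<Sum>x\<in>{..n} \<times> {..n}. pbw_scale (c' x) (smult (lin_form a b ^ fst x) (Q (snd x))))"
      by (rule sum.mono_neutral_cong_left) (auto simp: c'_def)
    also have "\<dots> = (\<Sum>i\<le>n. \<Sum>j\<le>n. pbw_scale (c' (i, j)) (smult (lin_form a b ^ i) (Q j)))"
      by (subst sum.cartesian_product) (rule sum.cong, auto)
    also have "\<dots> = (\<Sum>j\<le>n. \<Sum>i\<le>n. pbw_scale (c' (i, j)) (smult (lin_form a b ^ i) (Q j)))"
      by (rule sum.swap)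
    also have "\<dots> = (\<Sum>j\<le>n. smult (f j) (Q j))"
      by (rule sum.cong) (simp_all add: f_def smult_sum del: mult_pCons_left mult_pCons_right)
    finally have s0: "(\<Sum>j\<le>n. smult (f j) (Q j)) = 0" using c by simp
    have d: "dtransv a b (f j) = 0" for j
    proof -
      have "f j = poly_in a b (if j \<le> n then (\<Sum>i\<le>n. monom (c' (i, j)) i) else 0)"
      proof -
        have "poly_in a b (\<Sum>i\<in>I. monom (k i) i) = (\<Sum>i\<in>I. cst (k i) * lin_form a b ^ i)" for I and k :: "nat \<Rightarrow> 'k"
          by (induction I rule: infinite_finite_induct) (simp_all add: poly_in_add poly_in_monom del: mult_pCons_left mult_pCons_right)
        then show ?thesis unfolding f_def by (simp del: mult_pCons_left mult_pCons_right)
      qed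
      then show ?thesis using dtransv_poly_in by (simp only:)
    qed
    have f0: "f j = 0" if "j \<le> n" for j using free[OF d s0] that by blast
    have "c (i, j) = 0" if "i + j \<le> n" for i j
    proof -
      have "(\<Sum>i\<le>n. cst (c' (i, j)) * lin_form a b ^ i) = 0" using f0[of j] that by (simp add: f_def)
      then have "c' (i, j) = 0" using lin_form_pow_free[OF ab, of "\<lambda>i. c' (i, j)" n i] that by simp
      then show ?thesis using that by (simp add: c'_def)
    qed
    then show "\<forall>x\<in>?J n. c x = 0" by auto
  qed
  have bc: "?b ` J \<subseteq> carrier H" for J by auto
  note L = H.lin_subspaceD[OF H.lin_subspace_lin_span[OF bc]]
  have bF: "u [^]\<^bsub>H\<^esub> i \<otimes>\<^bsub>H\<^esub> v [^]\<^bsub>H\<^esub> j \<in> ?F n" if "i + j \<le> n" for i j n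
    by (rule subsetD[OF H.lin_span_superset], rule image_eqI[of _ _ "(i, j)"]) (use that in simp_all)
  have Fmono: "?F m \<subseteq> ?F n" if "m \<le> n" for m n
    by (rule H.lin_span_mono, rule image_mono) (use that in auto)
  have FA: "x \<in> carrier H" if "x \<in> ?F n" for x n using L(1) that by blast
  have uF: "u \<otimes>\<^bsub>H\<^esub> y \<in> ?F (Suc n)" if "y \<in> ?F n" for y n
    using that bc
  proof (induction rule: H.lin_span_induct)
    case (base x)
    then obtain i j where ij: "i + j \<le> n" "x = u [^]\<^bsub>H\<^esub> i \<otimes>\<^bsub>H\<^esub> v [^]\<^bsub>H\<^esub> j" by auto
    have "u \<otimes>\<^bsub>H\<^esub> x = u [^]\<^bsub>H\<^esub> Suc i \<otimes>\<^bsub>H\<^esub> v [^]\<^bsub>H\<^esub> j"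
      unfolding ij(2) H.nat_pow_Suc2[OF uc] by (simp add: H.m_assoc)
    then show ?case using bF[of "Suc i" j "Suc n"] ij(1) by (simp del: H.nat_pow_Suc)
  qed (simp_all add: L(2-4) H.r_distr H.smult_mult_right)
  \<comment> \<open>Moving v past u^i produces only a multiple of u^i, so the total degree does not
    increase beyond i + 1.\<close>
  have vui: "v \<otimes>\<^bsub>H\<^esub> u [^]\<^bsub>H\<^esub> i = u [^]\<^bsub>H\<^esub> i \<otimes>\<^bsub>H\<^esub> v \<oplus>\<^bsub>H\<^esub> (of_nat i * l) \<odot>\<^bsub>H\<^esub> u [^]\<^bsub>H\<^esub> i" for i :: nat
  proof (induction i)
    case (Suc i)
    let ?U = "u [^]\<^bsub>H\<^esub> i"
    have "v \<otimes>\<^bsub>H\<^esub> (?U \<otimes>\<^bsub>H\<^esub> u) = (v \<otimes>\<^bsub>H\<^esub> ?U) \<otimes>\<^bsub>H\<^esub> u" by (simp add: H.m_assoc)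
    also have "\<dots> = ?U \<otimes>\<^bsub>H\<^esub> (v \<otimes>\<^bsub>H\<^esub> u) \<oplus>\<^bsub>H\<^esub> (of_nat i * l) \<odot>\<^bsub>H\<^esub> (?U \<otimes>\<^bsub>H\<^esub> u)"
      unfolding Suc by (simp add: H.l_distr H.m_assoc H.smult_mult_left)
    also have "\<dots> = ?U \<otimes>\<^bsub>H\<^esub> u \<otimes>\<^bsub>H\<^esub> v \<oplus>\<^bsub>H\<^esub> (l \<odot>\<^bsub>H\<^esub> (?U \<otimes>\<^bsub>H\<^esub> u) \<oplus>\<^bsub>H\<^esub> (of_nat i * l) \<odot>\<^bsub>H\<^esub> (?U \<otimes>\<^bsub>H\<^esub> u))"
      unfolding vu by (simp add: H.r_distr H.m_assoc H.smult_mult_right H.a_assoc)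
    also have "l \<odot>\<^bsub>H\<^esub> (?U \<otimes>\<^bsub>H\<^esub> u) \<oplus>\<^bsub>H\<^esub> (of_nat i * l) \<odot>\<^bsub>H\<^esub> (?U \<otimes>\<^bsub>H\<^esub> u) = (of_nat (Suc i) * l) \<odot>\<^bsub>H\<^esub> (?U \<otimes>\<^bsub>H\<^esub> u)"
      by (simp add: distrib_right H.smult_add_left)
    finally show ?case by simp
  qed simp
  have vF: "v \<otimes>\<^bsub>H\<^esub> y \<in> ?F (Suc n)" if "y \<in> ?F n" for y n
    using that bc
  proof (induction rule: H.lin_span_induct)
    case (base x)
    then obtain i j where ij: "i + j \<le> n" "x = u [^]\<^bsub>H\<^esub> i \<otimes>\<^bsub>H\<^esub> v [^]\<^bsub>H\<^esub> j" by auto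
    have "v \<otimes>\<^bsub>H\<^esub> x = (v \<otimes>\<^bsub>H\<^esub> u [^]\<^bsub>H\<^esub> i) \<otimes>\<^bsub>H\<^esub> v [^]\<^bsub>H\<^esub> j" unfolding ij(2) by (simp add: H.m_assoc)
    also have "\<dots> = u [^]\<^bsub>H\<^esub> i \<otimes>\<^bsub>H\<^esub> v [^]\<^bsub>H\<^esub> Suc j \<oplus>\<^bsub>H\<^esub> (of_nat i * l) \<odot>\<^bsub>H\<^esub> (u [^]\<^bsub>H\<^esub> i \<otimes>\<^bsub>H\<^esub> v [^]\<^bsub>H\<^esub> j)"
      unfolding vui H.nat_pow_Suc2[OF v] by (simp add: H.l_distr H.m_assoc H.smult_mult_left)
    finally have eq: "v \<otimes>\<^bsub>H\<^esub> x = u [^]\<^bsub>H\<^esub> i \<otimes>\<^bsub>H\<^esub> v [^]\<^bsub>H\<^esub> Suc j \<oplus>\<^bsub>H\<^esub> (of_nat i * l) \<odot>\<^bsub>H\<^esub> (u [^]\<^bsub>H\<^esub> i \<otimes>\<^bsub>H\<^esub> v [^]\<^bsub>H\<^esub> j)" .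
    show ?case unfolding eq by (intro L(3,4) bF) (use ij in simp_all)
  qed (simp_all add: L(2-4) H.r_distr H.smult_mult_right)
  have ui: "u [^]\<^bsub>H\<^esub> i \<otimes>\<^bsub>H\<^esub> y \<in> ?F (i + n)" if "y \<in> ?F n" for i y n
  proof (induction i)
    case (Suc i)
    then show ?case using uF FA[OF that] unfolding H.nat_pow_Suc2[OF uc] by (simp add: H.m_assoc)
  qed (use that FA in simp)
  have vj: "v [^]\<^bsub>H\<^esub> j \<otimes>\<^bsub>H\<^esub> y \<in> ?F (j + n)" if "y \<in> ?F n" for j y n
  proof (induction j)
    case (Suc j)
    then show ?case using vF FA[OF that] unfolding H.nat_pow_Suc2[OF v] by (simp add: H.m_assoc)
  qed (use that FA in simp)
  have mult: "x \<otimes>\<^bsub>H\<^esub> y \<in> ?F (m + n)" if x: "x \<in> ?F m" and y: "y \<in> ?F n" for x y m n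
    using x bc
  proof (induction rule: H.lin_span_induct)
    case (base x)
    then obtain i j where ij: "i + j \<le> m" "x = u [^]\<^bsub>H\<^esub> i \<otimes>\<^bsub>H\<^esub> v [^]\<^bsub>H\<^esub> j" by auto
    have "u [^]\<^bsub>H\<^esub> i \<otimes>\<^bsub>H\<^esub> (v [^]\<^bsub>H\<^esub> j \<otimes>\<^bsub>H\<^esub> y) \<in> ?F (i + (j + n))" by (intro ui vj y)
    then have "x \<otimes>\<^bsub>H\<^esub> y \<in> ?F (i + (j + n))" unfolding ij(2) using FA[OF y] by (simp add: H.m_assoc)
    then show ?case using Fmono[of "i + (j + n)" "m + n"] ij(1) by auto
  qed (use FA[OF y] in \<open>simp_all add: L(2-4) H.l_distr H.smult_mult_left\<close>)
  have one: "e \<in> ?F 0" using bF[of 0 0 0] by simp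
  have cov: "\<exists>n. s \<in> ?F n" if "s \<in> alg_gen H {u, v}" for s
  proof -
    have "subalg {s. \<exists>n. s \<in> ?F n} H"
    proof (rule H.subalgI)
      show "{s. \<exists>n. s \<in> ?F n} \<subseteq> carrier H" using FA by blast
      show "e \<in> {s. \<exists>n. s \<in> ?F n}" using one by blast
    next
      fix x y assume "x \<in> {s. \<exists>n. s \<in> ?F n}" "y \<in> {s. \<exists>n. s \<in> ?F n}"
      then obtain m n where mn: "x \<in> ?F m" "y \<in> ?F n" by blast
      have "x \<in> ?F (m + n)" "y \<in> ?F (m + n)"
        using subsetD[OF Fmono mn(1), of "m + n"] subsetD[OF Fmono mn(2), of "m + n"] by simp_all
      then show "x \<oplus>\<^bsub>H\<^esub> y \<in> {s. \<exists>n. s \<in> ?F n}" using L(3) by blast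
      show "x \<otimes>\<^bsub>H\<^esub> y \<in> {s. \<exists>n. s \<in> ?F n}" using mult[OF mn] by blast
    next
      fix c x assume "x \<in> {s. \<exists>n. s \<in> ?F n}"
      then show "c \<odot>\<^bsub>H\<^esub> x \<in> {s. \<exists>n. s \<in> ?F n}" using L(4) by blast
    qed
    moreover have "u \<in> ?F 1" "v \<in> ?F 1" using bF[of 1 0 1] bF[of 0 1 1] by simp_all
    ultimately have "alg_gen H {u, v} \<subseteq> {s. \<exists>n. s \<in> ?F n}" by (intro H.alg_gen_least) blast+
    then show ?thesis using that by blast
  qed
  have "GK_dim H (alg_gen H {u, v}) \<le> ereal (real 2)"
  proof (rule H.GK_dim_le[OF H_nontrivial ind _ mult one cov])
    show "?J m \<subseteq> ?J n" if "m \<le> n" for m n using that by auto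
    have "card (?J n) \<le> card ({..n} \<times> {..n})" for n by (rule card_mono[OF _ Jsub]) simp
    then show "card (?J n) \<le> (n + 1) ^ 2" for n by (simp add: power2_eq_square)
  qed
  moreover have "ereal (real 2) \<le> GK_dim H (alg_gen H {u, v})"
  proof (rule H.GK_dim_ge[OF H_nontrivial, of "{u, v}" _ ?b ?J 4])
    show "{u, v} \<subseteq> alg_gen H {u, v}" by (rule H.alg_gen_superset)
    show "H.lin_indep ?b (?J n)" for n by (rule ind)
    show "?b ` ?J n \<subseteq> H.words {u, v} n" for n
    proof
      fix x assume "x \<in> ?b ` ?J n"
      then obtain i j where ij: "i + j \<le> n" "x = u [^]\<^bsub>H\<^esub> i \<otimes>\<^bsub>H\<^esub> v [^]\<^bsub>H\<^esub> j" by auto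
      let ?w = "replicate i u @ replicate j v"
      have "x = foldr (\<otimes>\<^bsub>H\<^esub>) ?w e"
        unfolding ij(2) foldr_append by (subst (1 2) H.foldr_replicate) simp_all
      moreover have "set ?w \<subseteq> {u, v} \<and> length ?w \<le> n" using ij(1) by auto
      ultimately show "x \<in> H.words {u, v} n" by blast
    qed
    \<comment> \<open>The triangle contains a square with n div 2 + 1 points on each side, and n
      \<le> 2 (n div 2 + 1); squaring gives the constant 4.\<close>
    show "real n ^ 2 \<le> 4 * real (card (?J n))" for n
    proof -
      have "{..n div 2} \<times> {..n div 2} \<subseteq> ?J n" by auto
      then have "card ({..n div 2} \<times> {..n div 2}) \<le> card (?J n)" by (rule card_mono[OF Jfin])
      then have 1: "(n div 2 + 1) ^ 2 \<le> card (?J n)" by (simp add: power2_eq_square)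
      have "n \<le> 2 * (n div 2 + 1)" by simp
      then have "n ^ 2 \<le> (2 * (n div 2 + 1)) ^ 2" by (rule power_mono) simp
      also have "\<dots> \<le> 4 * card (?J n)" using 1 unfolding power_mult_distrib by simp
      finally show ?thesis by (metis of_nat_le_iff of_nat_mult of_nat_numeral of_nat_power)
    qed
  qed simp_all
  ultimately show "GK_dim H (alg_gen H {u, v}) = 2" by simp
qed

text \<open>The powers of z + r are monic in z, because \<open>Zop\<close> raises the degree in z by
  one and keeps the leading coefficient. Their independence over the polynomials in x and y follows
  by comparing leading terms.\<close>

lemma coeff_mult_v_pow: "n < m \<Longrightarrow> coeff ((mult_v r ^^ n) 1) m = 0" "coeff ((mult_v r ^^ n) 1) n = 1"
proof -
  have "(\<forall>m>n. coeff ((mult_v r ^^ n) 1) m = 0) \<and> coeff ((mult_v r ^^ n) 1) n = 1"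
  proof (induction n)
    case (Suc n)
    then show ?case by (auto simp: mult_v_def coeff_Zop split: nat.split)
  qed auto
  then show "n < m \<Longrightarrow> coeff ((mult_v r ^^ n) 1) m = 0" "coeff ((mult_v r ^^ n) 1) n = 1" by blast+
qed

lemma mult_v_free:
  assumes "(\<Sum>j\<le>n. smult (f j) ((mult_v r ^^ j) 1)) = 0" shows "\<forall>j\<le>n. f j = 0"
  using assms
proof (induction n)
  case 0
  then show ?case by simp
next
  case (Suc n)
  have "coeff (\<Sum>j\<le>Suc n. smult (f j) ((mult_v r ^^ j) 1)) (Suc n) = f (Suc n)"
    using coeff_mult_v_pow(2)[where r = r and n = "Suc n"] by (simp add: coeff_sum coeff_mult_v_pow(1) del: funpow.simps)
  from this[unfolded Suc.prems] have f0: "f (Suc n) = 0" by simp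
  then have "(\<Sum>j\<le>n. smult (f j) ((mult_v r ^^ j) 1)) = 0" using Suc.prems by simp
  then show ?case using Suc.IH f0 by (auto simp: le_Suc_eq)
qed

text \<open>The part \<open>ev r\<close> commutes with u, so the commutator of v and u is that of Z
  and u, namely \<open>delta u\<close>. The eigenvector condition on u then supplies the last
  premise of \<open>ore_pair\<close>.\<close>

lemma ore_pair_Z:
  assumes ab: "(a, b) \<noteq> (0, 0)" and d: "delta (lin_form a b) = cst l * lin_form a b"
  shows "is_iterated_ore H (ev (lin_form a b)) (ev r \<oplus>\<^bsub>H\<^esub> Z) (l \<odot>\<^bsub>H\<^esub> ev (lin_form a b))"
    "GK_dim H (alg_gen H {ev (lin_form a b), ev r \<oplus>\<^bsub>H\<^esub> Z}) = 2"
proof -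
  let ?u = "ev (lin_form a b)"
  have v: "ev r \<oplus>\<^bsub>H\<^esub> Z \<in> carrier H" by simp
  have pw: "psi ((mult_v r ^^ j) 1) = (ev r \<oplus>\<^bsub>H\<^esub> Z) [^]\<^bsub>H\<^esub> j" for j :: nat
    unfolding psi_mult_v_pow psi_v ..
  have "(ev r \<oplus>\<^bsub>H\<^esub> Z) \<otimes>\<^bsub>H\<^esub> ?u = ?u \<otimes>\<^bsub>H\<^esub> ev r \<oplus>\<^bsub>H\<^esub> (?u \<otimes>\<^bsub>H\<^esub> Z \<oplus>\<^bsub>H\<^esub> l \<odot>\<^bsub>H\<^esub> ?u)"
    by (simp add: H.l_distr ev_commute[of r] ev_Z d ev_mult ev_cst H.smult_mult_left del: mult_pCons_left mult_pCons_right)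
  then have vu: "(ev r \<oplus>\<^bsub>H\<^esub> Z) \<otimes>\<^bsub>H\<^esub> ?u = ?u \<otimes>\<^bsub>H\<^esub> (ev r \<oplus>\<^bsub>H\<^esub> Z) \<oplus>\<^bsub>H\<^esub> l \<odot>\<^bsub>H\<^esub> ?u"
    by (simp add: H.r_distr H.a_assoc)
  note * = ore_pair[OF ab refl v, of "\<lambda>j. (mult_v r ^^ j) 1", OF pw mult_v_free vu]
  show "is_iterated_ore H ?u (ev r \<oplus>\<^bsub>H\<^esub> Z) (l \<odot>\<^bsub>H\<^esub> ?u)" by (rule *(1))
  show "GK_dim H (alg_gen H {?u, ev r \<oplus>\<^bsub>H\<^esub> Z}) = 2" by (rule *(2))
qed

text \<open>Here v = X involves no Z. For (a, b) = (0, 1) the kernel of the transversal derivation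
  is the polynomials in y, and the powers of x are independent over these.\<close>

lemma ore_pair_XY: "is_iterated_ore H Y X \<zero>\<^bsub>H\<^esub>" "GK_dim H (alg_gen H {Y, X}) = 2"
proof -
  have Y: "Y = ev (lin_form 0 1)" by (simp add: ev_lin_form)
  have pw: "psi [:xx ^ j:] = X [^]\<^bsub>H\<^esub> j" for j :: nat
    unfolding psi_const ev_pow ev_gens ..
  have free: "\<forall>j\<le>n. f j = 0" if d: "\<And>j. dtransv 0 1 (f j) = 0" and s: "(\<Sum>j\<le>n. smult (f j) [:xx ^ j:]) = 0" for n f
  proof -
    have "\<exists>t. f j = [:t:]" for j
    proof -
      have "dx (f j) = 0" using d[of j] by (simp add: dtransv_def)
      then show ?thesis using pderiv_eq_0_iff[of "f j"] degree_eq_zeroE by blast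
    qed
    then obtain t where t: "\<And>j. f j = [:t j:]" by metis
    have "smult (f j) [:xx ^ j:] = [:monom (t j) j:]" for j
    proof -
      have "monom (t j) j = smult (t j) (xx ^ j)" by (rule monom_altdef)
      then show ?thesis by (simp add: t)
    qed
    then have "[:\<Sum>j\<le>n. monom (t j) j:] = 0" using s by (simp add: const_poly_sum)
    then have "coeff (\<Sum>j\<le>n. monom (t j) j) i = 0" for i by simp
    then have "t j = 0" if "j \<le> n" for j using that by (simp add: coeff_sum) metis
    then show ?thesis using t by simp
  qed
  have vu: "X \<otimes>\<^bsub>H\<^esub> Y = Y \<otimes>\<^bsub>H\<^esub> X \<oplus>\<^bsub>H\<^esub> 0 \<odot>\<^bsub>H\<^esub> Y" by (simp add: relations(1))
  have ab: "(0, 1) \<noteq> (0, 0 :: 'k)" by simp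
  note * = ore_pair[OF ab Y gen_closed(1), of "\<lambda>j. [:xx ^ j:]", OF pw free vu]
  show "is_iterated_ore H Y X \<zero>\<^bsub>H\<^esub>" using *(1) by simp
  show "GK_dim H (alg_gen H {Y, X}) = 2" by (rule *(2))
qed

subsection \<open>The whole algebra\<close>

text \<open>A lower bound is enough to tell H from the lines and planes.\<close>

lemma GK_H: "3 \<le> GK_dim H (carrier H)"
proof -
  let ?b = "\<lambda>(i, j, k). Y [^]\<^bsub>H\<^esub> (i::nat) \<otimes>\<^bsub>H\<^esub> X [^]\<^bsub>H\<^esub> (j::nat) \<otimes>\<^bsub>H\<^esub> Z [^]\<^bsub>H\<^esub> (k::nat)"
  let ?q = "\<lambda>(i, j, k). monom (monom (monom (1::'k) i) j) k"
  \<comment> \<open>Exponents up to n div 3 keep each monomial a word of length at most n. The box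
    has (n div 3 + 1)^3 points and n \<le> 3 (n div 3 + 1), which gives the constant 27.\<close>
  let ?J = "\<lambda>n. {..n div 3} \<times> {..n div 3} \<times> {..n div 3} :: (nat \<times> nat \<times> nat) set"
  have Zk: "psi (monom r k) = ev r \<otimes>\<^bsub>H\<^esub> Z [^]\<^bsub>H\<^esub> k" for r k
  proof (induction k)
    case 0
    show ?case by (simp add: monom_0 psi_const)
  next
    case (Suc k)
    then show ?case by (simp add: monom_Suc psi_pCons H.m_assoc)
  qed
  have m: "monom (monom (1::'k) i) j = yy ^ i * xx ^ j" for i j
  proof -
    have "monom (monom (1::'k) i) j = [:monom 1 i:] * monom 1 j" by (simp add: smult_monom)
    also have "[:monom (1::'k) i:] = yy ^ i"
    proof (induction i)
      case (Suc i)
      have "[:monom (1::'k) (Suc i):] = yy * [:monom 1 i:]" by (simp add: monom_Suc)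
      then show ?case unfolding Suc by simp
    qed (simp add: monom_0 one_pCons)
    finally show ?thesis by (simp add: monom_altdef)
  qed
  have b: "?b = (\<lambda>x. psi (?q x))"
    by (rule ext) (simp add: Zk m ev_mult ev_pow ev_gens split: prod.split)
  have ind: "H.lin_indep ?b (?J n)" for n
    unfolding b
  proof (rule lin_indep_psi)
    fix c assume c: "(\<Sum>x\<in>?J n. pbw_scale (c x) (?q x)) = 0"
    show "\<forall>x\<in>?J n. c x = 0"
    proof
      fix x assume x: "x \<in> ?J n"
      obtain i j k where ijk: "x = (i, j, k)" by (cases x)
      have "coeff (coeff (coeff (\<Sum>y\<in>?J n. pbw_scale (c y) (?q y)) k) j) i = (\<Sum>y\<in>?J n. if y = x then c y else 0)"
        unfolding coeff_sum by (rule sum.cong) (auto simp: ijk split: if_splits)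
      also have "\<dots> = c x" using x by simp
      finally show "c x = 0" using c by simp
    qed
  qed simp
  have "ereal (real 3) \<le> GK_dim H (carrier H)"
  proof (rule H.GK_dim_ge[OF H_nontrivial, of "{X, Y, Z}" _ ?b ?J 27])
    show "H.lin_indep ?b (?J n)" for n by (rule ind)
    show "?b ` ?J n \<subseteq> H.words {X, Y, Z} n" for n
    proof
      fix x assume "x \<in> ?b ` ?J n"
      then obtain i j k where ijk: "i \<le> n div 3" "j \<le> n div 3" "k \<le> n div 3"
        "x = Y [^]\<^bsub>H\<^esub> i \<otimes>\<^bsub>H\<^esub> X [^]\<^bsub>H\<^esub> j \<otimes>\<^bsub>H\<^esub> Z [^]\<^bsub>H\<^esub> k" by auto
      let ?w = "replicate i Y @ replicate j X @ replicate k Z"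
      have "foldr (\<otimes>\<^bsub>H\<^esub>) ?w e = Y [^]\<^bsub>H\<^esub> i \<otimes>\<^bsub>H\<^esub> (X [^]\<^bsub>H\<^esub> j \<otimes>\<^bsub>H\<^esub> (Z [^]\<^bsub>H\<^esub> k \<otimes>\<^bsub>H\<^esub> e))"
        unfolding foldr_append by (subst (1 2 3) H.foldr_replicate) simp_all
      then have "x = foldr (\<otimes>\<^bsub>H\<^esub>) ?w e" unfolding ijk(4) by (simp only: H.r_one H.m_assoc H.nat_pow_closed H.m_closed gen_closed)
      moreover have "set ?w \<subseteq> {X, Y, Z} \<and> length ?w \<le> n" using ijk(1-3) by auto
      ultimately show "x \<in> H.words {X, Y, Z} n" by blast
    qed
    show "real n ^ 3 \<le> 27 * real (card (?J n))" for n
    proof -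
      have "n \<le> 3 * (n div 3 + 1)" by simp
      then have "n ^ 3 \<le> (3 * (n div 3 + 1)) ^ 3" by (rule power_mono) simp
      also have "\<dots> = 27 * card (?J n)" unfolding power_mult_distrib by (simp add: power3_eq_cube)
      finally show ?thesis by (metis of_nat_le_iff of_nat_mult of_nat_numeral of_nat_power)
    qed
  qed simp_all
  then show ?thesis by simp
qed

section \<open>The complete list, separated by GK-dimension\<close>

definition planes where
  "planes = {(Y, X, \<zero>\<^bsub>H\<^esub>)}
     \<union> {(Y, Z \<oplus>\<^bsub>H\<^esub> c \<odot>\<^bsub>H\<^esub> X \<ominus>\<^bsub>H\<^esub> Y \<otimes>\<^bsub>H\<^esub> X, l2 \<odot>\<^bsub>H\<^esub> Y) | c. True}
     \<union> (if l1 \<noteq> l2 then {(X, Z \<oplus>\<^bsub>H\<^esub> b \<odot>\<^bsub>H\<^esub> Y \<oplus>\<^bsub>H\<^esub> Y \<otimes>\<^bsub>H\<^esub> X, l1 \<odot>\<^bsub>H\<^esub> X) | b. True} else {})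
     \<union> (if l1 = l2 \<and> \<alpha> = 0 then {(X \<oplus>\<^bsub>H\<^esub> a \<odot>\<^bsub>H\<^esub> Y,
          Z \<oplus>\<^bsub>H\<^esub> b \<odot>\<^bsub>H\<^esub> Y \<oplus>\<^bsub>H\<^esub> a \<odot>\<^bsub>H\<^esub> (Y [^]\<^bsub>H\<^esub> (2::nat)) \<oplus>\<^bsub>H\<^esub> Y \<otimes>\<^bsub>H\<^esub> X,
          l1 \<odot>\<^bsub>H\<^esub> (X \<oplus>\<^bsub>H\<^esub> a \<odot>\<^bsub>H\<^esub> Y)) | a b. True} else {})"

lemma plane_Y:
  "is_iterated_ore H Y (Z \<oplus>\<^bsub>H\<^esub> c \<odot>\<^bsub>H\<^esub> X \<ominus>\<^bsub>H\<^esub> Y \<otimes>\<^bsub>H\<^esub> X) (l2 \<odot>\<^bsub>H\<^esub> Y)"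
  "GK_dim H (alg_gen H {Y, Z \<oplus>\<^bsub>H\<^esub> c \<odot>\<^bsub>H\<^esub> X \<ominus>\<^bsub>H\<^esub> Y \<otimes>\<^bsub>H\<^esub> X}) = 2"
proof -
  have u: "ev (lin_form 0 1) = Y" by (simp add: ev_lin_form)
  have v: "ev (cst c * xx + cst (- 1) * (yy * xx)) \<oplus>\<^bsub>H\<^esub> Z = Z \<oplus>\<^bsub>H\<^esub> c \<odot>\<^bsub>H\<^esub> X \<ominus>\<^bsub>H\<^esub> Y \<otimes>\<^bsub>H\<^esub> X"
    unfolding P.e_add ev_mult ev_cst ev_gens
    by (simp add: H.smult_mult_left a_minus_def H.smult_minus_1 H.l_minus H.a_ac)
  have d: "delta (lin_form 0 1) = cst l2 * lin_form 0 1"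
    unfolding delta_lin_form by (simp add: lin_form_def)
  have ab: "(0 :: 'k, 1 :: 'k) \<noteq> (0, 0)" by simp
  show "is_iterated_ore H Y (Z \<oplus>\<^bsub>H\<^esub> c \<odot>\<^bsub>H\<^esub> X \<ominus>\<^bsub>H\<^esub> Y \<otimes>\<^bsub>H\<^esub> X) (l2 \<odot>\<^bsub>H\<^esub> Y)"
    using ore_pair_Z(1)[OF ab d, of "cst c * xx + cst (- 1) * (yy * xx)"] unfolding u v .
  show "GK_dim H (alg_gen H {Y, Z \<oplus>\<^bsub>H\<^esub> c \<odot>\<^bsub>H\<^esub> X \<ominus>\<^bsub>H\<^esub> Y \<otimes>\<^bsub>H\<^esub> X}) = 2"
    using ore_pair_Z(2)[OF ab d, of "cst c * xx + cst (- 1) * (yy * xx)"] unfolding u v .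
qed

text \<open>For \<alpha> = 0, \<open>delta\<close> scales x by l1 and y by l2, so x + ay is an
  eigenvector with value l1 as soon as a = 0 or l1 = l2. This serves both families over x +
  ay.\<close>

lemma plane_U:
  assumes al: "\<alpha> = 0" and al': "a = 0 \<or> l1 = l2"
  shows "is_iterated_ore H (X \<oplus>\<^bsub>H\<^esub> a \<odot>\<^bsub>H\<^esub> Y)
      (Z \<oplus>\<^bsub>H\<^esub> b \<odot>\<^bsub>H\<^esub> Y \<oplus>\<^bsub>H\<^esub> a \<odot>\<^bsub>H\<^esub> (Y [^]\<^bsub>H\<^esub> (2::nat)) \<oplus>\<^bsub>H\<^esub> Y \<otimes>\<^bsub>H\<^esub> X) (l1 \<odot>\<^bsub>H\<^esub> (X \<oplus>\<^bsub>H\<^esub> a \<odot>\<^bsub>H\<^esub> Y))" (is "is_iterated_ore H ?u ?v _")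
    "GK_dim H (alg_gen H {X \<oplus>\<^bsub>H\<^esub> a \<odot>\<^bsub>H\<^esub> Y,
      Z \<oplus>\<^bsub>H\<^esub> b \<odot>\<^bsub>H\<^esub> Y \<oplus>\<^bsub>H\<^esub> a \<odot>\<^bsub>H\<^esub> (Y [^]\<^bsub>H\<^esub> (2::nat)) \<oplus>\<^bsub>H\<^esub> Y \<otimes>\<^bsub>H\<^esub> X}) = 2"
proof -
  let ?r = "cst b * yy + cst a * (yy * yy) + yy * xx"
  have u: "ev (lin_form 1 a) = ?u" by (simp add: ev_lin_form)
  have v: "ev ?r \<oplus>\<^bsub>H\<^esub> Z = ?v"
    unfolding P.e_add ev_mult ev_cst ev_gens
    by (simp add: H.smult_mult_left numeral_2_eq_2 H.a_ac)
  have d: "delta (lin_form 1 a) = cst l1 * lin_form 1 a"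
  proof -
    have "delta (lin_form 1 a) = cst 1 * (cst l1 * xx - cst \<alpha> * yy) + cst a * (cst l2 * yy)"
      by (rule delta_lin_form)
    also have "\<dots> = cst l1 * lin_form 1 a"
      unfolding lin_form_def using al al' by (auto simp: mult.commute)
    finally show ?thesis .
  qed
  have ab: "(1 :: 'k, a) \<noteq> (0, 0)" by simp
  show "is_iterated_ore H ?u ?v (l1 \<odot>\<^bsub>H\<^esub> ?u)"
    using ore_pair_Z(1)[OF ab d, of ?r] unfolding u v .
  show "GK_dim H (alg_gen H {?u, ?v}) = 2"
    using ore_pair_Z(2)[OF ab d, of ?r] unfolding u v .
qed

lemma plane_X:
  assumes "\<alpha> = 0"
  shows "right_coideal_subalg H \<Delta> (alg_gen H {X, Z \<oplus>\<^bsub>H\<^esub> b \<odot>\<^bsub>H\<^esub> Y \<oplus>\<^bsub>H\<^esub> Y \<otimes>\<^bsub>H\<^esub> X})"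
    "is_iterated_ore H X (Z \<oplus>\<^bsub>H\<^esub> b \<odot>\<^bsub>H\<^esub> Y \<oplus>\<^bsub>H\<^esub> Y \<otimes>\<^bsub>H\<^esub> X) (l1 \<odot>\<^bsub>H\<^esub> X)"
    "GK_dim H (alg_gen H {X, Z \<oplus>\<^bsub>H\<^esub> b \<odot>\<^bsub>H\<^esub> Y \<oplus>\<^bsub>H\<^esub> Y \<otimes>\<^bsub>H\<^esub> X}) = 2"
proof -
  have u: "X \<oplus>\<^bsub>H\<^esub> 0 \<odot>\<^bsub>H\<^esub> Y = X" by simp
  have v: "Z \<oplus>\<^bsub>H\<^esub> b \<odot>\<^bsub>H\<^esub> Y \<oplus>\<^bsub>H\<^esub> 0 \<odot>\<^bsub>H\<^esub> (Y [^]\<^bsub>H\<^esub> (2::nat)) \<oplus>\<^bsub>H\<^esub> Y \<otimes>\<^bsub>H\<^esub> X = Z \<oplus>\<^bsub>H\<^esub> b \<odot>\<^bsub>H\<^esub> Y \<oplus>\<^bsub>H\<^esub> Y \<otimes>\<^bsub>H\<^esub> X"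
    by simp
  show "right_coideal_subalg H \<Delta> (alg_gen H {X, Z \<oplus>\<^bsub>H\<^esub> b \<odot>\<^bsub>H\<^esub> Y \<oplus>\<^bsub>H\<^esub> Y \<otimes>\<^bsub>H\<^esub> X})"
    using right_coideal_UZ[of 0 b] unfolding u v .
  show "is_iterated_ore H X (Z \<oplus>\<^bsub>H\<^esub> b \<odot>\<^bsub>H\<^esub> Y \<oplus>\<^bsub>H\<^esub> Y \<otimes>\<^bsub>H\<^esub> X) (l1 \<odot>\<^bsub>H\<^esub> X)"
    using plane_U(1)[OF assms, of 0 b] unfolding u v by simp
  show "GK_dim H (alg_gen H {X, Z \<oplus>\<^bsub>H\<^esub> b \<odot>\<^bsub>H\<^esub> Y \<oplus>\<^bsub>H\<^esub> Y \<otimes>\<^bsub>H\<^esub> X}) = 2"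
    using plane_U(2)[OF assms, of 0 b] unfolding u v by simp
qed

lemma planes:
  assumes hyp: "l1 \<noteq> l2 \<Longrightarrow> \<alpha> = 0" and F: "(u, v, d) \<in> planes"
  shows "right_coideal_subalg H \<Delta> (alg_gen H {u, v}) \<and> is_iterated_ore H u v d \<and> GK_dim H (alg_gen H {u, v}) = 2"
proof -
  consider "(u, v, d) = (Y, X, \<zero>\<^bsub>H\<^esub>)"
    | c where "(u, v, d) = (Y, Z \<oplus>\<^bsub>H\<^esub> c \<odot>\<^bsub>H\<^esub> X \<ominus>\<^bsub>H\<^esub> Y \<otimes>\<^bsub>H\<^esub> X, l2 \<odot>\<^bsub>H\<^esub> Y)"
    | b where "l1 \<noteq> l2" "(u, v, d) = (X, Z \<oplus>\<^bsub>H\<^esub> b \<odot>\<^bsub>H\<^esub> Y \<oplus>\<^bsub>H\<^esub> Y \<otimes>\<^bsub>H\<^esub> X, l1 \<odot>\<^bsub>H\<^esub> X)"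
    | a b where "l1 = l2" "\<alpha> = 0" "(u, v, d) = (X \<oplus>\<^bsub>H\<^esub> a \<odot>\<^bsub>H\<^esub> Y,
          Z \<oplus>\<^bsub>H\<^esub> b \<odot>\<^bsub>H\<^esub> Y \<oplus>\<^bsub>H\<^esub> a \<odot>\<^bsub>H\<^esub> (Y [^]\<^bsub>H\<^esub> (2::nat)) \<oplus>\<^bsub>H\<^esub> Y \<otimes>\<^bsub>H\<^esub> X,
          l1 \<odot>\<^bsub>H\<^esub> (X \<oplus>\<^bsub>H\<^esub> a \<odot>\<^bsub>H\<^esub> Y))"
    using F unfolding planes_def by (cases "l1 = l2"; cases "\<alpha> = 0"; simp only: if_True if_False simp_thms; blast)
  then show ?thesis
  proof cases
    case 1
    then show ?thesis unfolding prod.inject using right_coideal_XY ore_pair_XY by (elim conjE) (simp only: simp_thms)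
  next
    case (2 c)
    then show ?thesis unfolding prod.inject using right_coideal_YZ plane_Y by (elim conjE) (simp only: simp_thms)
  next
    case (3 b)
    then show ?thesis unfolding prod.inject using plane_X[OF hyp[OF 3(1)]] by (elim conjE) (simp only: simp_thms)
  next
    case (4 a b)
    then show ?thesis unfolding prod.inject using right_coideal_UZ plane_U[OF 4(2)] by (elim conjE) (simp only: simp_thms)
  qed
qed

definition "lines = {alg_gen H {a \<odot>\<^bsub>H\<^esub> X \<oplus>\<^bsub>H\<^esub> b \<odot>\<^bsub>H\<^esub> Y} | a b. (a, b) \<noteq> (0, 0)}"

lemma lines:
  assumes "S \<in> lines" shows "right_coideal_subalg H \<Delta> S" "GK_dim H S = 1"
proof -
  obtain a b where ab: "(a, b) \<noteq> (0, 0)" "S = alg_gen H {a \<odot>\<^bsub>H\<^esub> X \<oplus>\<^bsub>H\<^esub> b \<odot>\<^bsub>H\<^esub> Y}"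
    using assms unfolding lines_def by blast
  show "right_coideal_subalg H \<Delta> S" unfolding ab(2) by (rule right_coideal_line)
  show "GK_dim H S = 1" using GK_line[OF ab(1)] unfolding ev_lin_form ab(2) .
qed

lemma all_coideals:
  assumes hyp: "l1 \<noteq> l2 \<Longrightarrow> \<alpha> = 0"
  shows "{S. right_coideal_subalg H \<Delta> S} = {scalars H, carrier H} \<union> lines \<union> {alg_gen H {u, v} | u v d. (u, v, d) \<in> planes}"
    (is "?L = ?R")
proof (intro equalityI subsetI)
  fix S assume "S \<in> ?R"
  then consider "S = scalars H" | "S = carrier H" | "S \<in> lines" | u v d where "(u, v, d) \<in> planes" "S = alg_gen H {u, v}"
    by blast
  then show "S \<in> ?L"
    by cases (use right_coideal_scalars right_coideal_carrier lines(1) planes[OF hyp] in simp_all)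
next
  fix S assume "S \<in> ?L"
  then have S: "right_coideal_subalg H \<Delta> S" by simp
  show "S \<in> ?R"
  proof (rule coideal_cases[OF _ S])
    show "\<alpha> = 0" if "l1 \<noteq> l2" using that by (rule hyp)
    show "S \<in> ?R" if "S = scalars H" using that by blast
    show "S \<in> ?R" if "S = carrier H" using that by blast
    show "S \<in> ?R" if "(a, b) \<noteq> (0, 0)" "S = alg_gen H {a \<odot>\<^bsub>H\<^esub> X \<oplus>\<^bsub>H\<^esub> b \<odot>\<^bsub>H\<^esub> Y}" for a b
      using that unfolding lines_def by blast
    have "(Y, X, \<zero>\<^bsub>H\<^esub>) \<in> planes" unfolding planes_def by blast
    then show "S \<in> ?R" if "S = alg_gen H {Y, X}" using that by blast
    have "(Y, Z \<oplus>\<^bsub>H\<^esub> c \<odot>\<^bsub>H\<^esub> X \<ominus>\<^bsub>H\<^esub> Y \<otimes>\<^bsub>H\<^esub> X, l2 \<odot>\<^bsub>H\<^esub> Y) \<in> planes" for c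
      unfolding planes_def by blast
    then show "S \<in> ?R" if "S = alg_gen H {Y, Z \<oplus>\<^bsub>H\<^esub> c \<odot>\<^bsub>H\<^esub> X \<ominus>\<^bsub>H\<^esub> Y \<otimes>\<^bsub>H\<^esub> X}" for c using that by blast
    have "(X, Z \<oplus>\<^bsub>H\<^esub> b \<odot>\<^bsub>H\<^esub> Y \<oplus>\<^bsub>H\<^esub> Y \<otimes>\<^bsub>H\<^esub> X, l1 \<odot>\<^bsub>H\<^esub> X) \<in> planes" if "l1 \<noteq> l2" for b
      unfolding planes_def if_P[OF that] by blast
    then show "S \<in> ?R" if "l1 \<noteq> l2" "S = alg_gen H {X, Z \<oplus>\<^bsub>H\<^esub> b \<odot>\<^bsub>H\<^esub> Y \<oplus>\<^bsub>H\<^esub> Y \<otimes>\<^bsub>H\<^esub> X}" for b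
      using that by blast
    have "(X \<oplus>\<^bsub>H\<^esub> a \<odot>\<^bsub>H\<^esub> Y,
          Z \<oplus>\<^bsub>H\<^esub> b \<odot>\<^bsub>H\<^esub> Y \<oplus>\<^bsub>H\<^esub> a \<odot>\<^bsub>H\<^esub> (Y [^]\<^bsub>H\<^esub> (2::nat)) \<oplus>\<^bsub>H\<^esub> Y \<otimes>\<^bsub>H\<^esub> X,
          l1 \<odot>\<^bsub>H\<^esub> (X \<oplus>\<^bsub>H\<^esub> a \<odot>\<^bsub>H\<^esub> Y)) \<in> planes" if "l1 = l2" "\<alpha> = 0" for a b
      unfolding planes_def if_P[OF conjI[OF that]] by blast
    then show "S \<in> ?R" if "l1 = l2" "\<alpha> = 0"
      "S = alg_gen H {X \<oplus>\<^bsub>H\<^esub> a \<odot>\<^bsub>H\<^esub> Y, Z \<oplus>\<^bsub>H\<^esub> b \<odot>\<^bsub>H\<^esub> Y \<oplus>\<^bsub>H\<^esub> a \<odot>\<^bsub>H\<^esub> (Y [^]\<^bsub>H\<^esub> (2::nat)) \<oplus>\<^bsub>H\<^esub> Y \<otimes>\<^bsub>H\<^esub> X}" for a b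
      using that by blast
  qed
qed

text \<open>The four families have dimension at most 0, at least 3, exactly 1 and exactly 2, so
  fixing the dimension singles out one of them.\<close>

lemma coideals_by_dim:
  assumes hyp: "l1 \<noteq> l2 \<Longrightarrow> \<alpha> = 0"
  shows "{S. right_coideal_subalg H \<Delta> S \<and> GK_dim H S = 1} = lines"
    "{S. right_coideal_subalg H \<Delta> S \<and> GK_dim H S = 2} = {alg_gen H {u, v} | u v d. (u, v, d) \<in> planes}"
proof -
  have c: "S = scalars H \<and> GK_dim H S \<le> 0 \<or> S = carrier H \<and> 3 \<le> GK_dim H S \<or> S \<in> lines \<and> GK_dim H S = 1
      \<or> S \<in> {alg_gen H {u, v} | u v d. (u, v, d) \<in> planes} \<and> GK_dim H S = 2" if "right_coideal_subalg H \<Delta> S" for S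
  proof -
    have "S \<in> {scalars H, carrier H} \<union> lines \<union> {alg_gen H {u, v} | u v d. (u, v, d) \<in> planes}"
      using that all_coideals[OF hyp] by blast
    then consider "S = scalars H" | "S = carrier H" | "S \<in> lines" | u v d where "(u, v, d) \<in> planes" "S = alg_gen H {u, v}"
      by blast
    then show ?thesis
    proof cases
      case 1 then show ?thesis using GK_scalars by simp
    next
      case 2 then show ?thesis using GK_H by simp
    next
      case 3 then show ?thesis using lines(2) by simp
    next
      case (4 u v d)
      then have "GK_dim H S = 2" using planes[OF hyp] by simp
      then show ?thesis using 4 by blast
    qed
  qed
  have n: "\<not> (1 :: ereal) \<le> 0" "\<not> (3 :: ereal) \<le> 1" "(1 :: ereal) \<noteq> 2" "\<not> (2 :: ereal) \<le> 0" "\<not> (3 :: ereal) \<le> 2"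
    by (simp_all add: one_ereal_def zero_ereal_def numeral_eq_ereal)
  show "{S. right_coideal_subalg H \<Delta> S \<and> GK_dim H S = 1} = lines"
  proof (intro equalityI subsetI)
    fix S assume "S \<in> {S. right_coideal_subalg H \<Delta> S \<and> GK_dim H S = 1}"
    then have S: "right_coideal_subalg H \<Delta> S" "GK_dim H S = 1" by simp_all
    then show "S \<in> lines" using c[OF S(1)] n by auto
  next
    fix S assume "S \<in> lines"
    then show "S \<in> {S. right_coideal_subalg H \<Delta> S \<and> GK_dim H S = 1}" using lines by simp
  qed
  show "{S. right_coideal_subalg H \<Delta> S \<and> GK_dim H S = 2} = {alg_gen H {u, v} | u v d. (u, v, d) \<in> planes}"
  proof (intro equalityI subsetI)
    fix S assume "S \<in> {S. right_coideal_subalg H \<Delta> S \<and> GK_dim H S = 2}"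
    then have S: "right_coideal_subalg H \<Delta> S" "GK_dim H S = 2" by simp_all
    then show "S \<in> {alg_gen H {u, v} | u v d. (u, v, d) \<in> planes}" using c[OF S(1)] n by auto
  next
    fix S assume "S \<in> {alg_gen H {u, v} | u v d. (u, v, d) \<in> planes}"
    then obtain u v d where "(u, v, d) \<in> planes" "S = alg_gen H {u, v}" by blast
    then show "S \<in> {S. right_coideal_subalg H \<Delta> S \<and> GK_dim H S = 2}" using planes[OF hyp] by simp
  qed
qed

text \<open>If u' is a polynomial in u, the derivation transversal to u kills u', which says ab' =
  ba'. Conversely, proportional forms lie in each other's subalgebra.\<close>

lemma lines_eq_iff:
  assumes ab: "(a, b) \<noteq> (0, 0)" "(a', b') \<noteq> (0, 0)"
  shows "alg_gen H {a \<odot>\<^bsub>H\<^esub> X \<oplus>\<^bsub>H\<^esub> b \<odot>\<^bsub>H\<^esub> Y} = alg_gen H {a' \<odot>\<^bsub>H\<^esub> X \<oplus>\<^bsub>H\<^esub> b' \<odot>\<^bsub>H\<^esub> Y}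
    \<longleftrightarrow> (\<exists>t. t \<noteq> 0 \<and> a' = t * a \<and> b' = t * b)"
  unfolding ev_lin_form[symmetric]
proof
  assume eq: "alg_gen H {ev (lin_form a b)} = alg_gen H {ev (lin_form a' b')}"
  have "ev (lin_form a' b') \<in> alg_gen H {ev (lin_form a b)}"
    unfolding eq by (rule subsetD[OF H.alg_gen_superset]) simp
  then obtain r where r: "ev (lin_form a' b') = ev r" "dtransv a b r = 0" unfolding alg_gen_line[OF ab(1)] by blast
  then have "dtransv a b (lin_form a' b') = 0" unfolding ev_eq_iff by simp
  then have "cst a * cst b' - cst b * cst a' = 0" unfolding dtransv_def d_lin_form .
  then have e: "a * b' = b * a'" by simp
  show "\<exists>t. t \<noteq> 0 \<and> a' = t * a \<and> b' = t * b"
  proof (cases "a = 0")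
    case True
    then have "b \<noteq> 0" "a' = 0" using ab e by auto
    then show ?thesis using ab True by (intro exI[of _ "b' / b"]) auto
  next
    case False
    have "a' \<noteq> 0"
    proof
      assume "a' = 0"
      then have "b' = 0" using e False by simp
      then show False using ab(2) \<open>a' = 0\<close> by simp
    qed
    then show ?thesis using False e by (intro exI[of _ "a' / a"]) (simp add: field_simps)
  qed
next
  assume "\<exists>t. t \<noteq> 0 \<and> a' = t * a \<and> b' = t * b"
  then obtain t where t: "t \<noteq> 0" "a' = t * a" "b' = t * b" by blast
  have sub: "alg_gen H {ev (lin_form (s * c) (s * d))} \<subseteq> alg_gen H {ev (lin_form c d)}" for s c d
  proof (rule H.alg_gen_least)
    show G: "subalg (alg_gen H {ev (lin_form c d)}) H" by (rule H.subalg_alg_gen) simp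
    have "ev (lin_form (s * c) (s * d)) = s \<odot>\<^bsub>H\<^esub> ev (lin_form c d)"
      unfolding ev_lin_form by (simp add: H.smult_add_right H.smult_smult)
    moreover have "ev (lin_form c d) \<in> alg_gen H {ev (lin_form c d)}" by (rule subsetD[OF H.alg_gen_superset]) simp
    ultimately show "{ev (lin_form (s * c) (s * d))} \<subseteq> alg_gen H {ev (lin_form c d)}"
      using H.subalgD(5)[OF G] by simp
  qed
  have "alg_gen H {ev (lin_form a b)} \<subseteq> alg_gen H {ev (lin_form a' b')}"
    using sub[of "1 / t" a' b'] t by simp
  then show "alg_gen H {ev (lin_form a b)} = alg_gen H {ev (lin_form a' b')}"
    using sub[of t a b] t by (intro equalityI) simp_all
qed

end

theorem mainTheorem5:
  fixes l1 l2 \<alpha> :: "'k::field_char_0"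
    and H :: "('k, (gen list \<Rightarrow>\<^sub>0 'k) set) module" (structure)
  assumes "l1 \<noteq> l2 \<Longrightarrow> \<alpha> = 0"
    and "l1 = l2 \<Longrightarrow> \<alpha> \<in> {0, 1}"
    and H: "H = HA l1 l2 \<alpha>"
    and \<Delta>: "\<Delta> = HA_comult l1 l2 \<alpha>"
    and z1: "z1 = HA_gen l1 l2 \<alpha> GY"
    and z2: "z2 = HA_gen l1 l2 \<alpha> GX"
    and z3: "z3 = HA_gen l1 l2 \<alpha> GZ"
    \<comment> \<open>The generators of the algebras in GK-dimension 1, and the triples \<open>(u, v, \<delta>(u))\<close> for the
      algebras \<open>\<bbbk>[u][v; \<delta>]\<close> in GK-dimension 2.\<close>
    and L: "L = (\<lambda>a b. a \<odot> z2 \<oplus> b \<odot> z1)"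
    and F1: "F1 = {(z1, z2, \<zero>)}"
    and F2: "F2 = {(z1, z3 \<oplus> c \<odot> z2 \<ominus> z1 \<otimes> z2, l2 \<odot> z1) | c. True}"
    and F3: "F3 = {(z2, z3 \<oplus> b \<odot> z1 \<oplus> z1 \<otimes> z2, l1 \<odot> z2) | b. True}"
    and F4: "F4 = {(z2 \<oplus> a \<odot> z1,
                    z3 \<oplus> b \<odot> z1 \<oplus> a \<odot> (z1 [^] (2::nat)) \<oplus> z1 \<otimes> z2,
                    l1 \<odot> (z2 \<oplus> a \<odot> z1)) | a b. True}"
    and F: "F = F1 \<union> F2 \<union> (if l1 \<noteq> l2 then F3 else {})
                  \<union> (if l1 = l2 \<and> \<alpha> = 0 then F4 else {})"
  shows "{S. right_coideal_subalg H \<Delta> S} =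
           {scalars H, carrier H}
           \<union> {alg_gen H {L a b} | a b. (a, b) \<noteq> (0, 0)}
           \<union> {alg_gen H {u, v} | u v d. (u, v, d) \<in> F} \<and>
         {S. right_coideal_subalg H \<Delta> S \<and> GK_dim H S = 1} =
           {alg_gen H {L a b} | a b. (a, b) \<noteq> (0, 0)} \<and>
         {S. right_coideal_subalg H \<Delta> S \<and> GK_dim H S = 2} =
           {alg_gen H {u, v} | u v d. (u, v, d) \<in> F} \<and>
         (\<forall>a b. (a, b) \<noteq> (0, 0) \<longrightarrow> is_polynomial_alg H (L a b) (alg_gen H {L a b})) \<and>
         (\<forall>a b a' b'. (a, b) \<noteq> (0, 0) \<longrightarrow> (a', b') \<noteq> (0, 0) \<longrightarrow>
           (alg_gen H {L a b} = alg_gen H {L a' b'} \<longleftrightarrow>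
             (\<exists>t. t \<noteq> 0 \<and> a' = t * a \<and> b' = t * b))) \<and>
         (\<forall>u v d. (u, v, d) \<in> F \<longrightarrow> is_iterated_ore H u v d) \<and>
         (l1 = l2 \<and> \<alpha> = 1 \<longrightarrow>
           {S. right_coideal_subalg H \<Delta> S \<and> GK_dim H S = 2} =
           {alg_gen H {u, v} | u v d. (u, v, d) \<in> F1 \<union> F2})"
proof -
  interpret A: ha l1 l2 \<alpha> .
  have z: "z1 = A.Y" "z2 = A.X" "z3 = A.Z"
    by (simp_all only: z1 z2 z3 A.X_def A.Y_def A.Z_def)
  have hyp: "l1 \<noteq> l2 \<Longrightarrow> \<alpha> = 0" by fact
  have planes: "F = A.planes"
    unfolding F F1 F2 F3 F4 A.planes_def z H ..
  have L_ev: "L a b = A.ev (lin_form a b)" for a b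
    unfolding A.ev_lin_form L z H ..
  have lines: "{alg_gen H {L a b} | a b. (a, b) \<noteq> (0, 0)} = A.lines"
    unfolding A.lines_def L_ev A.ev_lin_form H ..
  \<comment> \<open>The equation l1 = l2 discards \<open>F3\<close>, and \<alpha> = 1 differs from
    0, which discards \<open>F4\<close>.\<close>
  have planes_1: "F1 \<union> F2 = A.planes" if "l1 = l2 \<and> \<alpha> = 1"
    unfolding planes[symmetric] F using that[THEN conjunct1] that[THEN conjunct2] by (simp only: one_neq_zero simp_thms if_False Un_empty_right)
  let ?H = "HA l1 l2 \<alpha>"
  let ?D = "HA_comult l1 l2 \<alpha>"
  have all: "{S. right_coideal_subalg ?H ?D S} = {scalars ?H, carrier ?H} \<union> A.lines
      \<union> {alg_gen ?H {u, v} | u v d. (u, v, d) \<in> A.planes}"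
    by (rule A.all_coideals) (rule hyp)
  have dim_1: "{S. right_coideal_subalg ?H ?D S \<and> GK_dim ?H S = 1} = A.lines"
    by (rule A.coideals_by_dim(1)) (rule hyp)
  have dim_2: "{S. right_coideal_subalg ?H ?D S \<and> GK_dim ?H S = 2}
      = {alg_gen ?H {u, v} | u v d. (u, v, d) \<in> A.planes}"
    by (rule A.coideals_by_dim(2)) (rule hyp)
  have ore: "is_iterated_ore ?H u v d" if "(u, v, d) \<in> A.planes" for u v d
    by (rule A.planes[OF _ that, THEN conjunct2, THEN conjunct1]) (rule hyp)
  show ?thesis
    unfolding lines planes unfolding H \<Delta> L_ev
  proof (intro conjI allI impI)
    fix a b :: 'k assume "(a, b) \<noteq> (0, 0)"
    then show "is_polynomial_alg ?H (A.ev (lin_form a b)) (alg_gen ?H {A.ev (lin_form a b)})"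
      by (rule A.polynomial_alg_line)
  next
    fix a b a' b' :: 'k assume "(a, b) \<noteq> (0, 0)" "(a', b') \<noteq> (0, 0)"
    then show "(alg_gen ?H {A.ev (lin_form a b)} = alg_gen ?H {A.ev (lin_form a' b')})
        = (\<exists>t. t \<noteq> 0 \<and> a' = t * a \<and> b' = t * b)"
      unfolding A.ev_lin_form by (rule A.lines_eq_iff)
  next
    assume "l1 = l2 \<and> \<alpha> = 1"
    then have "F1 \<union> F2 = A.planes" by (rule planes_1)
    then show "{S. right_coideal_subalg ?H ?D S \<and> GK_dim ?H S = 2}
        = {alg_gen ?H {u, v} | u v d. (u, v, d) \<in> F1 \<union> F2}"
      unfolding dim_2 by (simp only:)
  qed (fact all dim_1 dim_2 ore)+
qed

end
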